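(* Let $u(x,y)=x(1-x)y(1-y)$, which is the solution of the Poisson problem $-\Delta u(x,y)=f(x,y):=2(x(1-x)+y(1-y))$ on $\Omega=[0,1]^2$ with homogeneous Dirichlet boundary conditions. For integers $m\ge n\ge 1$ let $u_{n,m}\in V_{n,m}$ be the nonconforming P1 Galerkin solution of this problem with respect to the triangulation $\mathcal{T}_{n,m}$, and let $E_{n,m}=|u-u_{n,m}|_{H^1,\mathcal{T}_{n,m}}$ be its discrete $H^1$ error. Then there exist constants $C_4,C_4'>0$, independent of $n$ and $m$, such that $$ C_4'\min\left(1,\frac{m}{n^2}\right)\le E_{n,m}\le C_4\min\left(1,\frac{m}{n^2}\right)\qquad\text{for all integers } m\ge n\ge 1. $$ In particular, if for a sequence of triangulations $\mathcal{T}_{n,m}$ with $m\ge n$ and $n\to\infty$ the Galerkin solutions converge, i.e. $E_{n,m}\to 0$ along the sequence, then necessarily $m/n^2\to 0$ along the sequence.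
   Context: **Triangulations.** For integers $m\ge n\ge 1$, $\mathcal{T}_{n,m}$ is the triangulation of $\Omega=[0,1]^2$ into closed triangles generated by intersecting $[0,1]^2$ with the three systems of lines $y=\frac{j}{2m}$ ($j=1,\dots,2m-1$); $y=\frac nm x+\frac jm$ ($j=1-m,\dots,m-1$); $y=-\frac nm x+\frac jm$ ($j=1,\dots,2m-1$). Its vertices are the points $P_{i,j}=(\frac{i}{2n},\frac{j}{2m})$, where $i=0,2,\dots,2n$ if $j\in\{0,2,\dots,2m\}$ is even, and $i=0,1,3,\dots,2n-1,2n$ if $j\in\{1,3,\dots,2m-1\}$ is odd. A typical triangle has a horizontal longest edge of length $1/n$, corresponding height $1/(2m)$, and two other sides of equal length; the exceptional triangles along the vertical sides of the square are right-angled with legs $1/(2n)$ (horizontal) and $1/(2m)$ (vertical). **Nonconforming P1 space.** $V_{n,m}$ is the space of functions $v$ that are a linear polynomial on each triangle of $\mathcal{T}_{n,m}$ (in general discontinuous across edges), are continuous across the midpoints of interior edges (equivalently, the traces of $v$ from the two triangles sharing an interior edge $e$ have the same integral over $e$), and vanish at the midpoints of boundary edges. **Discrete norm.** For a function $v$ with $v|_\Delta\in H^1(\Delta)$ for all $\Delta\in\mathcal{T}_{n,m}$, $$|v|_{H^1,\mathcal{T}_{n,m}}=\Big(\sum_{\Delta\in\mathcal{T}_{n,m}}\int_\Delta|\nabla v|^2\,dxdy\Big)^{1/2},$$ with associated bilinear form $(v,w)_{H^1,\mathcal{T}_{n,m}}=\sum_{\Delta\in\mathcal{T}_{n,m}}\int_\Delta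 \nabla v\cdot\nabla w\,dxdy$. **Galerkin solution.** $u_{n,m}\in V_{n,m}$ is the unique element with $(u_{n,m},v)_{H^1,\mathcal{T}_{n,m}}=(f,v)_{L_2(\Omega)}$ for all $v\in V_{n,m}$. *)

theory Defs
  imports "HOL-Analysis.Analysis"
begin

definition unit_square :: "(real \<times> real) set" where
  "unit_square = {0..1} \<times> {0..1}"

definition grid_lines :: "nat \<Rightarrow> nat \<Rightarrow> (real \<times> real) set set" where
  "grid_lines n m =
     (\<lambda>j. {(x, y). y = of_int j / (2 * real m)}) ` {1 .. 2 * int m - 1} \<union>
     (\<lambda>j. {(x, y). y = real n / real m * x + of_int j / real m}) ` {1 - int m .. int m - 1} \<union>
     (\<lambda>j. {(x, y). y = - (real n / real m) * x + of_int j / real m}) ` {1 .. 2 * int m - 1}"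

definition triangulation :: "nat \<Rightarrow> nat \<Rightarrow> (real \<times> real) set set" where
  "triangulation n m = closure ` components (interior unit_square - \<Union> (grid_lines n m))"

definition linear_polynomial :: "(real \<times> real \<Rightarrow> real) \<Rightarrow> bool" where
  "linear_polynomial p \<longleftrightarrow> (\<exists>a b c. \<forall>x y. p (x, y) = a + b * x + c * y)"

text \<open>
  An element of the nonconforming space is discontinuous across edges, so it is represented by a
  function on the plane that is determined by its linear polynomials \<open>p \<Delta>\<close> on the open triangles;
  \<open>p \<Delta>\<close> also provides the trace from \<open>\<Delta>\<close> on the edges of \<open>\<Delta>\<close>. The last clause fixes the otherwise
  irrelevant values on the null set of edges (and outside the square) to be zero, so that each
  element of the space has exactly one representative. An interior edge is one shared by two
  triangles, a boundary edge one that lies in the boundary of the square.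
\<close>

definition nonconforming_P1 :: "nat \<Rightarrow> nat \<Rightarrow> (real \<times> real \<Rightarrow> real) set" where
  "nonconforming_P1 n m = {v. \<exists>p.
     (\<forall>\<Delta> \<in> triangulation n m. linear_polynomial (p \<Delta>) \<and> (\<forall>z \<in> interior \<Delta>. v z = p \<Delta> z)) \<and>
     (\<forall>\<Delta> \<in> triangulation n m. \<forall>\<Delta>' \<in> triangulation n m. \<forall>a b.
        closed_segment a b edge_of \<Delta> \<and> closed_segment a b edge_of \<Delta>' \<longrightarrow>
        p \<Delta> (midpoint a b) = p \<Delta>' (midpoint a b)) \<and>
     (\<forall>\<Delta> \<in> triangulation n m. \<forall>a b.
        closed_segment a b edge_of \<Delta> \<and> closed_segment a b \<subseteq> frontier unit_square \<longrightarrow>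
        p \<Delta> (midpoint a b) = 0) \<and>
     (\<forall>z. z \<notin> (\<Union>\<Delta> \<in> triangulation n m. interior \<Delta>) \<longrightarrow> v z = 0)}"

definition gradient :: "(real \<times> real \<Rightarrow> real) \<Rightarrow> real \<times> real \<Rightarrow> real \<times> real" where
  "gradient v z = (THE D. GDERIV v z :> D)"

text \<open>
  The integrals are taken over the open triangles, where the piecewise smooth functions of interest
  have a classical gradient; the edges are null sets.
\<close>

definition broken_form ::
    "nat \<Rightarrow> nat \<Rightarrow> (real \<times> real \<Rightarrow> real) \<Rightarrow> (real \<times> real \<Rightarrow> real) \<Rightarrow> real" where
  "broken_form n m v w =
     (\<Sum>\<Delta> \<in> triangulation n m. LINT z : interior \<Delta> | lebesgue. gradient v z \<bullet> gradient w z)"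

definition broken_seminorm :: "nat \<Rightarrow> nat \<Rightarrow> (real \<times> real \<Rightarrow> real) \<Rightarrow> real" where
  "broken_seminorm n m v = sqrt (broken_form n m v v)"

definition galerkin_solution ::
    "nat \<Rightarrow> nat \<Rightarrow> (real \<times> real \<Rightarrow> real) \<Rightarrow> real \<times> real \<Rightarrow> real" where
  "galerkin_solution n m f =
     (THE u. u \<in> nonconforming_P1 n m \<and>
        (\<forall>v \<in> nonconforming_P1 n m.
           broken_form n m u v = (LINT z : unit_square | lebesgue. f z * v z)))"

text \<open>
  Classical solutions of the homogeneous Dirichlet problem for \<open>-\<Delta>w = f\<close> on the unit square.
  The derivative \<open>H z\<close> of the gradient field \<open>g\<close> is the Hessian, and its trace is the Laplacian.
\<close>

definition poisson_solution ::
    "(real \<times> real \<Rightarrow> real) \<Rightarrow> (real \<times> real \<Rightarrow> real) \<Rightarrow> bool" where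
  "poisson_solution f w \<longleftrightarrow>
     continuous_on unit_square w \<and>
     (\<forall>z \<in> frontier unit_square. w z = 0) \<and>
     (\<exists>g H. \<forall>z \<in> interior unit_square.
        (GDERIV w z :> g z) \<and> (g has_derivative H z) (at z) \<and>
        - (\<Sum>b \<in> Basis. H z b \<bullet> b) = f z)"

definition u_exact :: "real \<times> real \<Rightarrow> real" where
  "u_exact = (\<lambda>(x, y). x * (1 - x) * y * (1 - y))"

definition f_rhs :: "real \<times> real \<Rightarrow> real" where
  "f_rhs = (\<lambda>(x, y). 2 * (x * (1 - x) + y * (1 - y)))"

definition galerkin_error :: "nat \<Rightarrow> nat \<Rightarrow> real" where
  "galerkin_error n m =
     broken_seminorm n m (\<lambda>z. u_exact z - galerkin_solution n m f_rhs z)"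

end

theory Submission
  imports Defs
begin

text \<open>
Write \<open>h = 1 / n\<close> and \<open>k = 1 / (2 * m)\<close> for the width and the height of a typical cell. The quantity
\<open>m / n^2\<close> is \<open>h^2 / (2 * k)\<close>: it measures how far a difference quotient over the distance \<open>k\<close> can
magnify a second order error \<open>h^2\<close>.

In a horizontal strip all slanted edges have their midpoints on the midline of the
strip. A nonconforming function is therefore, on each midline, an ordinary continuous piecewise
linear function with zero end values, and in each cell its vertical slope is determined by one further
number, the value at the midpoint of the horizontal edge (\<open>nonconforming_P1_eq\<close>). So the discrete
Poincare inequality is the one for functions of the single variable \<open>x\<close>, with a constant that
does not see the anisotropy (\<open>poincare\<close>).

Let \<open>L v = (u, v) - (f, v)\<close> be the consistency functional, with the broken form in the
first term. The squared distance of \<open>u\<close> from a discrete function is a quadratic function of the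
latter, and expanding it at the Galerkin solution gives \<open>\<bar>L v\<bar> \<le> E * \<bar>v\<bar>\<close> for every discrete \<open>v\<close>, and
\<open>E^2 \<le> \<bar>u - I\<bar>^2 + K^2\<close> whenever \<open>I\<close> is discrete and \<open>\<bar>L v\<bar> \<le> K * \<bar>v\<bar>\<close> for all discrete \<open>v\<close>
(\<open>error_lower_bound\<close>, \<open>error_upper_bound\<close>).

For the upper bound, \<open>L v\<close> is an integral over the boundaries of the cells. Replacing \<open>\<nabla>u\<close> on each edge by
its value at the midpoint makes the sum of these integrals vanish, since \<open>v\<close> is continuous at the
midpoints and zero at those on the boundary. The error committed in one cell is at most \<open>h^3\<close> times the
coefficients of \<open>v\<close> there, while the area of the cell is of order \<open>h * k\<close>; so \<open>K\<close> is of order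
\<open>h^2 / k\<close> (\<open>consistency_bound\<close>). Midpoint interpolation has an error of the same order
(\<open>interp_gradient_error\<close>), and stability bounds the error by a constant (\<open>error_stability\<close>).

For the lower bound, let \<open>v\<close> have values of alternating sign at the nodes of a midline, shifted by one node from
one strip to the next, and the value zero at the horizontal edges. The two node values of a cell nearly cancel,
so the vertical slope of \<open>v\<close> is small. But its horizontal slope jumps across every horizontal edge, and
the jumps have the same sign wherever the amplitude of \<open>v\<close> has. Such a jump \<open>J\<close> contributes \<open>J * h^3 / 12\<close>
times the mixed derivative of \<open>u\<close> to \<open>L v\<close>, of which the slanted edges take back only about a quarter if \<open>k\<close> is small. The amplitude
is chosen with the sign of the mixed derivative \<open>(1 - 2 * x) * (1 - 2 * y)\<close>, so that the
contributions of all horizontal edges add up (\<open>osc_gain_lower\<close>). The energy of \<open>v\<close> grows only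
when \<open>h^2 / k\<close> is large (\<open>energy_osc\<close>), and both regimes of the minimum follow from this single function
(\<open>galerkin_error_lower\<close>).
\<close>

section \<open>The Poisson problem on the square\<close>

lemma interior_unit_square: "interior unit_square = {0<..<1} \<times> {0<..<1}"
  unfolding unit_square_def interior_Times by simp

lemma unit_square_cbox: "unit_square = cbox (0,0) (1,1)"
  unfolding unit_square_def by (simp add: cbox_Pair_eq)

lemma compact_unit_square: "compact unit_square"
  unfolding unit_square_cbox by (rule compact_cbox)

lemma frontier_unit_square:
  "frontier unit_square = {(x, y). (x, y) \<in> unit_square \<and> (x = 0 \<or> x = 1 \<or> y = 0 \<or> y = 1)}"
  using compact_unit_square
  unfolding frontier_def interior_unit_square
  by (auto simp: compact_imp_closed unit_square_def)

definition u_grad :: "real \<times> real \<Rightarrow> real \<times> real" where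
  "u_grad = (\<lambda>(x, y). ((1 - 2 * x) * (y * (1 - y)), x * (1 - x) * (1 - 2 * y)))"

lemma gderiv_u_exact: "GDERIV u_exact z :> u_grad z"
proof -
  have "((\<lambda>z. fst z * (1 - fst z) * snd z * (1 - snd z)) has_derivative
         (\<lambda>h. h \<bullet> u_grad z)) (at z)"
    by (rule derivative_eq_intros refl | force simp: u_grad_def inner_prod_def split_def algebra_simps)+
  moreover have "u_exact = (\<lambda>z. fst z * (1 - fst z) * snd z * (1 - snd z))"
    by (auto simp: u_exact_def)
  ultimately show ?thesis
    by (simp add: gderiv_def)
qed

lemma poisson_u_exact: "poisson_solution f_rhs u_exact"
proof -
  define H :: "real \<times> real \<Rightarrow> real \<times> real \<Rightarrow> real \<times> real" where
    "H = (\<lambda>z h. (- 2 * fst h * (snd z * (1 - snd z)) + (1 - 2 * fst z) * (1 - 2 * snd z) * snd h,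
                 (1 - 2 * fst z) * (1 - 2 * snd z) * fst h - 2 * fst z * (1 - fst z) * snd h))"
  have cont: "continuous_on unit_square u_exact"
    unfolding u_exact_def split_def by (intro continuous_intros)
  have zero: "u_exact z = 0" if "z \<in> frontier unit_square" for z
    using that by (auto simp: frontier_unit_square u_exact_def)
  have der: "(u_grad has_derivative H z) (at z)" for z
  proof -
    have "((\<lambda>z. ((1 - 2 * fst z) * (snd z * (1 - snd z)), fst z * (1 - fst z) * (1 - 2 * snd z)))
            has_derivative H z) (at z)"
      unfolding H_def
      by (rule has_derivative_Pair; (rule derivative_eq_intros refl | force simp: algebra_simps)+)
    moreover have "u_grad = (\<lambda>z. ((1 - 2 * fst z) * (snd z * (1 - snd z)), fst z * (1 - fst z) * (1 - 2 * snd z)))"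
      by (auto simp: u_grad_def)
    ultimately show ?thesis by simp
  qed
  have tr: "- (\<Sum>b \<in> Basis. H z b \<bullet> b) = f_rhs z" for z
    by (simp add: H_def Basis_prod_def sum.union_disjoint f_rhs_def split_def algebra_simps)
  show ?thesis
    unfolding poisson_solution_def using cont zero der tr gderiv_u_exact by blast
qed

text \<open>
Only a derivative of \<open>\<psi>'\<close> at the maximum itself is available, since the Hessian of a classical
solution need not be continuous; monotonicity of \<open>\<psi>'\<close> near a point is replaced by its sign next to the
point.
\<close>

lemma second_derivative_nonpos_at_max:
  fixes \<psi> \<psi>' :: "real \<Rightarrow> real"
  assumes r: "r > 0"
    and d: "\<And>t. \<bar>t\<bar> < r \<Longrightarrow> (\<psi> has_real_derivative \<psi>' t) (at t)"
    and d2: "(\<psi>' has_real_derivative c) (at 0)"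
    and mx: "\<And>t. \<bar>t\<bar> < r \<Longrightarrow> \<psi> t \<le> \<psi> 0"
  shows "c \<le> 0"
proof (rule ccontr)
  assume "\<not> c \<le> 0"
  then obtain e where e: "e > 0" "\<And>t. 0 < t \<Longrightarrow> t < e \<Longrightarrow> \<psi>' t > \<psi>' 0"
    using DERIV_pos_inc_right[OF d2] by auto
  have z: "\<psi>' 0 = 0"
    by (rule DERIV_local_max[OF d[of 0] r]) (use mx r in auto)
  define t where "t = min e r / 2"
  have t: "0 < t" "t < e" "t < r" using e r by (auto simp: t_def)
  obtain x where x: "0 < x" "x < t" "\<psi> t - \<psi> 0 = (t - 0) * \<psi>' x"
    using MVT2[of 0 t \<psi> \<psi>'] t d by auto
  have "\<psi>' x > 0" using e(2)[of x] x t z by auto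
  then have "(t - 0) * \<psi>' x > 0" using t by simp
  then show False using x(3) mx[of t] t by simp
qed

text \<open>
The weak maximum principle. If the difference were positive somewhere, then after adding a small
multiple of \<open>x^2 + y^2\<close> it would still have its maximum inside the square; there the Laplacian is
at most zero, but it equals four times that multiple.
\<close>

lemma poisson_comparison:
  assumes w: "poisson_solution f w" and v: "poisson_solution f v" and z0: "z0 \<in> unit_square"
  shows "w z0 \<le> v z0"
proof (rule ccontr)
  assume "\<not> w z0 \<le> v z0"
  then have pos: "w z0 - v z0 > 0" by simp
  obtain g H where gH: "\<And>z. z \<in> interior unit_square \<Longrightarrow> GDERIV w z :> g z"
      "\<And>z. z \<in> interior unit_square \<Longrightarrow> (g has_derivative H z) (at z)"
      "\<And>z. z \<in> interior unit_square \<Longrightarrow> - (\<Sum>b \<in> Basis. H z b \<bullet> b) = f z"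
    using w unfolding poisson_solution_def by blast
  obtain g' H' where gH': "\<And>z. z \<in> interior unit_square \<Longrightarrow> GDERIV v z :> g' z"
      "\<And>z. z \<in> interior unit_square \<Longrightarrow> (g' has_derivative H' z) (at z)"
      "\<And>z. z \<in> interior unit_square \<Longrightarrow> - (\<Sum>b \<in> Basis. H' z b \<bullet> b) = f z"
    using v unfolding poisson_solution_def by blast
  \<comment> \<open>On the boundary \<open>\<phi>\<close> is at most \<open>2 * \<epsilon>\<close>, and at \<open>z0\<close> at least \<open>4 * \<epsilon>\<close>.\<close>
  define \<epsilon> where "\<epsilon> = (w z0 - v z0) / 4"
  have \<epsilon>: "\<epsilon> > 0" using pos by (simp add: \<epsilon>_def)
  define \<phi> where "\<phi> = (\<lambda>z. w z - v z + \<epsilon> * (z \<bullet> z))"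
  have "continuous_on unit_square \<phi>"
    using w v unfolding \<phi>_def poisson_solution_def by (intro continuous_intros) auto
  moreover have "unit_square \<noteq> {}" using z0 by auto
  ultimately obtain z1 where z1: "z1 \<in> unit_square" "\<And>z. z \<in> unit_square \<Longrightarrow> \<phi> z \<le> \<phi> z1"
    using continuous_attains_sup[OF compact_unit_square] by blast
  have z1i: "z1 \<in> interior unit_square"
  proof (rule ccontr)
    assume "z1 \<notin> interior unit_square"
    then have fr: "z1 \<in> frontier unit_square"
      using z1(1) closure_subset by (auto simp: frontier_def)
    then have "w z1 = 0" "v z1 = 0" using w v unfolding poisson_solution_def by auto
    moreover have "z1 \<bullet> z1 \<le> 2"
    proof -
      have "fst z1 \<in> {0..1}" "snd z1 \<in> {0..1}" using z1(1) by (auto simp: unit_square_def)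
      then have "fst z1 * fst z1 \<le> 1" "snd z1 * snd z1 \<le> 1"
        by (auto intro: mult_le_one)
      then show ?thesis by (simp add: inner_prod_def)
    qed
    ultimately have "\<phi> z1 \<le> \<epsilon> * 2"
      using \<epsilon> by (simp add: \<phi>_def)
    moreover have "\<phi> z0 \<ge> 4 * \<epsilon>" using \<epsilon> by (simp add: \<phi>_def \<epsilon>_def)
    ultimately show False using z1(2)[OF z0] \<epsilon> by simp
  qed
  obtain r where r: "r > 0" "ball z1 r \<subseteq> interior unit_square"
    using z1i open_interior openE by blast
  have each: "(H z1 b - H' z1 b) \<bullet> b + 2 * \<epsilon> \<le> 0" if b: "b \<in> Basis" for b
  proof (rule second_derivative_nonpos_at_max[OF r(1)])
    have inb: "z1 + t *\<^sub>R b \<in> interior unit_square" if "\<bar>t\<bar> < r" for t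
    proof -
      have "z1 + t *\<^sub>R b \<in> ball z1 r" using that b by (simp add: dist_norm)
      then show ?thesis using r(2) by blast
    qed
    show "((\<lambda>t. \<phi> (z1 + t *\<^sub>R b)) has_real_derivative
            ((g (z1 + t *\<^sub>R b) - g' (z1 + t *\<^sub>R b)) \<bullet> b + 2 * \<epsilon> * ((z1 + t *\<^sub>R b) \<bullet> b))) (at t)"
      if "\<bar>t\<bar> < r" for t
    proof -
      have line: "((\<lambda>t. z1 + t *\<^sub>R b) has_derivative (\<lambda>s. s *\<^sub>R b)) (at t)"
        by (auto intro!: derivative_eq_intros)
      have "(w has_derivative (\<lambda>h. h \<bullet> g (z1 + t *\<^sub>R b))) (at (z1 + t *\<^sub>R b))"
           "(v has_derivative (\<lambda>h. h \<bullet> g' (z1 + t *\<^sub>R b))) (at (z1 + t *\<^sub>R b))"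
        using gH(1) gH'(1) inb[OF that] by (auto simp: gderiv_def)
      note this[THEN has_derivative_compose[OF line]]
      then have "((\<lambda>t. \<phi> (z1 + t *\<^sub>R b)) has_derivative
        (\<lambda>s. s *\<^sub>R b \<bullet> g (z1 + t *\<^sub>R b) - s *\<^sub>R b \<bullet> g' (z1 + t *\<^sub>R b)
             + \<epsilon> * ((z1 + t *\<^sub>R b) \<bullet> (s *\<^sub>R b) + (s *\<^sub>R b) \<bullet> (z1 + t *\<^sub>R b)))) (at t)"
        unfolding \<phi>_def
        by (intro has_derivative_add has_derivative_diff has_derivative_mult_right
              has_derivative_inner line)
      then show ?thesis
        unfolding has_field_derivative_def
        by (rule back_subst[of "\<lambda>D. (_ has_derivative D) _"])
           (auto simp: fun_eq_iff inner_commute inner_diff_left inner_diff_right algebra_simps)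
    qed
    show "((\<lambda>t. (g (z1 + t *\<^sub>R b) - g' (z1 + t *\<^sub>R b)) \<bullet> b + 2 * \<epsilon> * ((z1 + t *\<^sub>R b) \<bullet> b))
            has_real_derivative ((H z1 b - H' z1 b) \<bullet> b + 2 * \<epsilon>)) (at 0)"
    proof -
      have line: "((\<lambda>t. z1 + t *\<^sub>R b) has_derivative (\<lambda>s. s *\<^sub>R b)) (at 0)"
        by (auto intro!: derivative_eq_intros)
      have "(g has_derivative H z1) (at (z1 + 0 *\<^sub>R b))" "(g' has_derivative H' z1) (at (z1 + 0 *\<^sub>R b))"
        using gH(2)[OF z1i] gH'(2)[OF z1i] by simp_all
      note D = this[THEN has_derivative_compose[OF line]]
      have lin: "H z1 (s *\<^sub>R b) = s *\<^sub>R H z1 b" "H' z1 (s *\<^sub>R b) = s *\<^sub>R H' z1 b" for s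
        using gH(2)[OF z1i] gH'(2)[OF z1i] has_derivative_linear linear_scale by blast+
      have "((\<lambda>t. (g (z1 + t *\<^sub>R b) - g' (z1 + t *\<^sub>R b)) \<bullet> b + 2 * \<epsilon> * ((z1 + t *\<^sub>R b) \<bullet> b))
        has_derivative (\<lambda>s. (H z1 (s *\<^sub>R b) - H' z1 (s *\<^sub>R b)) \<bullet> b + 2 * \<epsilon> * ((s *\<^sub>R b) \<bullet> b))) (at 0)"
        by (intro has_derivative_add has_derivative_diff has_derivative_mult_right
              has_derivative_inner_left line D)
      then show ?thesis
        unfolding has_field_derivative_def
        by (rule back_subst[of "\<lambda>D. (_ has_derivative D) _"])
           (use b in \<open>auto simp: fun_eq_iff lin inner_diff_left algebra_simps\<close>)
    qed
    show "\<phi> (z1 + t *\<^sub>R b) \<le> \<phi> (z1 + 0 *\<^sub>R b)" if "\<bar>t\<bar> < r" for t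
      using z1(2)[of "z1 + t *\<^sub>R b"] inb[OF that] interior_subset by auto
  qed
  have "(\<Sum>b\<in>Basis. (H z1 b - H' z1 b) \<bullet> b + 2 * \<epsilon>) \<le> 0"
    by (rule sum_nonpos) (use each in auto)
  moreover have "(\<Sum>b\<in>Basis. (H z1 b - H' z1 b) \<bullet> b) = 0"
    using gH(3)[OF z1i] gH'(3)[OF z1i] by (simp add: inner_diff_left sum_subtractf)
  ultimately show False using \<epsilon> by (simp add: sum.distrib)
qed

lemma poisson_unique:
  assumes "poisson_solution f_rhs w" "z \<in> unit_square"
  shows "w z = u_exact z"
  using poisson_comparison assms poisson_u_exact by (metis order_antisym)

section \<open>The cells of the triangulation\<close>

locale anisotropic_mesh =
  fixes n m :: nat
  assumes n_pos: "1 \<le> n" and n_le_m: "n \<le> m"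
begin

definition h :: real where "h = 1 / real n"
definition k :: real where "k = 1 / (2 * real m)"

lemma h_pos: "h > 0" and k_pos: "k > 0" and h_le_1: "h \<le> 1" and k_le: "k \<le> h / 2"
proof -
  have "real m \<ge> real n" "real n \<ge> 1" using n_pos n_le_m by simp_all
  then show "h > 0" "k > 0" "h \<le> 1" "k \<le> h / 2"
    by (simp_all add: h_def k_def divide_simps)
qed

lemma nh: "real n * h = 1" and mk: "2 * real m * k = 1"
  using n_pos n_le_m by (simp_all add: h_def k_def)

text \<open>
The orientation of a cell: \<open>1\<close> if its apex is on the lower side of the strip and its horizontal edge
on the upper side, \<open>- 1\<close> in the opposite case. Cell \<open>i\<close> of strip \<open>s\<close> has its apex on the vertical line
\<open>x = i * h / 2\<close>.
\<close>

definition \<tau> :: "nat \<Rightarrow> nat \<Rightarrow> real" where "\<tau> s i = (-1) ^ (s + i)"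

lemma tau_cases: "\<tau> s i = 1 \<or> \<tau> s i = - 1"
  by (cases "even (s + i)") (simp_all add: \<tau>_def)

lemma tau_sq [simp]: "\<tau> s i * \<tau> s i = 1" "\<tau> s i * (\<tau> s i * x) = x"
  using tau_cases[of s i] by auto

text \<open>
The first and the last cell of a strip are cut off at the vertical sides of the square; these factors
remove the missing half.
\<close>

definition lft :: "nat \<Rightarrow> real" where "lft i = (if i = 0 then 0 else 1)"
definition rgt :: "nat \<Rightarrow> real" where "rgt i = (if i = 2 * n then 0 else 1)"
definition apex_x :: "nat \<Rightarrow> real" where "apex_x i = real i * h / 2"
definition ymid :: "nat \<Rightarrow> real" where "ymid s = (real s + 1 / 2) * k"

definition apex :: "nat \<Rightarrow> nat \<Rightarrow> real \<times> real" where
  "apex s i = (apex_x i, ymid s - \<tau> s i * k / 2)"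
definition base_left :: "nat \<Rightarrow> nat \<Rightarrow> real \<times> real" where
  "base_left s i = (apex_x i - lft i * h / 2, ymid s + \<tau> s i * k / 2)"
definition base_right :: "nat \<Rightarrow> nat \<Rightarrow> real \<times> real" where
  "base_right s i = (apex_x i + rgt i * h / 2, ymid s + \<tau> s i * k / 2)"

definition tri :: "nat \<Rightarrow> nat \<Rightarrow> (real \<times> real) set" where
  "tri s i = convex hull {apex s i, base_left s i, base_right s i}"

text \<open>
The distance from the apex towards the horizontal edge, relative to the height of the cell.
\<close>

definition depth :: "nat \<Rightarrow> nat \<Rightarrow> real \<Rightarrow> real" where
  "depth s i y = 1 / 2 + \<tau> s i * (y - ymid s) / k"

text \<open>
The open triangle by linear inequalities; \<open>interior_tri\<close> identifies it with the interior of the convex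
hull of its corners.
\<close>

definition cell :: "nat \<Rightarrow> nat \<Rightarrow> (real \<times> real) set" where
  "cell s i = {(x, y). 0 < depth s i y \<and> depth s i y < 1 \<and>
     apex_x i - lft i * depth s i y * h / 2 < x \<and> x < apex_x i + rgt i * depth s i y * h / 2}"

definition idx :: "(nat \<times> nat) set" where "idx = {..<2 * m} \<times> {..2 * n}"

lemma lft_rgt_pos: "lft i + rgt i > 0" and lft_nonneg: "lft i \<ge> 0" and rgt_nonneg: "rgt i \<ge> 0"
  using n_pos by (auto simp: lft_def rgt_def)

lemma lft_rgt_cases:
  "(lft i = 1 \<and> rgt i = 1) \<or> (lft i = 0 \<and> rgt i = 1) \<or> (lft i = 1 \<and> rgt i = 0)"
  using n_pos by (auto simp: lft_def rgt_def)

lemma corners_not_collinear: "\<not> collinear {apex s i, base_left s i, base_right s i}"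
proof
  assume "collinear {apex s i, base_left s i, base_right s i}"
  then obtain u v where uv: "\<forall>x\<in>{apex s i, base_left s i, base_right s i}. \<exists>c. x = u + c *\<^sub>R v"
    unfolding collinear_alt by blast
  then obtain a b c where abc: "apex s i = u + a *\<^sub>R v" "base_left s i = u + b *\<^sub>R v"
    "base_right s i = u + c *\<^sub>R v" by blast
  have "base_right s i - base_left s i = (c - b) *\<^sub>R v"
    unfolding abc by (simp add: algebra_simps)
  then have 1: "(c - b) * fst v = (lft i + rgt i) * h / 2" "(c - b) * snd v = 0"
    by (auto simp: base_left_def base_right_def prod_eq_iff algebra_simps)
  have "base_left s i - apex s i = (b - a) *\<^sub>R v"
    unfolding abc by (simp add: algebra_simps)
  then have 2: "(b - a) * snd v = \<tau> s i * k"
    by (simp add: base_left_def apex_def prod_eq_iff algebra_simps)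
  have "(lft i + rgt i) * h / 2 > 0" using lft_rgt_pos h_pos by simp
  with 1 have "snd v = 0" by auto
  with 2 show False using tau_cases[of s i] k_pos by auto
qed

lemma tri_corners_distinct:
  "apex s i \<noteq> base_left s i" "apex s i \<noteq> base_right s i" "base_left s i \<noteq> base_right s i"
  and tri_affine_independent: "\<not> affine_dependent {apex s i, base_left s i, base_right s i}"
  using corners_not_collinear[of s i] by (auto simp: collinear_3_eq_affine_dependent)

lemma interior_tri: "interior (tri s i) = cell s i"
proof -
  let ?t = "depth s i" and ?c = "lft i + rgt i"
  have c: "?c > 0" by (rule lft_rgt_pos)
  have "interior (tri s i) = {v. \<exists>x y z. 0 < x \<and> 0 < y \<and> 0 < z \<and> x + y + z = 1 \<and>
          x *\<^sub>R apex s i + y *\<^sub>R base_left s i + z *\<^sub>R base_right s i = v}"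
    unfolding tri_def by (rule interior_convex_hull_3_minimal[OF corners_not_collinear]) simp
  also have "\<dots> = cell s i"
  proof (intro set_eqI iffI)
    fix v assume "v \<in> {v. \<exists>x y z. 0 < x \<and> 0 < y \<and> 0 < z \<and> x + y + z = 1 \<and>
          x *\<^sub>R apex s i + y *\<^sub>R base_left s i + z *\<^sub>R base_right s i = v}"
    then obtain x y z where xyz: "0 < x" "0 < y" "0 < z" "x + y + z = 1"
      and v: "v = x *\<^sub>R apex s i + y *\<^sub>R base_left s i + z *\<^sub>R base_right s i" by auto
    have x: "x = 1 - y - z" using xyz by simp
    have v1: "fst v = apex_x i + (rgt i * z - lft i * y) * h / 2"
      and v2: "snd v = ymid s + \<tau> s i * k * (y + z - 1 / 2)"
      unfolding v x by (simp_all add: apex_def base_left_def base_right_def field_simps)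
    have t: "?t (snd v) = y + z"
      unfolding depth_def v2 using k_pos by (simp add: field_simps)
    have "0 < ?c * z" "0 < ?c * y" using c xyz by simp_all
    then have "- lft i * (y + z) < rgt i * z - lft i * y" "rgt i * z - lft i * y < rgt i * (y + z)"
      by (simp_all add: algebra_simps)
    then have "(- lft i * (y + z)) * (h / 2) < (rgt i * z - lft i * y) * (h / 2)"
      "(rgt i * z - lft i * y) * (h / 2) < (rgt i * (y + z)) * (h / 2)"
      using h_pos by (simp_all only: mult_less_cancel_right_pos half_gt_zero)
    then show "v \<in> cell s i"
      unfolding cell_def split_def using t xyz by (simp add: v1)
  next
    fix v assume "v \<in> cell s i"
    then have t01: "0 < ?t (snd v)" "?t (snd v) < 1"
      and l: "apex_x i - lft i * ?t (snd v) * h / 2 < fst v" and r: "fst v < apex_x i + rgt i * ?t (snd v) * h / 2"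
      by (auto simp: cell_def split_def)
    define t where "t = ?t (snd v)"
    define \<xi> where "\<xi> = (fst v - apex_x i) * 2 / h"
    have fv: "fst v = apex_x i + \<xi> * h / 2" using h_pos by (simp add: \<xi>_def field_simps)
    have sv: "snd v = ymid s + \<tau> s i * k * (t - 1 / 2)"
      using k_pos by (simp add: t_def depth_def field_simps)
    have "- (lft i * t) * (h / 2) < \<xi> * (h / 2)" "\<xi> * (h / 2) < (rgt i * t) * (h / 2)"
      using l r unfolding fv t_def by (simp_all add: algebra_simps)
    then have xi: "- (lft i * t) < \<xi>" "\<xi> < rgt i * t"
      using h_pos by (simp_all only: mult_less_cancel_right_pos half_gt_zero)
    \<comment> \<open>The barycentric coordinates of \<open>v\<close> are \<open>1 - t\<close>, \<open>y\<close> and \<open>z\<close>.\<close>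
    define z where "z = (\<xi> + lft i * t) / ?c"
    define y where "y = t - z"
    have z: "z > 0" using xi c by (simp add: z_def)
    have y: "y > 0" using xi c by (simp add: y_def z_def divide_simps algebra_simps)
    have zc: "z * ?c = \<xi> + lft i * t" using c by (simp add: z_def)
    have e: "rgt i * z - lft i * y = \<xi>" using zc by (simp add: y_def algebra_simps)
    have "(1 - t) *\<^sub>R apex s i + y *\<^sub>R base_left s i + z *\<^sub>R base_right s i = v"
    proof (rule prod_eqI)
      have tt: "t = y + z" by (simp add: y_def)
      show "fst ((1 - t) *\<^sub>R apex s i + y *\<^sub>R base_left s i + z *\<^sub>R base_right s i) = fst v"
        unfolding fv e[symmetric] tt by (simp add: apex_def base_left_def base_right_def field_simps)
      show "snd ((1 - t) *\<^sub>R apex s i + y *\<^sub>R base_left s i + z *\<^sub>R base_right s i) = snd v"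
        unfolding sv tt by (simp add: apex_def base_left_def base_right_def field_simps)
    qed
    moreover have "1 - t > 0" "(1 - t) + y + z = 1" using t01 by (simp_all add: t_def y_def)
    ultimately show "v \<in> {v. \<exists>x y z. 0 < x \<and> 0 < y \<and> 0 < z \<and> x + y + z = 1 \<and>
          x *\<^sub>R apex s i + y *\<^sub>R base_left s i + z *\<^sub>R base_right s i = v}"
      using y z by blast
  qed
  finally show ?thesis .
qed

lemma cell_nonempty: "cell s i \<noteq> {}"
proof -
  have "(apex_x i + (rgt i - lft i) * h / 8, ymid s) \<in> cell s i"
    using lft_rgt_cases[of i] h_pos by (auto simp: cell_def depth_def)
  then show ?thesis by blast
qed

lemma closure_cell: "closure (cell s i) = tri s i"
proof -
  have "convex (tri s i)" "closed (tri s i)"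
    unfolding tri_def by (auto intro!: compact_imp_closed finite_imp_compact_convex_hull)
  moreover have "interior (tri s i) \<noteq> {}" using interior_tri cell_nonempty by simp
  ultimately show ?thesis
    using convex_closure_interior[of "tri s i"] by (simp add: interior_tri)
qed

lemma open_cell: "open (cell s i)" and connected_cell: "connected (cell s i)"
proof -
  show "open (cell s i)" using open_interior interior_tri by metis
  have "convex (cell s i)" unfolding interior_tri[symmetric] tri_def by (simp add: convex_interior)
  then show "connected (cell s i)" by (rule convex_connected)
qed

lemma idx_iff: "(s, i) \<in> idx \<longleftrightarrow> s < 2 * m \<and> i \<le> 2 * n"
  by (auto simp: idx_def)

text \<open>
In the coordinates \<open>X = 2 * n * x\<close>, \<open>Y = 2 * m * y\<close> the vertices have integer coordinates and
the slanted lines are those on which \<open>Y - X\<close> or \<open>Y + X\<close> is an even integer. Whether a point lies in a cell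
or on a line then becomes a question about integers.
\<close>

lemma cell_scaled:
  "(x, y) \<in> cell s i \<longleftrightarrow> (let X = 2 * real n * x; Y = 2 * real m * y;
      D = (if even (s + i) then Y - real s else real s + 1 - Y) in
      0 < D \<and> D < 1 \<and> real i - lft i * D < X \<and> X < real i + rgt i * D)"
proof -
  define X Y where "X = 2 * real n * x" and "Y = 2 * real m * y"
  define D where "D = (if even (s + i) then Y - real s else real s + 1 - Y)"
  have npos: "real n > 0" "real m > 0" using n_pos n_le_m by simp_all
  have D: "depth s i y = D"
    using npos by (simp add: depth_def D_def Y_def \<tau>_def ymid_def k_def field_simps)
  have l: "apex_x i - lft i * D * h / 2 < x \<longleftrightarrow> real i - lft i * D < X"
    and r: "x < apex_x i + rgt i * D * h / 2 \<longleftrightarrow> X < real i + rgt i * D"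
    using npos by (simp_all add: apex_x_def h_def X_def field_simps)
  show ?thesis
    unfolding cell_def Let_def X_def[symmetric] Y_def[symmetric] D_def[symmetric]
    by (simp add: D l r)
qed

lemma cell_bounds:
  assumes "(x, y) \<in> cell s i" "(s, i) \<in> idx"
  shows "0 < x" "x < 1" "0 < y" "y < 1" "real s < 2 * real m * y" "2 * real m * y < real s + 1"
    "\<bar>2 * real n * x - real i\<bar> < (if even (s + i) then 2 * real m * y - real s else real s + 1 - 2 * real m * y)"
proof -
  define X Y where "X = 2 * real n * x" and "Y = 2 * real m * y"
  define D where "D = (if even (s + i) then Y - real s else real s + 1 - Y)"
  have npos: "real n > 0" "real m > 0" using n_pos n_le_m by simp_all
  have c: "0 < D" "D < 1" "real i - lft i * D < X" "X < real i + rgt i * D"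
    using assms(1) unfolding cell_scaled Let_def X_def[symmetric] Y_def[symmetric] D_def[symmetric]
    by auto
  have l: "lft i * D \<le> D" and r: "rgt i * D \<le> D"
    using c(1) by (auto simp: lft_def rgt_def)
  show "\<bar>X - real i\<bar> < D" using c l r by (simp add: abs_if)
  have s: "real s < Y" "Y < real s + 1" using c(1,2) by (auto simp: D_def split: if_splits)
  then show "real s < Y" "Y < real s + 1" .
  have "s < 2 * m" using assms(2) by (simp add: idx_iff)
  then have "s + 1 \<le> 2 * m" by simp
  then have "real s + 1 \<le> 2 * real m" using of_nat_le_iff[of "s + 1" "2 * m", where 'a = real] by simp
  then have "0 < Y" "Y < 2 * real m" using s by linarith+
  then show "0 < y" "y < 1" using npos by (simp_all add: Y_def zero_less_mult_iff)
  have "0 < X"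
  proof (cases "i = 0")
    case True then show ?thesis using c by (simp add: lft_def)
  next
    case False then have "real i \<ge> 1" by simp
    then show ?thesis using c l by linarith
  qed
  then show "0 < x" using npos by (simp add: X_def zero_less_mult_iff)
  have "X < 2 * real n"
  proof (cases "i = 2 * n")
    case True then show ?thesis using c by (simp add: rgt_def)
  next
    case False then have "i + 1 \<le> 2 * n" using assms(2) by (simp add: idx_iff)
    then have "real i + 1 \<le> 2 * real n" using of_nat_le_iff[of "i + 1" "2 * n", where 'a = real] by simp
    then show ?thesis using c r by linarith
  qed
  then show "x < 1" using npos by (simp add: X_def)
qed

text \<open>
In a strip, the centres of two different cells of equal orientation are at a distance of at least two
scaled units, while each of them has half-width less than one; cells of opposite orientation have complementary
half-widths and centres at a distance of at least one.
\<close>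

lemma cells_disjoint:
  assumes z: "z \<in> cell s i" "z \<in> cell s' i'" and "(s, i) \<in> idx" "(s', i') \<in> idx"
  shows "s = s' \<and> i = i'"
proof -
  obtain x y where zz: "z = (x, y)" by fastforce
  note c = cell_bounds(5-7)[OF z(1)[unfolded zz] assms(3)]
  note c' = cell_bounds(5-7)[OF z(2)[unfolded zz] assms(4)]
  have s: "s = s'" using c(1,2) c'(1,2) by linarith
  define Y where "Y = 2 * real m * y - real s"
  have Y: "0 < Y" "Y < 1" using c by (simp_all add: Y_def)
  have i: "\<bar>2 * real n * x - real i\<bar> < (if even (s + i) then Y else 1 - Y)"
    and i': "\<bar>2 * real n * x - real i'\<bar> < (if even (s + i') then Y else 1 - Y)"
    using c c' s by (auto simp: Y_def)
  have "i = i'"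
  proof (cases "even (s + i) = even (s + i')")
    case True
    then have "\<bar>real i - real i'\<bar> < 2" using i i' Y by (simp split: if_splits)
    then have "\<bar>int i - int i'\<bar> < 2" by linarith
    moreover have "even (i + i')" using True by auto
    ultimately show ?thesis by presburger
  next
    case False
    then have "\<bar>real i - real i'\<bar> < 1" using i i' Y by (simp split: if_splits)
    then show ?thesis by linarith
  qed
  with s show ?thesis by simp
qed

lemma cell_avoids_grid:
  assumes z: "z \<in> cell s i" and si: "(s, i) \<in> idx"
  shows "z \<notin> \<Union> (grid_lines n m)"
proof
  assume g: "z \<in> \<Union> (grid_lines n m)"
  obtain x y where zz: "z = (x, y)" by fastforce
  define X Y where "X = 2 * real n * x" and "Y = 2 * real m * y"
  have npos: "real n > 0" "real m > 0" using n_pos n_le_m by simp_all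
  note c = cell_bounds(5-7)[OF z[unfolded zz] si, folded X_def Y_def]
  from g obtain j :: int where j: "y = of_int j / (2 * real m) \<or> y = real n / real m * x + of_int j / real m
     \<or> y = - (real n / real m) * x + of_int j / real m"
    unfolding grid_lines_def zz by auto
  then have "Y = of_int j \<or> Y - X = 2 * of_int j \<or> Y + X = 2 * of_int j"
    using npos by (elim disjE) (simp_all add: X_def Y_def field_simps)
  then show False
  proof (elim disjE)
    assume "Y = of_int j"
    then have "int s < j" "j < int s + 1" using c by linarith+
    then show False by simp
  next
    assume a: "Y - X = 2 * of_int j"
    show False
    proof (cases "even (s + i)")
      case True
      then have "real s - real i < 2 * of_int j" "2 * of_int j < real s - real i + 2"
        using c a by auto
      then have "int s - int i < 2 * j" "2 * j < int s - int i + 2" by linarith+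
      moreover have "even (int s - int i)" using True by simp
      ultimately show False by presburger
    next
      case False
      then have "real s - real i - 1 < 2 * of_int j" "2 * of_int j < real s - real i + 1"
        using c a by auto
      then have "int s - int i - 1 < 2 * j" "2 * j < int s - int i + 1" by linarith+
      moreover have "odd (int s - int i)" using False by simp
      ultimately show False by presburger
    qed
  next
    assume a: "Y + X = 2 * of_int j"
    show False
    proof (cases "even (s + i)")
      case True
      then have "real s + real i < 2 * of_int j" "2 * of_int j < real s + real i + 2"
        using c a by auto
      then have "int s + int i < 2 * j" "2 * j < int s + int i + 2" by linarith+
      moreover have "even (int s + int i)" using True by simp
      ultimately show False by presburger
    next
      case False
      then have "real s + real i - 1 < 2 * of_int j" "2 * of_int j < real s + real i + 1"
        using c a by auto
      then have "int s + int i - 1 < 2 * j" "2 * j < int s + int i + 1" by linarith+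
      moreover have "odd (int s + int i)" using False by simp
      ultimately show False by presburger
    qed
  qed
qed

text \<open>
Let the point lie above the interval from \<open>i\<close> to \<open>i + 1\<close>, in scaled coordinates. At its height,
the cells \<open>i\<close> and \<open>i + 1\<close> divide that interval at the one slanted line which crosses it.
\<close>

lemma cells_cover:
  assumes z: "z \<in> interior unit_square" and g: "z \<notin> \<Union> (grid_lines n m)"
  shows "\<exists>(s, i) \<in> idx. z \<in> cell s i"
proof -
  obtain x y where zz: "z = (x, y)" by fastforce
  have xy: "0 < x" "x < 1" "0 < y" "y < 1" using z by (auto simp: zz interior_unit_square)
  define X Y where "X = 2 * real n * x" and "Y = 2 * real m * y"
  have npos: "real n > 0" "real m > 0" using n_pos n_le_m by simp_all
  have nm: "real n \<le> real m" using n_le_m by simp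
  have X: "0 < X" "X < 2 * real n" using xy npos by (simp_all add: X_def)
  have Y: "0 < Y" "Y < 2 * real m" using xy npos by (simp_all add: Y_def)
  have g1: "Y \<noteq> of_int j" if "1 \<le> j" "j \<le> 2 * int m - 1" for j
  proof
    assume "Y = of_int j"
    then have "y = of_int j / (2 * real m)" using npos by (simp add: Y_def field_simps)
    then show False using g that unfolding grid_lines_def zz by force
  qed
  have g2: "Y - X \<noteq> 2 * of_int j" for j
  proof
    assume a: "Y - X = 2 * of_int j"
    then have y: "y = real n / real m * x + of_int j / real m"
      using npos by (simp add: X_def Y_def field_simps)
    have "- real m < of_int j" "of_int j < real m" using a X Y nm by linarith+
    then have "1 - int m \<le> j" "j \<le> int m - 1" by linarith+
    then show False using g y unfolding grid_lines_def zz by force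
  qed
  have g3: "Y + X \<noteq> 2 * of_int j" for j
  proof
    assume a: "Y + X = 2 * of_int j"
    then have y: "y = - (real n / real m) * x + of_int j / real m"
      using npos by (simp add: X_def Y_def field_simps)
    have "0 < real_of_int j" "of_int j < 2 * real m" using a X Y nm by linarith+
    then have "1 \<le> j" "j \<le> 2 * int m - 1" by linarith+
    then show False using g y unfolding grid_lines_def zz by force
  qed
  define s where "s = nat \<lfloor>Y\<rfloor>"
  define i where "i = nat \<lfloor>X\<rfloor>"
  have s: "real s \<le> Y" "Y < real s + 1" using Y by (simp_all add: s_def)
  have i: "real i \<le> X" "X < real i + 1" using X by (simp_all add: i_def)
  have s2: "s < 2 * m" and i2: "i < 2 * n" using s i X Y by linarith+
  have "Y \<noteq> real s"
  proof
    assume "Y = real s"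
    then show False using g1[of "int s"] Y s2 by simp
  qed
  with s have s3: "real s < Y" by simp
  define D where "D = (if even (s + i) then Y - real s else real s + 1 - Y)"
  define D' where "D' = (if even (s + (i + 1)) then Y - real s else real s + 1 - Y)"
  have D: "0 < D" "D < 1" "D' = 1 - D" using s3 s by (auto simp: D_def D'_def)
  have ne: "X \<noteq> real i + D"
  proof
    assume XD: "X = real i + D"
    show False
    proof (cases "even (s + i)")
      case True
      then have "\<exists>j. int s - int i = 2 * j" by presburger
      then obtain j where "int s - int i = 2 * j" ..
      then have "real s - real i = 2 * of_int j" by linarith
      then show False using g2[of j] XD True by (simp add: D_def)
    next
      case False
      then have "\<exists>j. int s + int i + 1 = 2 * j" by presburger
      then obtain j where "int s + int i + 1 = 2 * j" ..
      then have "real s + real i + 1 = 2 * of_int j" by linarith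
      then show False using g3[of j] XD False by (simp add: D_def)
    qed
  qed
  show ?thesis
  proof (cases "X < real i + D")
    case True
    have "real i - lft i * D < X" "X < real i + rgt i * D"
      using True i D X i2 by (auto simp: lft_def rgt_def)
    then have "z \<in> cell s i"
      unfolding zz cell_scaled Let_def X_def[symmetric] Y_def[symmetric] D_def[symmetric]
      using D by simp
    then show ?thesis using s2 i2 by (intro bexI[of _ "(s, i)"]) (auto simp: idx_def)
  next
    case False
    have "real (i + 1) - lft (i + 1) * D' < X" "X < real (i + 1) + rgt (i + 1) * D'"
      using False ne i D X by (auto simp: lft_def rgt_def)
    then have "z \<in> cell s (i + 1)"
      unfolding zz cell_scaled Let_def X_def[symmetric] Y_def[symmetric] D'_def[symmetric]
      using D by simp
    then show ?thesis using s2 i2 by (intro bexI[of _ "(s, i + 1)"]) (auto simp: idx_def)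
  qed
qed

lemma components_eq_cells:
  "components (interior unit_square - \<Union> (grid_lines n m)) = case_prod cell ` idx"
proof (rule components_open_unique)
  show "pairwise disjnt (case_prod cell ` idx)"
    unfolding pairwise_def disjnt_def
  proof (clarify, rule ccontr)
    fix s i s' i' assume a: "(s, i) \<in> idx" "(s', i') \<in> idx" "cell s i \<noteq> cell s' i'" "cell s i \<inter> cell s' i' \<noteq> {}"
    then obtain z where "z \<in> cell s i" "z \<in> cell s' i'" by blast
    then show False using cells_disjoint[OF _ _ a(1,2)] a(3) by blast
  qed
  show "\<Union> (case_prod cell ` idx) = interior unit_square - \<Union> (grid_lines n m)"
  proof (intro set_eqI iffI)
    fix z assume "z \<in> \<Union> (case_prod cell ` idx)"
    then obtain s i where si: "(s, i) \<in> idx" "z \<in> cell s i" by auto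
    then have "z \<in> interior unit_square"
      using cell_bounds(1-4)[of "fst z" "snd z"] by (auto simp: interior_unit_square mem_Times_iff)
    then show "z \<in> interior unit_square - \<Union> (grid_lines n m)"
      using cell_avoids_grid si by blast
  next
    fix z assume "z \<in> interior unit_square - \<Union> (grid_lines n m)"
    then show "z \<in> \<Union> (case_prod cell ` idx)" using cells_cover[of z] by auto
  qed
qed (use open_cell connected_cell cell_nonempty in auto)

lemma triangulation_eq: "triangulation n m = case_prod tri ` idx"
  unfolding triangulation_def components_eq_cells image_image
  by (intro image_cong) (auto simp: closure_cell)

lemma inj_on_tri: "inj_on (case_prod tri) idx"
proof (rule inj_onI, clarify)
  fix s i s' i' assume a: "(s, i) \<in> idx" "(s', i') \<in> idx" "tri s i = tri s' i'"
  then have "cell s i = cell s' i'" using interior_tri by metis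
  then show "s = s' \<and> i = i'" using cells_disjoint a cell_nonempty by blast
qed

lemma sum_triangulation: "(\<Sum>\<Delta>\<in>triangulation n m. F \<Delta>) = (\<Sum>s<2*m. \<Sum>i\<le>2*n. F (tri s i))"
  using sum.reindex[OF inj_on_tri, of F]
  by (simp add: triangulation_eq sum.cartesian_product split_def idx_def)

lemma edge_of_tri:
  "closed_segment a b edge_of tri s i \<longleftrightarrow>
    {a, b} \<in> {{apex s i, base_left s i}, {apex s i, base_right s i}, {base_left s i, base_right s i}}"
proof -
  let ?A = "apex s i" and ?L = "base_left s i" and ?R = "base_right s i"
  have ind: "\<not> affine_dependent {?A, ?L, ?R}" by (rule tri_affine_independent)
  have seg: "closed_segment a b = convex hull {a, b}" by (simp add: segment_convex_hull)
  have faces: "closed_segment a b face_of tri s i \<longleftrightarrow> (\<exists>c. c \<subseteq> {?A, ?L, ?R} \<and> closed_segment a b = convex hull c)"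
    unfolding tri_def by (rule face_of_convex_hull_affine_independent[OF ind])
  show ?thesis
  proof
    assume e: "closed_segment a b edge_of tri s i"
    then obtain c where c: "c \<subseteq> {?A, ?L, ?R}" "closed_segment a b = convex hull c"
      using faces by (auto simp: edge_of_def)
    have "\<not> affine_dependent c" using c(1) ind affine_independent_subset by blast
    then have "aff_dim c = int (card c) - 1" using affine_independent_iff_card by blast
    moreover have "aff_dim c = 1" using e c(2) by (simp add: edge_of_def aff_dim_convex_hull)
    ultimately have "card c = 2" by simp
    then obtain p q where pq: "c = {p, q}" "p \<noteq> q" by (auto simp: card_2_iff)
    then have "closed_segment a b = closed_segment p q" using c(2) by (simp add: segment_convex_hull)
    then have "{a, b} = {p, q}" by simp
    moreover have "p = ?A \<or> p = ?L \<or> p = ?R" "q = ?A \<or> q = ?L \<or> q = ?R" using c(1) pq(1) by auto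
    then have "{p, q} = {?A, ?L} \<or> {p, q} = {?A, ?R} \<or> {p, q} = {?L, ?R}"
      using pq(2) by (elim disjE) (simp_all add: insert_commute)
    ultimately show "{a, b} \<in> {{?A, ?L}, {?A, ?R}, {?L, ?R}}" by simp
  next
    assume ab: "{a, b} \<in> {{?A, ?L}, {?A, ?R}, {?L, ?R}}"
    then have "{a, b} \<subseteq> {?A, ?L, ?R}" by auto
    then have "closed_segment a b face_of tri s i" using faces seg by blast
    moreover have "a \<noteq> b" using ab tri_corners_distinct[of s i] by (auto simp: doubleton_eq_iff)
    then have "aff_dim (closed_segment a b) = 1"
      by (simp add: segment_convex_hull aff_dim_convex_hull aff_dim_2)
    ultimately show "closed_segment a b edge_of tri s i" by (simp add: edge_of_def)
  qed
qed

end

section \<open>Nonconforming functions as values at edge midpoints\<close>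

context anisotropic_mesh begin

definition base_row :: "nat \<Rightarrow> nat \<Rightarrow> nat" where "base_row s i = (if even (s + i) then s + 1 else s)"

text \<open>
The midpoint of an edge is at the height \<open>\<rho> * k / 2\<close> for an integer \<open>\<rho>\<close>: odd for slanted edges,
which have their midpoints on the midline of a strip, and even for horizontal ones. So an edge is given by a pair
\<open>(\<rho>, j)\<close>: if \<open>\<rho> = 2 * s + 1\<close>, the slanted edge between the cells \<open>j - 1\<close> and \<open>j\<close> of strip \<open>s\<close>;
if \<open>\<rho> = 2 * r\<close>, the horizontal edge with the cells \<open>j\<close> of the strips \<open>r - 1\<close> and \<open>r\<close> on its two sides,
which exists if \<open>r + j\<close> is odd. The set \<open>edges\<close> contains only the interior ones, and a nonconforming
function corresponds to a real function supported on it.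
\<close>

definition edges :: "(nat \<times> nat) set" where
  "edges = {(\<rho>, j). if odd \<rho> then \<rho> < 4 * m \<and> 1 \<le> j \<and> j \<le> 2 * n
                     else 0 < \<rho> \<and> \<rho> < 4 * m \<and> j \<le> 2 * n \<and> odd (\<rho> div 2 + j)}"

definition dofs :: "(nat \<times> nat \<Rightarrow> real) set" where
  "dofs = {e. \<forall>t. t \<notin> edges \<longrightarrow> e t = 0}"

definition slant_x :: "nat \<Rightarrow> real" where
  "slant_x j = (if j = 0 then 0 else if j = 2 * n + 1 then 1 else (2 * real j - 1) * h / 4)"
definition base_x :: "nat \<Rightarrow> real" where "base_x i = apex_x i + (rgt i - lft i) * h / 4"
definition edge_mid :: "nat \<times> nat \<Rightarrow> real \<times> real" where
  "edge_mid t = (if odd (fst t) then slant_x (snd t) else base_x (snd t), real (fst t) * k / 2)"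

definition tri_edges :: "nat \<Rightarrow> nat \<Rightarrow> (nat \<times> nat) set" where
  "tri_edges s i = {(2 * s + 1, i), (2 * s + 1, i + 1), (2 * base_row s i, i)}"

definition val_left :: "(nat \<times> nat \<Rightarrow> real) \<Rightarrow> nat \<Rightarrow> nat \<Rightarrow> real" where "val_left e s i = e (2 * s + 1, i)"
definition val_right :: "(nat \<times> nat \<Rightarrow> real) \<Rightarrow> nat \<Rightarrow> nat \<Rightarrow> real" where "val_right e s i = e (2 * s + 1, i + 1)"
definition val_base :: "(nat \<times> nat \<Rightarrow> real) \<Rightarrow> nat \<Rightarrow> nat \<Rightarrow> real" where "val_base e s i = e (2 * base_row s i, i)"

text \<open>
The first and the last cell of a strip are half as wide as the others, so the same difference of
node values belongs to twice the slope. One of their two node values is zero, and twice the mean is the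
other one, the value above or below the midpoint of the horizontal edge. The value at the centre is taken on the vertical line through
the apex, which for these two cells is a side of the square.
\<close>

definition end_factor :: "nat \<Rightarrow> real" where "end_factor i = 2 - lft i * rgt i"
definition slope_x :: "(nat \<times> nat \<Rightarrow> real) \<Rightarrow> nat \<Rightarrow> nat \<Rightarrow> real" where
  "slope_x e s i = end_factor i * (val_right e s i - val_left e s i) * 2 / h"
definition slope_y :: "(nat \<times> nat \<Rightarrow> real) \<Rightarrow> nat \<Rightarrow> nat \<Rightarrow> real" where
  "slope_y e s i = \<tau> s i * (val_base e s i - end_factor i * (val_left e s i + val_right e s i) / 2) * 2 / k"
definition center_val :: "(nat \<times> nat \<Rightarrow> real) \<Rightarrow> nat \<Rightarrow> nat \<Rightarrow> real" where
  "center_val e s i = lft i * rgt i * (val_left e s i + val_right e s i) / 2"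
definition local_poly :: "(nat \<times> nat \<Rightarrow> real) \<Rightarrow> nat \<Rightarrow> nat \<Rightarrow> real \<times> real \<Rightarrow> real" where
  "local_poly e s i z = center_val e s i + slope_x e s i * (fst z - apex_x i) + slope_y e s i * (snd z - ymid s)"

definition nc_fun :: "(nat \<times> nat \<Rightarrow> real) \<Rightarrow> real \<times> real \<Rightarrow> real" where
  "nc_fun e z = (\<Sum>(s, i)\<in>idx. indicator (cell s i) z * local_poly e s i z)"

lemma finite_idx: "finite idx" by (simp add: idx_def)

lemma finite_edges: "finite edges"
  by (rule finite_subset[of _ "{..4 * m} \<times> {..2 * n}"]) (auto simp: edges_def split: if_splits)

lemma nc_fun_cell:
  assumes "(s, i) \<in> idx" "z \<in> cell s i"
  shows "nc_fun e z = local_poly e s i z"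
proof -
  have "nc_fun e z = (\<Sum>(s', i')\<in>{(s, i)}. indicator (cell s' i') z * local_poly e s' i' z)"
    unfolding nc_fun_def using assms finite_idx
    by (intro sum.mono_neutral_right) (auto simp: indicator_def dest: cells_disjoint)
  then show ?thesis using assms by simp
qed

lemma nc_fun_outside: "(\<And>s i. (s, i) \<in> idx \<Longrightarrow> z \<notin> cell s i) \<Longrightarrow> nc_fun e z = 0"
  unfolding nc_fun_def by (intro sum.neutral) (auto simp: indicator_def)

lemma apex_x_last: "apex_x (2 * n) = 1" using nh by (simp add: apex_x_def)

lemma midpoint_edges:
  "midpoint (apex s i) (base_left s i) = (apex_x i - lft i * h / 4, ymid s)"
  "midpoint (apex s i) (base_right s i) = (apex_x i + rgt i * h / 4, ymid s)"
  "midpoint (base_left s i) (base_right s i) = (base_x i, ymid s + \<tau> s i * k / 2)"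
  by (simp_all add: midpoint_def apex_def base_left_def base_right_def base_x_def field_simps)

lemma edge_mid_tri_edges:
  assumes "i \<le> 2 * n"
  shows "edge_mid (2 * s + 1, i) = (apex_x i - lft i * h / 4, ymid s)"
    "edge_mid (2 * s + 1, i + 1) = (apex_x i + rgt i * h / 4, ymid s)"
    "edge_mid (2 * base_row s i, i) = (base_x i, ymid s + \<tau> s i * k / 2)"
proof -
  show "edge_mid (2 * s + 1, i) = (apex_x i - lft i * h / 4, ymid s)"
    using assms by (auto simp: edge_mid_def slant_x_def apex_x_def lft_def ymid_def field_simps)
  show "edge_mid (2 * s + 1, i + 1) = (apex_x i + rgt i * h / 4, ymid s)"
    using assms apex_x_last by (cases "i = 2 * n") (auto simp: edge_mid_def slant_x_def apex_x_def rgt_def ymid_def field_simps)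
  show "edge_mid (2 * base_row s i, i) = (base_x i, ymid s + \<tau> s i * k / 2)"
    by (auto simp: edge_mid_def base_row_def \<tau>_def ymid_def field_simps)
qed

lemma edge_of_tri_edge_mid:
  assumes si: "(s, i) \<in> idx" and e: "closed_segment a b edge_of tri s i"
  shows "\<exists>t\<in>tri_edges s i. midpoint a b = edge_mid t"
proof -
  have "i \<le> 2 * n" using si by (simp add: idx_iff)
  note em = edge_mid_tri_edges[OF this, of s]
  from e have "{a, b} = {apex s i, base_left s i} \<or> {a, b} = {apex s i, base_right s i}
      \<or> {a, b} = {base_left s i, base_right s i}"
    unfolding edge_of_tri by simp
  then have "midpoint a b = midpoint (apex s i) (base_left s i) \<or>
      midpoint a b = midpoint (apex s i) (base_right s i) \<or>
      midpoint a b = midpoint (base_left s i) (base_right s i)"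
    by (metis doubleton_eq_iff midpoint_sym)
  then show ?thesis
    unfolding midpoint_edges em[symmetric] tri_edges_def by blast
qed

lemma slant_x_strict_mono: "i < j \<Longrightarrow> j \<le> 2 * n + 1 \<Longrightarrow> slant_x i < slant_x j"
proof -
  assume ij: "i < j" "j \<le> 2 * n + 1"
  have n2: "2 * real n * h = 2" using nh by simp
  have "(2 * real i - 1) * h < (2 * real j - 1) * h"
    using ij h_pos by simp
  moreover have "(2 * real i - 1) * h < 4" if "i \<le> 2 * n"
  proof -
    have "real i \<le> 2 * real n" using that of_nat_le_iff[of i "2 * n", where 'a = real] by simp
    then have "real i * h \<le> 2 * real n * h" using h_pos by simp
    moreover have "(2 * real i - 1) * h = 2 * (real i * h) - h" by (simp add: algebra_simps)
    ultimately show ?thesis using h_pos n2 by linarith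
  qed
  moreover have "(2 * real j - 1) * h > 0" using ij h_pos by simp
  ultimately show ?thesis using ij by (auto simp: slant_x_def)
qed

lemma base_x_strict_mono: "i < j \<Longrightarrow> j \<le> 2 * n \<Longrightarrow> base_x i < base_x j"
proof -
  assume ij: "i < j" "j \<le> 2 * n"
  then have "real j \<ge> real i + 1" by simp
  then have "real j * h \<ge> (real i + 1) * h" using h_pos by simp
  then show ?thesis using ij h_pos n_pos
    by (auto simp: base_x_def apex_x_def lft_def rgt_def field_simps)
qed

lemma base_x_bounds: "i \<le> 2 * n \<Longrightarrow> 0 < base_x i \<and> base_x i < 1"
proof -
  assume i: "i \<le> 2 * n"
  have "base_x 0 = h / 4" using n_pos by (simp add: base_x_def apex_x_def lft_def rgt_def)
  moreover have "base_x (2 * n) = 1 - h / 4" using n_pos apex_x_last by (simp add: base_x_def lft_def rgt_def)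
  ultimately show ?thesis using base_x_strict_mono[of 0 i] base_x_strict_mono[of i "2 * n"] i h_pos
    by (cases "i = 0"; cases "i = 2 * n") (simp_all add: less_le_trans)
qed

definition edge_range :: "(nat \<times> nat) set" where
  "edge_range = {(\<rho>, j). j \<le> (if odd \<rho> then 2 * n + 1 else 2 * n)}"

lemma inj_on_edge_mid: "inj_on edge_mid edge_range"
proof (rule inj_onI, clarify)
  fix \<rho> j \<rho>' j' assume a: "(\<rho>, j) \<in> edge_range" "(\<rho>', j') \<in> edge_range" "edge_mid (\<rho>, j) = edge_mid (\<rho>', j')"
  have r: "\<rho> = \<rho>'" using a(3) k_pos by (simp add: edge_mid_def)
  moreover have "j = j'"
    using a r slant_x_strict_mono[of j j'] slant_x_strict_mono[of j' j] base_x_strict_mono[of j j'] base_x_strict_mono[of j' j]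
    by (cases j j' rule: linorder_cases) (auto simp: edge_mid_def edge_range_def split: if_splits)
  ultimately show "\<rho> = \<rho>' \<and> j = j'" by simp
qed

lemma tri_edges_range: "(s, i) \<in> idx \<Longrightarrow> tri_edges s i \<subseteq> edge_range"
  by (auto simp: tri_edges_def edge_range_def idx_iff)

lemma end_factor_cases: "end_factor i = (if i = 0 \<or> i = 2 * n then 2 else 1)"
  by (simp add: end_factor_def lft_def rgt_def)

lemma dofs_boundary:
  assumes "e \<in> dofs"
  shows "val_left e s 0 = 0" "val_right e s (2 * n) = 0" "e (0, i) = 0" "e (4 * m, i) = 0"
  using assms by (auto simp: dofs_def edges_def val_left_def val_right_def)

lemma local_poly_edge_mid:
  assumes e: "e \<in> dofs" and si: "(s, i) \<in> idx" and t: "t \<in> tri_edges s i"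
  shows "local_poly e s i (edge_mid t) = e t"
proof -
  have i: "i \<le> 2 * n" using si by (simp add: idx_iff)
  note em = edge_mid_tri_edges[OF i, of s]
  have hk: "h > 0" "k > 0" by (rule h_pos k_pos)+
  have l: "local_poly e s i (apex_x i - lft i * h / 4, ymid s) = val_left e s i"
    and r: "local_poly e s i (apex_x i + rgt i * h / 4, ymid s) = val_right e s i"
    and b: "local_poly e s i (base_x i, ymid s + \<tau> s i * k / 2) = val_base e s i"
  proof -
    consider "i = 0" | "i = 2 * n" "i > 0" | "i \<noteq> 0" "i \<noteq> 2 * n" by blast
    then have "local_poly e s i (apex_x i - lft i * h / 4, ymid s) = val_left e s i \<and>
       local_poly e s i (apex_x i + rgt i * h / 4, ymid s) = val_right e s i \<and>
       local_poly e s i (base_x i, ymid s + \<tau> s i * k / 2) = val_base e s i"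
      using dofs_boundary(1,2)[OF e, of s] hk n_pos tau_cases[of s i]
      by cases (auto simp: local_poly_def center_val_def slope_x_def slope_y_def end_factor_def base_x_def lft_def rgt_def field_simps)
    then show "local_poly e s i (apex_x i - lft i * h / 4, ymid s) = val_left e s i"
      "local_poly e s i (apex_x i + rgt i * h / 4, ymid s) = val_right e s i"
      "local_poly e s i (base_x i, ymid s + \<tau> s i * k / 2) = val_base e s i" by auto
  qed
  show ?thesis
    using t l r b unfolding tri_edges_def em[symmetric]
    by (auto simp: em[symmetric] val_left_def val_right_def val_base_def)
qed

text \<open>
The three edge midpoints of a triangle are not collinear, so a linear polynomial is determined by its
values there.
\<close>

lemma linear_eq_local_poly:
  assumes e: "e \<in> dofs" and si: "(s, i) \<in> idx" and p: "linear_polynomial p"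
    and pe: "\<And>t. t \<in> tri_edges s i \<Longrightarrow> p (edge_mid t) = e t"
  shows "p z = local_poly e s i z"
proof -
  obtain A B C where p: "\<And>x y. p (x, y) = A + B * x + C * y"
    using p by (auto simp: linear_polynomial_def)
  have i: "i \<le> 2 * n" using si by (simp add: idx_iff)
  note em = edge_mid_tri_edges[OF i, of s]
  define q where "q = (\<lambda>x y. p (x, y) - local_poly e s i (x, y))"
  define B' where "B' = B - slope_x e s i"
  define C' where "C' = C - slope_y e s i"
  define A' where "A' = A - center_val e s i + slope_x e s i * apex_x i + slope_y e s i * ymid s"
  have q: "q x y = A' + B' * x + C' * y" for x y
    by (simp add: q_def p local_poly_def A'_def B'_def C'_def algebra_simps)
  have z: "p (edge_mid t) - local_poly e s i (edge_mid t) = 0" if "t \<in> tri_edges s i" for t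
    using pe[OF that] local_poly_edge_mid[OF e si that] by simp
  have 1: "q (apex_x i - lft i * h / 4) (ymid s) = 0"
    and 2: "q (apex_x i + rgt i * h / 4) (ymid s) = 0"
    and 3: "q (base_x i) (ymid s + \<tau> s i * k / 2) = 0"
    using z unfolding q_def em[symmetric] by (auto simp: tri_edges_def)
  have "B' * ((lft i + rgt i) * h / 4) = 0" using 1 2 by (simp add: q algebra_simps)
  moreover have "(lft i + rgt i) * h / 4 > 0" using lft_rgt_pos h_pos by simp
  ultimately have B: "B' = 0" by (metis mult_eq_0_iff order_less_irrefl)
  have "q (base_x i) (ymid s + \<tau> s i * k / 2) - q (apex_x i - lft i * h / 4) (ymid s) = C' * (\<tau> s i * k) / 2"
    by (simp add: q B algebra_simps)
  then have "C' * (\<tau> s i * k) = 0" using 1 3 by linarith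
  then have C: "C' = 0" using tau_cases[of s i] k_pos by auto
  have "A' = 0" using 1 B C by (simp add: q)
  then show ?thesis using q[of "fst z" "snd z"] B C by (simp add: q_def)
qed

lemma edge_mid_frontier:
  assumes t: "t \<in> edge_range" and fr: "edge_mid t \<in> frontier unit_square"
  shows "t \<notin> edges"
proof
  assume te: "t \<in> edges"
  obtain \<rho> j where tt: "t = (\<rho>, j)" by fastforce
  have mk': "4 * real m * (k / 2) = 1" using mk by simp
  have r: "0 < \<rho>" "\<rho> < 4 * m" using te unfolding tt edges_def by (auto split: if_splits intro: Nat.gr0I)
  have "real \<rho> < 4 * real m" using r(2) of_nat_less_iff[of \<rho> "4 * m", where 'a = real] by simp
  then have "real \<rho> * (k / 2) < 4 * real m * (k / 2)" using k_pos by (intro mult_strict_right_mono) auto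
  then have "real \<rho> * (k / 2) < 1" using mk' by linarith
  then have y: "0 < real \<rho> * k / 2" "real \<rho> * k / 2 < 1" using r(1) k_pos by simp_all
  have x: "0 < fst (edge_mid t)" "fst (edge_mid t) < 1"
  proof -
    have "0 < fst (edge_mid t) \<and> fst (edge_mid t) < 1"
    proof (cases "odd \<rho>")
      case True
      then have "1 \<le> j" "j \<le> 2 * n" using te by (auto simp: tt edges_def)
      then show ?thesis using slant_x_strict_mono[of 0 j] slant_x_strict_mono[of j "2 * n + 1"] True
        by (simp add: tt edge_mid_def slant_x_def[of 0] slant_x_def[of "Suc (2 * n)"])
    next
      case False
      then show ?thesis using te base_x_bounds[of j] by (simp add: tt edge_mid_def edges_def)
    qed
    then show "0 < fst (edge_mid t)" "fst (edge_mid t) < 1" by auto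
  qed
  have "snd (edge_mid t) = real \<rho> * k / 2" by (simp add: tt edge_mid_def)
  then show False using fr x y by (auto simp: frontier_unit_square split_def)
qed

text \<open>
Continuity at the midpoint of a shared edge needs no comparison of the two triangles: on both
sides the value is the one assigned to the edge with that midpoint, and different edges have different
midpoints.
\<close>

lemma nc_fun_in_nonconforming_P1:
  assumes e: "e \<in> dofs"
  shows "nc_fun e \<in> nonconforming_P1 n m"
proof -
  define g where "g = inv_into idx (case_prod tri)"
  define p where "p = (\<lambda>\<Delta>. case_prod (local_poly e) (g \<Delta>))"
  have g: "g (tri s i) = (s, i)" if "(s, i) \<in> idx" for s i
    using inv_into_f_f[OF inj_on_tri that] by (simp add: g_def)
  have p: "p (tri s i) = local_poly e s i" if "(s, i) \<in> idx" for s i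
    using g[OF that] by (simp add: p_def)
  have val: "\<exists>t\<in>edge_range. midpoint a b = edge_mid t \<and> p (tri s i) (midpoint a b) = e t"
    if "(s, i) \<in> idx" "closed_segment a b edge_of tri s i" for s i a b
    using edge_of_tri_edge_mid[OF that] tri_edges_range[OF that(1)] local_poly_edge_mid[OF e that(1)] p[OF that(1)]
    by auto
  show ?thesis
    unfolding nonconforming_P1_def mem_Collect_eq
  proof (intro exI[of _ p] conjI ballI allI impI)
    fix \<Delta> assume "\<Delta> \<in> triangulation n m"
    then obtain s i where si: "(s, i) \<in> idx" "\<Delta> = tri s i" by (auto simp: triangulation_eq)
    show "linear_polynomial (p \<Delta>)"
      unfolding linear_polynomial_def si(2) p[OF si(1)] local_poly_def
      by (intro exI[of _ "center_val e s i - slope_x e s i * apex_x i - slope_y e s i * ymid s"] exI[of _ "slope_x e s i"] exI[of _ "slope_y e s i"])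
         (simp add: algebra_simps)
  next
    fix \<Delta> z assume "\<Delta> \<in> triangulation n m" "z \<in> interior \<Delta>"
    then obtain s i where si: "(s, i) \<in> idx" "\<Delta> = tri s i" "z \<in> cell s i"
      by (auto simp: triangulation_eq interior_tri)
    then show "nc_fun e z = p \<Delta> z" using nc_fun_cell p by simp
  next
    fix \<Delta> \<Delta>' a b
    assume "\<Delta> \<in> triangulation n m" "\<Delta>' \<in> triangulation n m"
      and ed: "closed_segment a b edge_of \<Delta> \<and> closed_segment a b edge_of \<Delta>'"
    then obtain s i s' i' where si: "(s, i) \<in> idx" "\<Delta> = tri s i" "(s', i') \<in> idx" "\<Delta>' = tri s' i'"
      by (auto simp: triangulation_eq)
    obtain t where t: "t \<in> edge_range" "midpoint a b = edge_mid t" "p \<Delta> (midpoint a b) = e t"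
      using val[OF si(1)] ed si by blast
    obtain t' where t': "t' \<in> edge_range" "midpoint a b = edge_mid t'" "p \<Delta>' (midpoint a b) = e t'"
      using val[OF si(3)] ed si by blast
    have "t = t'" using t t' inj_onD[OF inj_on_edge_mid] by metis
    then show "p \<Delta> (midpoint a b) = p \<Delta>' (midpoint a b)" using t t' by simp
  next
    fix \<Delta> a b
    assume "\<Delta> \<in> triangulation n m"
      and ed: "closed_segment a b edge_of \<Delta> \<and> closed_segment a b \<subseteq> frontier unit_square"
    then obtain s i where si: "(s, i) \<in> idx" "\<Delta> = tri s i"
      by (auto simp: triangulation_eq)
    obtain t where t: "t \<in> edge_range" "midpoint a b = edge_mid t" "p \<Delta> (midpoint a b) = e t"
      using val[OF si(1)] ed si by blast
    have "midpoint a b \<in> frontier unit_square" using ed midpoint_in_closed_segment by blast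
    then have "t \<notin> edges" using edge_mid_frontier t by metis
    then have "e t = 0" using e unfolding dofs_def mem_Collect_eq by blast
    then show "p \<Delta> (midpoint a b) = 0" using t by simp
  next
    fix z assume "z \<notin> (\<Union>\<Delta>\<in>triangulation n m. interior \<Delta>)"
    then show "nc_fun e z = 0"
      by (intro nc_fun_outside) (auto simp: triangulation_eq interior_tri)
  qed
qed

lemma segment_frontierI:
  assumes "a \<in> unit_square" "b \<in> unit_square"
    and "fst a = fst b \<and> fst a \<in> {0, 1} \<or> snd a = snd b \<and> snd a \<in> {0, 1}"
  shows "closed_segment a b \<subseteq> frontier unit_square"
proof
  fix z assume "z \<in> closed_segment a b"
  then obtain u where u: "0 \<le> u" "u \<le> 1" "z = (1 - u) *\<^sub>R a + u *\<^sub>R b" by (auto simp: in_segment)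
  have "convex unit_square" by (simp add: unit_square_cbox convex_box)
  then have "z \<in> unit_square" using u assms(1,2) by (auto simp: convex_alt)
  moreover have "fst z \<in> {0, 1} \<or> snd z \<in> {0, 1}"
    using assms(3) by (auto simp: u algebra_simps)
  ultimately show "z \<in> frontier unit_square" by (auto simp: frontier_unit_square split_def)
qed

lemma apex_x_range: "i \<le> 2 * n \<Longrightarrow> 0 \<le> apex_x i \<and> apex_x i \<le> 1"
proof -
  assume "i \<le> 2 * n"
  then have "real i \<le> 2 * real n" using of_nat_le_iff[of i "2 * n", where 'a = real] by simp
  then have "real i * h \<le> 2 * real n * h" using h_pos by simp
  moreover have "2 * real n * h = 2" using nh by simp
  ultimately have "real i * h \<le> 2" by linarith
  then show ?thesis using h_pos by (simp add: apex_x_def)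
qed

lemma row_range:
  assumes "s < 2 * m"
  shows "0 \<le> ymid s - k / 2" "ymid s + k / 2 \<le> 1"
proof -
  have "real s + 1 \<le> 2 * real m" using assms of_nat_le_iff[of "s + 1" "2 * m", where 'a = real] by simp
  then have "(real s + 1) * k \<le> 2 * real m * k" using k_pos by simp
  then show "ymid s + k / 2 \<le> 1" using mk by (simp add: ymid_def algebra_simps)
  show "0 \<le> ymid s - k / 2" using k_pos by (simp add: ymid_def algebra_simps)
qed

lemma corners_in_square:
  assumes "(s, i) \<in> idx"
  shows "apex s i \<in> unit_square" "base_left s i \<in> unit_square" "base_right s i \<in> unit_square"
proof -
  have si: "s < 2 * m" "i \<le> 2 * n" using assms by (simp_all add: idx_iff)
  have "0 \<le> ymid s - \<tau> s i * k / 2 \<and> ymid s - \<tau> s i * k / 2 \<le> 1"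
       "0 \<le> ymid s + \<tau> s i * k / 2 \<and> ymid s + \<tau> s i * k / 2 \<le> 1"
    using tau_cases[of s i] row_range[OF si(1)] k_pos by auto
  moreover have "0 \<le> apex_x i - lft i * h / 2"
    using apex_x_range[of "i - 1"] si(2) by (cases i) (auto simp: lft_def apex_x_def algebra_simps)
  moreover have "apex_x i + rgt i * h / 2 \<le> 1"
    using apex_x_range[of "i + 1"] apex_x_range[of i] si(2) by (cases "i = 2 * n") (auto simp: rgt_def apex_x_def algebra_simps)
  moreover have "lft i * h \<ge> 0" "rgt i * h \<ge> 0" using h_pos lft_nonneg rgt_nonneg by simp_all
  ultimately show "apex s i \<in> unit_square" "base_left s i \<in> unit_square" "base_right s i \<in> unit_square"
    using apex_x_range[OF si(2)] by (auto simp: apex_def base_left_def base_right_def unit_square_def)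
qed

text \<open>
Each edge value is read off from one of the two adjacent triangles. The work is to show that the other
triangle, or the boundary condition, gives the same value.
\<close>

lemma nonconforming_P1_is_nc_fun:
  assumes v: "v \<in> nonconforming_P1 n m"
  shows "\<exists>e\<in>dofs. v = nc_fun e"
proof -
  obtain p where P: "\<forall>\<Delta> \<in> triangulation n m. linear_polynomial (p \<Delta>) \<and> (\<forall>z \<in> interior \<Delta>. v z = p \<Delta> z)"
    and cont': "\<forall>\<Delta> \<in> triangulation n m. \<forall>\<Delta>' \<in> triangulation n m. \<forall>a b.
        closed_segment a b edge_of \<Delta> \<and> closed_segment a b edge_of \<Delta>' \<longrightarrow>
        p \<Delta> (midpoint a b) = p \<Delta>' (midpoint a b)"
    and bdry': "\<forall>\<Delta> \<in> triangulation n m. \<forall>a b.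
        closed_segment a b edge_of \<Delta> \<and> closed_segment a b \<subseteq> frontier unit_square \<longrightarrow>
        p \<Delta> (midpoint a b) = 0"
    and out: "\<forall>z. z \<notin> (\<Union>\<Delta> \<in> triangulation n m. interior \<Delta>) \<longrightarrow> v z = 0"
    using v unfolding nonconforming_P1_def mem_Collect_eq by (elim exE conjE) (rule that)
  have p: "\<Delta> \<in> triangulation n m \<Longrightarrow> linear_polynomial (p \<Delta>)"
      "\<Delta> \<in> triangulation n m \<Longrightarrow> z \<in> interior \<Delta> \<Longrightarrow> v z = p \<Delta> z" for \<Delta> z
    using P by auto
  note cont = cont'[rule_format, OF _ _ conjI] and bdry = bdry'[rule_format, OF _ conjI]
  define e where "e = (\<lambda>t. if t \<in> edges then p (tri (fst t div 2) (snd t)) (edge_mid t) else 0)"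
  have e: "e \<in> dofs" by (simp add: dofs_def e_def)
  have tr: "tri s i \<in> triangulation n m" if "(s, i) \<in> idx" for s i
    using that by (auto simp: triangulation_eq)
  have vals: "p (tri s i) (edge_mid t) = e t" if si: "(s, i) \<in> idx" and t: "t \<in> tri_edges s i" for s i t
  proof -
    have s: "s < 2 * m" and i: "i \<le> 2 * n" using si by (simp_all add: idx_iff)
    note em = edge_mid_tri_edges[OF i, of s]
    have ed: "closed_segment (apex s i) (base_left s i) edge_of tri s i"
      "closed_segment (apex s i) (base_right s i) edge_of tri s i"
      "closed_segment (base_left s i) (base_right s i) edge_of tri s i"
      by (simp_all add: edge_of_tri)
    note sq = corners_in_square[OF si]
    from t consider "t = (2 * s + 1, i)" | "t = (2 * s + 1, i + 1)" | "t = (2 * base_row s i, i)"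
      by (auto simp: tri_edges_def)
    then show ?thesis
    proof cases
      case 1
      show ?thesis
      proof (cases "i = 0")
        case True
        have "closed_segment (apex s i) (base_left s i) \<subseteq> frontier unit_square"
          by (rule segment_frontierI) (use sq True in \<open>auto simp: apex_def base_left_def apex_x_def lft_def\<close>)
        then have "p (tri s i) (edge_mid t) = 0"
          using bdry[OF tr[OF si] ed(1)] by (simp only: 1 em midpoint_edges)
        then show ?thesis using e True by (simp add: 1 dofs_def edges_def)
      next
        case False
        then have "t \<in> edges" using 1 s i by (auto simp: edges_def)
        then show ?thesis by (simp add: e_def 1)
      qed
    next
      case 2
      show ?thesis
      proof (cases "i = 2 * n")
        case True
        have "closed_segment (apex s i) (base_right s i) \<subseteq> frontier unit_square"
          by (rule segment_frontierI) (use sq True apex_x_last in \<open>auto simp: apex_def base_right_def rgt_def\<close>)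
        then have "p (tri s i) (edge_mid t) = 0"
          using bdry[OF tr[OF si] ed(2)] by (simp only: 2 em midpoint_edges)
        then show ?thesis using e True by (simp add: 2 dofs_def edges_def)
      next
        case False
        then have te: "t \<in> edges" and si': "(s, i + 1) \<in> idx" using 2 s i by (auto simp: edges_def idx_iff)
        have t1: "\<tau> s (i + 1) = - \<tau> s i" by (simp add: \<tau>_def)
        have "apex s (i + 1) = base_right s i" "base_left s (i + 1) = apex s i"
          using False unfolding apex_def base_right_def base_left_def t1
          by (simp_all add: apex_x_def lft_def rgt_def algebra_simps)
        then have "closed_segment (apex s i) (base_right s i) edge_of tri s (i + 1)"
          unfolding edge_of_tri by (simp add: insert_commute)
        from cont[OF tr[OF si] tr[OF si'] ed(2) this]
        have "p (tri s i) (edge_mid t) = p (tri s (i + 1)) (edge_mid t)"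
          by (simp only: 2 em midpoint_edges)
        then show ?thesis using te by (simp add: e_def 2)
      qed
    next
      case 3
      show ?thesis
      proof (cases "even (s + i)")
        case odd: False
        show ?thesis
        proof (cases "s = 0")
          case True
          have "closed_segment (base_left s i) (base_right s i) \<subseteq> frontier unit_square"
            by (rule segment_frontierI) (use sq True odd in \<open>auto simp: base_left_def base_right_def \<tau>_def ymid_def\<close>)
          then have "p (tri s i) (edge_mid t) = 0"
            using bdry[OF tr[OF si] ed(3)] by (simp only: 3 em midpoint_edges)
          then show ?thesis using e True odd by (simp add: 3 base_row_def dofs_def edges_def)
        next
          case False
          then have "t \<in> edges" using odd s i by (auto simp: 3 base_row_def edges_def)
          then show ?thesis using odd by (simp add: e_def 3 base_row_def)
        qed
      next
        case ev: True
        show ?thesis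
        proof (cases "s + 1 = 2 * m")
          case True
          then have s1: "real s + 1 = 2 * real m" using of_nat_eq_iff[of "s + 1" "2 * m", where 'a = real] by simp
          have "ymid s + \<tau> s i * k / 2 = (real s + 1) * k" using ev by (simp add: \<tau>_def ymid_def algebra_simps)
          then have "ymid s + \<tau> s i * k / 2 = 1" using s1 mk by simp
          then have "closed_segment (base_left s i) (base_right s i) \<subseteq> frontier unit_square"
            by (intro segment_frontierI) (use sq in \<open>auto simp: base_left_def base_right_def\<close>)
          then have "p (tri s i) (edge_mid t) = 0"
            using bdry[OF tr[OF si] ed(3)] by (simp only: 3 em midpoint_edges)
          moreover have "t \<notin> edges" using True ev by (auto simp: 3 base_row_def edges_def)
          ultimately show ?thesis using e unfolding dofs_def mem_Collect_eq by metis
        next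
          case False
          then have te: "t \<in> edges" and si': "(s + 1, i) \<in> idx"
            using ev s i by (auto simp: 3 base_row_def edges_def idx_iff)
          have t1: "\<tau> (s + 1) i = - \<tau> s i" by (simp add: \<tau>_def)
          have "base_left (s + 1) i = base_left s i" "base_right (s + 1) i = base_right s i"
            using ev unfolding base_right_def base_left_def t1
            by (simp_all add: ymid_def \<tau>_def algebra_simps)
          then have "closed_segment (base_left s i) (base_right s i) edge_of tri (s + 1) i"
            unfolding edge_of_tri by simp
          from cont[OF tr[OF si] tr[OF si'] ed(3) this]
          have "p (tri s i) (edge_mid t) = p (tri (s + 1) i) (edge_mid t)"
            by (simp only: 3 em midpoint_edges)
          then show ?thesis using te ev by (simp add: e_def 3 base_row_def)
        qed
      qed
    qed
  qed
  have "v z = nc_fun e z" for z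
  proof (cases "\<exists>s i. (s, i) \<in> idx \<and> z \<in> cell s i")
    case True
    then obtain s i where si: "(s, i) \<in> idx" "z \<in> cell s i" by blast
    then have "v z = p (tri s i) z" using p(2)[OF tr] by (simp add: interior_tri)
    also have "\<dots> = local_poly e s i z"
      by (rule linear_eq_local_poly[OF e si(1) p(1)[OF tr[OF si(1)]] vals[OF si(1)]])
    finally show ?thesis using nc_fun_cell si by simp
  next
    case False
    then have "z \<notin> (\<Union>\<Delta>\<in>triangulation n m. interior \<Delta>)" by (auto simp: triangulation_eq interior_tri)
    then have "v z = 0" using out by blast
    then show ?thesis using nc_fun_outside[of z e] False by simp
  qed
  then show ?thesis using e by blast
qed

theorem nonconforming_P1_eq: "nonconforming_P1 n m = nc_fun ` dofs"
  using nonconforming_P1_is_nc_fun nc_fun_in_nonconforming_P1 by blast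

end

section \<open>Moments of a cell\<close>

context anisotropic_mesh begin

definition cell_int :: "nat \<Rightarrow> nat \<Rightarrow> (real \<times> real \<Rightarrow> real) \<Rightarrow> real" where
  "cell_int s i g = (LINT z : cell s i | lebesgue. g z)"

definition area :: "nat \<Rightarrow> real" where "area i = (lft i + rgt i) * h * k / 4"

lemma cell_subset_tri: "cell s i \<subseteq> tri s i"
  using interior_subset[of "tri s i"] by (simp add: interior_tri)

lemma cell_sets: "cell s i \<in> sets borel" using open_cell by simp

lemma cont_integrable_lborel:
  assumes "continuous_on UNIV g"
  shows "set_integrable lborel (cell s i) (g :: real \<times> real \<Rightarrow> real)"
proof -
  have "compact (tri s i)" by (auto simp: tri_def intro!: finite_imp_compact_convex_hull)
  moreover have "continuous_on (tri s i) g" using assms continuous_on_subset by blast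
  ultimately have "set_integrable lborel (tri s i) g"
    unfolding set_integrable_def by (rule borel_integrable_compact)
  then show ?thesis by (rule set_integrable_subset) (use cell_subset_tri cell_sets in auto)
qed

lemma cell_indicator_measurable:
  assumes "continuous_on UNIV g"
  shows "(\<lambda>z. indicator (cell s i) z *\<^sub>R (g z :: real)) \<in> borel_measurable lborel"
proof -
  have [measurable]: "g \<in> borel_measurable borel" by (rule borel_measurable_continuous_onI[OF assms])
  have [measurable]: "cell s i \<in> sets borel" by (rule cell_sets)
  show ?thesis by measurable
qed

lemma cont_integrable:
  assumes "continuous_on UNIV g"
  shows "set_integrable lebesgue (cell s i) (g :: real \<times> real \<Rightarrow> real)"
  using cont_integrable_lborel[OF assms] unfolding set_integrable_def
  by (rule integrable_completion[THEN iffD2, rotated]) (rule cell_indicator_measurable[OF assms])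

lemma cell_int_lborel:
  assumes "continuous_on UNIV g"
  shows "cell_int s i g = (LINT z : cell s i | lborel. g z)"
  unfolding cell_int_def set_lebesgue_integral_def
  by (rule integral_completion) (rule cell_indicator_measurable[OF assms])

lemma power_integral_interval:
  fixes a b c :: real
  assumes "a \<le> b"
  shows "(LINT x : {a<..<b} | lborel. (x - c) ^ p) = ((b - c) ^ (p + 1) - (a - c) ^ (p + 1)) / real (p + 1)"
proof -
  have "(LINT x : {a<..<b} | lborel. (x - c) ^ p) = (LBINT x=a..b. (x - c) ^ p)"
    using assms by (simp add: interval_integral_eq_integral interval_lebesgue_integral_def einterval_eq)
  also have "\<dots> = (b - c) ^ (p + 1) / real (p + 1) - (a - c) ^ (p + 1) / real (p + 1)"
  proof (rule interval_integral_FTC_finite)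
    fix x
    have "((\<lambda>x. (x - c) ^ (p + 1) / real (p + 1)) has_real_derivative (x - c) ^ p) (at x)"
    proof -
      have "((\<lambda>x. x - c) has_real_derivative 1) (at x)" by (auto intro!: derivative_eq_intros)
      from DERIV_cdivide[OF DERIV_power[OF this, of "p + 1"], of "real (p + 1)"]
      show ?thesis by simp
    qed
    then show "((\<lambda>x. (x - c) ^ (p + 1) / real (p + 1)) has_vector_derivative (x - c) ^ p) (at x within {min a b..max a b})"
      using has_real_derivative_iff_has_vector_derivative has_vector_derivative_at_within by blast
  qed (intro continuous_intros)
  finally show ?thesis by (simp add: diff_divide_distrib)
qed

text \<open>
Integration along horizontal slices. The slice at relative depth \<open>t\<close> reaches from the vertical line
through the apex by \<open>t * h / 2\<close> to either side, unless that side is cut off, and \<open>y - ymid s\<close> equals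
\<open>\<tau> * k * (t - 1 / 2)\<close>; what remains is an integral in \<open>t\<close> over the unit interval.
\<close>

lemma cell_moment:
  assumes G: "\<And>t. (G has_real_derivative t ^ (p + 1) * (t - 1 / 2) ^ q) (at t)"
  shows "cell_int s i (\<lambda>z. (fst z - apex_x i) ^ p * (snd z - ymid s) ^ q) =
    (rgt i ^ (p + 1) - (- lft i) ^ (p + 1)) * (h / 2) ^ (p + 1) / real (p + 1) * k * (\<tau> s i * k) ^ q * (G 1 - G 0)"
proof -
  let ?F = "\<lambda>z. (fst z - apex_x i) ^ p * (snd z - ymid s) ^ q"
  define \<epsilon> where "\<epsilon> = (rgt i ^ (p + 1) - (- lft i) ^ (p + 1)) * (h / 2) ^ (p + 1) / real (p + 1)"
  let ?a = "ymid s - k / 2" and ?b = "ymid s + k / 2"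
  let ?t = "depth s i"
  have cont: "continuous_on UNIV ?F" by (intro continuous_intros)
  have alg: "(A * H * T - B * H * T) / P * (K * S) = (A - B) * H / P * K * (T * S)" for A B H T P K S :: real
    by (simp add: algebra_simps diff_divide_distrib)
  have hk: "h > 0" "k > 0" by (rule h_pos k_pos)+
  have tin: "0 < ?t y \<and> ?t y < 1 \<longleftrightarrow> y \<in> {?a<..<?b}" for y
    using hk tau_cases[of s i] by (auto simp: depth_def field_simps)
  have "integrable (lborel \<Otimes>\<^sub>M lborel) (case_prod (\<lambda>x y. indicator (cell s i) (x, y) *\<^sub>R ?F (x, y)))"
    using cont_integrable_lborel[OF cont] by (simp add: set_integrable_def lborel_prod split_def)
  then have fub: "(LINT y|lborel. LINT x|lborel. indicator (cell s i) (x, y) *\<^sub>R ?F (x, y)) =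
      (LINT z|(lborel \<Otimes>\<^sub>M lborel). case_prod (\<lambda>x y. indicator (cell s i) (x, y) *\<^sub>R ?F (x, y)) z)"
    by (rule lborel_pair.integral_snd)
  have inner: "(LINT x|lborel. indicator (cell s i) (x, y) *\<^sub>R ?F (x, y)) =
      indicator {?a<..<?b} y *\<^sub>R (\<epsilon> * (\<tau> s i * k) ^ q * (?t y ^ (p + 1) * (?t y - 1 / 2) ^ q))" for y
  proof (cases "y \<in> {?a<..<?b}")
    case True
    then have t: "0 < ?t y" "?t y < 1" using tin by auto
    let ?l = "apex_x i - lft i * ?t y * h / 2" and ?r = "apex_x i + rgt i * ?t y * h / 2"
    have lr: "?l \<le> ?r" using t hk lft_nonneg[of i] rgt_nonneg[of i]
      by (smt (verit) divide_nonneg_pos mult_nonneg_nonneg)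
    have "(LINT x|lborel. indicator (cell s i) (x, y) *\<^sub>R ?F (x, y)) =
        (LINT x|lborel. (indicator {?l<..<?r} x *\<^sub>R (x - apex_x i) ^ p) * (y - ymid s) ^ q)"
      using t by (intro Bochner_Integration.integral_cong) (auto simp: cell_def indicator_def)
    also have "\<dots> = (LINT x : {?l<..<?r} | lborel. (x - apex_x i) ^ p) * (y - ymid s) ^ q"
      by (simp add: set_lebesgue_integral_def)
    also have "\<dots> = ((rgt i * ?t y * h / 2) ^ (p + 1) - (- (lft i * ?t y * h / 2)) ^ (p + 1)) / real (p + 1) * (y - ymid s) ^ q"
      using lr by (subst power_integral_interval) simp_all
    also have "(rgt i * ?t y * h / 2) ^ (p + 1) = rgt i ^ (p + 1) * (h / 2) ^ (p + 1) * ?t y ^ (p + 1)"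
      by (simp only: power_mult_distrib[symmetric]) (simp add: mult_ac)
    also have "(- (lft i * ?t y * h / 2)) ^ (p + 1) = (- lft i) ^ (p + 1) * (h / 2) ^ (p + 1) * ?t y ^ (p + 1)"
      by (simp only: power_mult_distrib[symmetric]) (simp add: mult_ac)
    also have "y - ymid s = \<tau> s i * k * (?t y - 1 / 2)"
      using hk by (simp add: depth_def)
    also have "(\<tau> s i * k * (?t y - 1 / 2)) ^ q = (\<tau> s i * k) ^ q * (?t y - 1 / 2) ^ q"
      by (rule power_mult_distrib)
    finally have "(LINT x|lborel. indicator (cell s i) (x, y) *\<^sub>R ?F (x, y)) =
      \<epsilon> * (\<tau> s i * k) ^ q * (?t y ^ (p + 1) * (?t y - 1 / 2) ^ q)"
      unfolding \<epsilon>_def alg .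
    then show ?thesis using True by simp
  next
    case False
    then have "indicator (cell s i) (x, y) = (0::real)" for x
      using tin[of y] by (auto simp: cell_def indicator_def)
    then show ?thesis using False by simp
  qed
  have ivl: "(LBINT y=?a..?b. g y) = (LINT y|lborel. indicator {?a<..<?b} y *\<^sub>R g y)" for g :: "real \<Rightarrow> real"
    using hk by (simp add: interval_lebesgue_integral_def einterval_eq set_lebesgue_integral_def)
  have "cell_int s i ?F = (LINT y|lborel. indicator {?a<..<?b} y *\<^sub>R (\<epsilon> * (\<tau> s i * k) ^ q * (?t y ^ (p + 1) * (?t y - 1 / 2) ^ q)))"
    unfolding cell_int_lborel[OF cont] set_lebesgue_integral_def inner[symmetric] fub
    by (simp add: lborel_prod split_def)
  also have "\<dots> = (LBINT y=?a..?b. \<epsilon> * (\<tau> s i * k) ^ q * (?t y ^ (p + 1) * (?t y - 1 / 2) ^ q))"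
    by (rule ivl[symmetric])
  also have "\<dots> = \<epsilon> * (\<tau> s i * k) ^ q * (\<tau> s i * k * G (?t ?b)) - \<epsilon> * (\<tau> s i * k) ^ q * (\<tau> s i * k * G (?t ?a))"
  proof (rule interval_integral_FTC_finite)
    show "continuous_on {min ?a ?b..max ?a ?b} (\<lambda>y. \<epsilon> * (\<tau> s i * k) ^ q * (?t y ^ (p + 1) * (?t y - 1 / 2) ^ q))"
      unfolding depth_def using hk by (intro continuous_intros) auto
    fix y
    have "(?t has_real_derivative \<tau> s i / k) (at y)"
      unfolding depth_def using hk by (auto intro!: derivative_eq_intros)
    from DERIV_chain2[OF G this]
    have "((\<lambda>y. G (?t y)) has_real_derivative ?t y ^ (p + 1) * (?t y - 1 / 2) ^ q * (\<tau> s i / k)) (at y)" .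
    from DERIV_cmult[OF this, of "\<epsilon> * (\<tau> s i * k) ^ q * (\<tau> s i * k)"]
    have "((\<lambda>y. \<epsilon> * (\<tau> s i * k) ^ q * (\<tau> s i * k * G (?t y))) has_real_derivative
        \<epsilon> * (\<tau> s i * k) ^ q * (?t y ^ (p + 1) * (?t y - 1 / 2) ^ q)) (at y)"
      using hk tau_cases[of s i] by (elim disjE) (simp_all add: mult_ac)
    then show "((\<lambda>y. \<epsilon> * (\<tau> s i * k) ^ q * (\<tau> s i * k * G (?t y))) has_vector_derivative
        \<epsilon> * (\<tau> s i * k) ^ q * (?t y ^ (p + 1) * (?t y - 1 / 2) ^ q)) (at y within {min ?a ?b..max ?a ?b})"
      using has_real_derivative_iff_has_vector_derivative has_vector_derivative_at_within by blast
  qed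
  also have "\<dots> = \<epsilon> * k * (\<tau> s i * k) ^ q * (G 1 - G 0)"
  proof -
    have tb: "?t ?b = 1 / 2 + \<tau> s i / 2" "?t ?a = 1 / 2 - \<tau> s i / 2" using hk by (simp_all add: depth_def)
    show ?thesis unfolding tb using tau_cases[of s i] by (elim disjE) (simp_all add: algebra_simps)
  qed
  finally show ?thesis by (simp add: \<epsilon>_def)
qed

definition moment :: "nat \<Rightarrow> nat \<Rightarrow> nat \<Rightarrow> nat \<Rightarrow> real" where
  "moment s i p q = cell_int s i (\<lambda>z. (fst z - apex_x i) ^ p * (snd z - ymid s) ^ q)"

lemma moment_values:
  "moment s i 0 0 = (rgt i + lft i) * h * k / 4"
  "moment s i 0 1 = (rgt i + lft i) * h * k ^ 2 * \<tau> s i / 24"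
  "moment s i 0 2 = (rgt i + lft i) * h * k ^ 3 / 48"
  "moment s i 0 3 = (rgt i + lft i) * h * k ^ 4 * \<tau> s i / 160"
  "moment s i 1 0 = (rgt i - lft i) * h ^ 2 * k / 24"
  "moment s i 1 1 = (rgt i - lft i) * h ^ 2 * k ^ 2 * \<tau> s i / 96"
  "moment s i 1 2 = (rgt i - lft i) * h ^ 2 * k ^ 3 / 240"
  "moment s i 2 0 = (rgt i + lft i) * h ^ 3 * k / 96"
  "moment s i 2 1 = (rgt i + lft i) * h ^ 3 * k ^ 2 * \<tau> s i / 320"
  "moment s i 3 0 = (rgt i - lft i) * h ^ 4 * k / 320"
proof -
  have e: "(rgt i ^ Suc p - (- lft i) ^ Suc p) = rgt i + (if even p then lft i else - lft i)" for p
    using lft_rgt_cases[of i] by auto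
  note M = cell_moment[of _ _ _ s i, folded moment_def, simplified e]
  have lr: "rgt i * rgt i = rgt i" "lft i * lft i = lft i" "rgt i * (rgt i * x) = rgt i * x"
    "lft i * (lft i * x) = lft i * x" for x
    using lft_rgt_cases[of i] by auto
  have t3: "\<tau> s i ^ 2 = 1" "\<tau> s i ^ 3 = \<tau> s i" using tau_cases[of s i] by auto
  show "moment s i 0 0 = (rgt i + lft i) * h * k / 4"
    by (subst M[of "\<lambda>t. t ^ 2 / 2"]) (auto intro!: derivative_eq_intros simp: e power_mult_distrib t3 lr)
  show "moment s i 0 1 = (rgt i + lft i) * h * k ^ 2 * \<tau> s i / 24"
    by (subst M[of "\<lambda>t. t ^ 3 / 3 - t ^ 2 / 4"]) (auto intro!: derivative_eq_intros simp: e power_mult_distrib t3 lr field_simps power2_eq_square power3_eq_cube)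
  show "moment s i 0 2 = (rgt i + lft i) * h * k ^ 3 / 48"
    by (subst M[of "\<lambda>t. t ^ 4 / 4 - t ^ 3 / 3 + t ^ 2 / 8"]) (auto intro!: derivative_eq_intros simp: e power_mult_distrib t3 lr field_simps eval_nat_numeral)
  show "moment s i 0 3 = (rgt i + lft i) * h * k ^ 4 * \<tau> s i / 160"
    by (subst M[of "\<lambda>t. t ^ 5 / 5 - 3 * t ^ 4 / 8 + t ^ 3 / 4 - t ^ 2 / 16"]) (auto intro!: derivative_eq_intros simp: e power_mult_distrib t3 lr field_simps eval_nat_numeral)
  show "moment s i 1 0 = (rgt i - lft i) * h ^ 2 * k / 24"
    by (subst M[of "\<lambda>t. t ^ 3 / 3"]) (auto intro!: derivative_eq_intros simp: e power_mult_distrib t3 lr field_simps eval_nat_numeral)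
  show "moment s i 1 1 = (rgt i - lft i) * h ^ 2 * k ^ 2 * \<tau> s i / 96"
    by (subst M[of "\<lambda>t. t ^ 4 / 4 - t ^ 3 / 6"]) (auto intro!: derivative_eq_intros simp: e power_mult_distrib t3 lr field_simps eval_nat_numeral)
  show "moment s i 1 2 = (rgt i - lft i) * h ^ 2 * k ^ 3 / 240"
    by (subst M[of "\<lambda>t. t ^ 5 / 5 - t ^ 4 / 4 + t ^ 3 / 12"]) (auto intro!: derivative_eq_intros simp: e power_mult_distrib t3 lr field_simps eval_nat_numeral)
  show "moment s i 2 0 = (rgt i + lft i) * h ^ 3 * k / 96"
    by (subst M[of "\<lambda>t. t ^ 4 / 4"]) (auto intro!: derivative_eq_intros simp: e power_mult_distrib t3 lr field_simps eval_nat_numeral)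
  show "moment s i 2 1 = (rgt i + lft i) * h ^ 3 * k ^ 2 * \<tau> s i / 320"
    by (subst M[of "\<lambda>t. t ^ 5 / 5 - t ^ 4 / 8"]) (auto intro!: derivative_eq_intros simp: e power_mult_distrib t3 lr field_simps eval_nat_numeral)
  show "moment s i 3 0 = (rgt i - lft i) * h ^ 4 * k / 320"
    by (subst M[of "\<lambda>t. t ^ 5 / 5"]) (auto intro!: derivative_eq_intros simp: e power_mult_distrib t3 lr field_simps eval_nat_numeral)
qed

end

section \<open>Energy, load and the Galerkin solution\<close>

text \<open>
Existence of the Galerkin solution: on functions supported in a finite set, a definite symmetric
bilinear form represents every linear functional. Each new point of the support is handled by one
Gram--Schmidt step.
\<close>

lemma riesz_finite_support:
  fixes B :: "('k \<Rightarrow> real) \<Rightarrow> ('k \<Rightarrow> real) \<Rightarrow> real" and F :: "('k \<Rightarrow> real) \<Rightarrow> real"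
  assumes "finite K"
    and sym: "\<And>x y. B x y = B y x"
    and lin: "\<And>x y c z. B (\<lambda>t. x t + c * y t) z = B x z + c * B y z"
    and pd: "\<And>x. (\<And>t. t \<notin> K \<Longrightarrow> x t = 0) \<Longrightarrow> B x x = 0 \<Longrightarrow> x = (\<lambda>t. 0)"
    and F: "\<And>x c y. F (\<lambda>t. x t + c * y t) = F x + c * F y"
  shows "\<exists>x. (\<forall>t. t \<notin> K \<longrightarrow> x t = 0) \<and> (\<forall>y. (\<forall>t. t \<notin> K \<longrightarrow> y t = 0) \<longrightarrow> B x y = F y)"
  using assms(1) pd F
proof (induction K arbitrary: F)
  case empty
  have F0: "F (\<lambda>t. 0) = 0" using empty(2)[of "\<lambda>t. 0" 1 "\<lambda>t. 0"] by simp
  have B0: "B (\<lambda>t. 0) (\<lambda>t. 0) = 0" using lin[of "\<lambda>t. 0" 1 "\<lambda>t. 0" "\<lambda>t. 0"] by simp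
  have z: "B (\<lambda>t. 0) y = F y" if "\<forall>t. t \<notin> {} \<longrightarrow> y t = 0" for y
  proof -
    have y: "y = (\<lambda>t. 0)" by (rule ext) (use that in blast)
    show ?thesis unfolding y by (rule trans[OF B0 F0[symmetric]])
  qed
  show ?case by (rule exI[of _ "\<lambda>t. 0"]) (use z in simp)
next
  case (insert k K)
  define V where "V = {x :: 'k \<Rightarrow> real. \<forall>t. t \<notin> K \<longrightarrow> x t = 0}"
  have pdK: "x = (\<lambda>t. 0)" if "\<And>t. t \<notin> K \<Longrightarrow> x t = 0" "B x x = 0" for x
    by (rule insert.prems(1)) (use that in auto)
  have linr: "B z (\<lambda>t. x t + c * y t) = B z x + c * B z y" for x y z c
    using lin[of x c y z] sym by metis
  define \<delta> :: "'k \<Rightarrow> real" where "\<delta> = (\<lambda>t. if t = k then 1 else 0)"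
  have IH: "\<exists>x\<in>V. \<forall>y\<in>V. B x y = G y"
    if G: "\<And>x c y. G (\<lambda>t. x t + c * y t) = G x + c * G y" for G
  proof -
    have "\<exists>x. (\<forall>t. t \<notin> K \<longrightarrow> x t = 0) \<and> (\<forall>y. (\<forall>t. t \<notin> K \<longrightarrow> y t = 0) \<longrightarrow> B x y = G y)"
    proof (rule insert.IH)
      show "x = (\<lambda>t. 0)" if "\<And>t. t \<notin> K \<Longrightarrow> x t = 0" "B x x = 0" for x
        by (rule pdK) (use that in simp_all)
    qed (rule G)
    then show ?thesis by (simp add: V_def Bex_def)
  qed
  obtain u where u: "u \<in> V" "\<forall>y\<in>V. B u y = F y"
    using IH[of F, OF insert.prems(2)] ..
  obtain p where p: "p \<in> V" "\<forall>y\<in>V. B p y = B \<delta> y"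
    using IH[of "B \<delta>", OF linr] ..
  define e where "e = (\<lambda>t. \<delta> t + (-1) * p t)"
  have ek: "e k = 1" using p(1) insert.hyps(2) by (simp add: e_def \<delta>_def V_def)
  have esupp: "\<And>t. t \<notin> insert k K \<Longrightarrow> e t = 0" using p(1) by (simp add: e_def \<delta>_def V_def)
  have "B e e \<noteq> 0"
  proof
    assume z: "B e e = 0"
    have "e = (\<lambda>t. 0)" by (rule insert.prems(1)) (use esupp z in simp_all)
    from fun_cong[OF this, of k] show False using ek by simp
  qed
  have orth: "B e y = 0" if "y \<in> V" for y using bspec[OF p(2) that] unfolding e_def lin by simp
  define c where "c = F e / B e e"
  define x where "x = (\<lambda>t. u t + c * e t)"
  have "B x y = F y" if y: "\<And>t. t \<notin> insert k K \<Longrightarrow> y t = 0" for y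
  proof -
    define y' where "y' = (\<lambda>t. y t + (- y k) * e t)"
    have "y' t = 0" if "t \<notin> K" for t
      using y[of t] esupp[of t] ek that by (cases "t = k") (simp_all add: y'_def)
    then have y': "y' \<in> V" by (simp add: V_def)
    have yy: "y = (\<lambda>t. y' t + y k * e t)" by (auto simp: y'_def)
    have "B u e = 0" using orth[OF u(1)] sym[of u e] by simp
    then have "B x y = B u y' + c * (y k * B e e)"
      by (subst yy) (simp add: x_def lin linr orth[OF y'])
    also have "\<dots> = F y' + y k * F e" using bspec[OF u(2) y'] \<open>B e e \<noteq> 0\<close> by (simp add: c_def)
    also have "\<dots> = F y" by (subst (2) yy) (simp add: insert.prems(2))
    finally show ?thesis .
  qed
  moreover have "\<forall>t. t \<notin> insert k K \<longrightarrow> x t = 0" using u(1) esupp by (auto simp: x_def V_def)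
  ultimately show ?case by (intro exI[of _ x]) simp
qed

lemma gradient_eqI:
  assumes "GDERIV v z :> D" shows "gradient v z = D"
  unfolding gradient_def
proof (rule the_equality)
  show "GDERIV v z :> D" by (rule assms)
  fix D' assume "GDERIV v z :> D'"
  then have "(\<lambda>h. h \<bullet> D') = (\<lambda>h. h \<bullet> D)" using assms has_derivative_unique unfolding gderiv_def by blast
  then show "D' = D" by (metis inner_commute vector_eq_ldot)
qed

lemma continuous_u_grad: "continuous_on UNIV u_grad"
proof -
  have "continuous_on UNIV (\<lambda>z::real\<times>real. ((1 - 2 * fst z) * (snd z * (1 - snd z)), fst z * (1 - fst z) * (1 - 2 * snd z)))"
    by (intro continuous_intros)
  then show ?thesis by (simp add: u_grad_def split_def)
qed

lemma continuous_f_rhs: "continuous_on UNIV f_rhs"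
  unfolding f_rhs_def split_def by (intro continuous_intros)

context anisotropic_mesh begin

lemma cell_int_add:
  "continuous_on UNIV g \<Longrightarrow> continuous_on UNIV g' \<Longrightarrow>
    cell_int s i (\<lambda>z. g z + g' z) = cell_int s i g + cell_int s i g'"
  unfolding cell_int_def by (intro set_integral_add cont_integrable)

lemma cell_int_cmult: "cell_int s i (\<lambda>z. c * g z) = c * cell_int s i g"
  unfolding cell_int_def by simp

lemma cell_int_const: "cell_int s i (\<lambda>z. c) = c * area i"
  using moment_values(1)[of s i] cell_int_cmult[of s i c "\<lambda>z. 1"] by (simp add: moment_def area_def)

lemma area_pos: "area i > 0"
  using lft_rgt_pos[of i] h_pos k_pos by (simp add: area_def)

lemma area_bounds: "h * k / 4 \<le> area i" "area i \<le> h * k / 2"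
  using lft_rgt_cases[of i] h_pos k_pos by (auto simp: area_def)

lemma cell_int_mono:
  assumes "continuous_on UNIV g" "continuous_on UNIV g'" "\<And>z. z \<in> cell s i \<Longrightarrow> g z \<le> g' z"
  shows "cell_int s i g \<le> cell_int s i g'"
  unfolding cell_int_def using assms by (intro set_integral_mono cont_integrable)

lemma cell_int_cong: "(\<And>z. z \<in> cell s i \<Longrightarrow> g z = g' z) \<Longrightarrow> cell_int s i g = cell_int s i g'"
  unfolding cell_int_def set_lebesgue_integral_def by (intro Bochner_Integration.integral_cong) (auto simp: indicator_def)

definition slope :: "(nat \<times> nat \<Rightarrow> real) \<Rightarrow> nat \<Rightarrow> nat \<Rightarrow> real \<times> real" where
  "slope e s i = (slope_x e s i, slope_y e s i)"

definition energy :: "(nat \<times> nat \<Rightarrow> real) \<Rightarrow> (nat \<times> nat \<Rightarrow> real) \<Rightarrow> real" where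
  "energy e e' = (\<Sum>s<2*m. \<Sum>i\<le>2*n. area i * (slope_x e s i * slope_x e' s i + slope_y e s i * slope_y e' s i))"
definition u_pairing :: "(nat \<times> nat \<Rightarrow> real) \<Rightarrow> real" where
  "u_pairing e = (\<Sum>s<2*m. \<Sum>i\<le>2*n. cell_int s i (\<lambda>z. u_grad z \<bullet> slope e s i))"
definition load :: "(nat \<times> nat \<Rightarrow> real) \<Rightarrow> real" where
  "load e = (\<Sum>s<2*m. \<Sum>i\<le>2*n. cell_int s i (\<lambda>z. f_rhs z * local_poly e s i z))"
definition u_energy :: real where
  "u_energy = (\<Sum>s<2*m. \<Sum>i\<le>2*n. cell_int s i (\<lambda>z. u_grad z \<bullet> u_grad z))"
definition consistency :: "(nat \<times> nat \<Rightarrow> real) \<Rightarrow> real" where "consistency e = u_pairing e - load e"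
definition error_sq :: "(nat \<times> nat \<Rightarrow> real) \<Rightarrow> real" where "error_sq e = u_energy - 2 * u_pairing e + energy e e"

lemma continuous_local_poly: "continuous_on UNIV (local_poly e s i)"
  unfolding local_poly_def by (intro continuous_intros)

lemma gderiv_local_poly: "GDERIV (local_poly e s i) z :> slope e s i"
  unfolding gderiv_def local_poly_def slope_def
  by (auto intro!: derivative_eq_intros simp: inner_prod_def algebra_simps)

lemma gderiv_nc_fun:
  assumes "(s, i) \<in> idx" "z \<in> cell s i"
  shows "GDERIV (nc_fun e) z :> slope e s i"
  using gderiv_local_poly[of e s i z] unfolding gderiv_def
  by (rule has_derivative_transform_within_open[OF _ open_cell assms(2)])
     (use nc_fun_cell assms in simp)

lemma gradient_nc_fun: "(s, i) \<in> idx \<Longrightarrow> z \<in> cell s i \<Longrightarrow> gradient (nc_fun e) z = slope e s i"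
  by (rule gradient_eqI[OF gderiv_nc_fun])

lemma gradient_error:
  "(s, i) \<in> idx \<Longrightarrow> z \<in> cell s i \<Longrightarrow> gradient (\<lambda>z. u_exact z - nc_fun e z) z = u_grad z - slope e s i"
proof (rule gradient_eqI)
  assume "(s, i) \<in> idx" "z \<in> cell s i"
  note gderiv_nc_fun[OF this, of e]
  then show "GDERIV (\<lambda>z. u_exact z - nc_fun e z) z :> u_grad z - slope e s i"
    using gderiv_u_exact[of z] unfolding gderiv_def
    by (auto intro!: derivative_eq_intros simp: inner_diff_right)
qed

lemma broken_form_cells:
  assumes "\<And>s i z. (s, i) \<in> idx \<Longrightarrow> z \<in> cell s i \<Longrightarrow> gradient v z \<bullet> gradient w z = g s i z"
  shows "broken_form n m v w = (\<Sum>s<2*m. \<Sum>i\<le>2*n. cell_int s i (g s i))"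
  unfolding broken_form_def sum_triangulation interior_tri cell_int_def[symmetric]
  by (intro sum.cong refl cell_int_cong assms) (auto simp: idx_def)

lemma broken_form_nc_fun: "broken_form n m (nc_fun e) (nc_fun e') = energy e e'"
proof -
  have "broken_form n m (nc_fun e) (nc_fun e') = (\<Sum>s<2*m. \<Sum>i\<le>2*n. cell_int s i (\<lambda>z. slope e s i \<bullet> slope e' s i))"
    by (rule broken_form_cells) (simp add: gradient_nc_fun)
  then show ?thesis by (simp add: cell_int_const energy_def slope_def mult.commute)
qed

text \<open>
So \<open>error_sq e\<close> is the squared broken distance of \<open>u\<close> from the function with the edge values \<open>e\<close>.
\<close>

lemma error_sq_cells: "error_sq e = (\<Sum>s<2*m. \<Sum>i\<le>2*n. cell_int s i (\<lambda>z. (u_grad z - slope e s i) \<bullet> (u_grad z - slope e s i)))"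
proof -
  have c: "continuous_on UNIV (\<lambda>z. u_grad z \<bullet> w)" "continuous_on UNIV (\<lambda>z. u_grad z \<bullet> u_grad z)" for w
    by (intro continuous_intros continuous_u_grad)+
  have "cell_int s i (\<lambda>z. (u_grad z - slope e s i) \<bullet> (u_grad z - slope e s i)) =
      cell_int s i (\<lambda>z. u_grad z \<bullet> u_grad z) - 2 * cell_int s i (\<lambda>z. u_grad z \<bullet> slope e s i)
        + area i * (slope_x e s i * slope_x e s i + slope_y e s i * slope_y e s i)" for s i
  proof -
    have "cell_int s i (\<lambda>z. (u_grad z - slope e s i) \<bullet> (u_grad z - slope e s i)) =
      cell_int s i (\<lambda>z. (u_grad z \<bullet> u_grad z + (-2) * (u_grad z \<bullet> slope e s i)) + slope e s i \<bullet> slope e s i)"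
      by (rule cell_int_cong) (simp add: inner_diff_left inner_diff_right inner_commute)
    also have "\<dots> = cell_int s i (\<lambda>z. u_grad z \<bullet> u_grad z) + (-2) * cell_int s i (\<lambda>z. u_grad z \<bullet> slope e s i)
        + (slope e s i \<bullet> slope e s i) * area i"
      using c by (subst cell_int_add, (intro continuous_intros c)+, subst cell_int_add, (intro continuous_intros c)+)
                 (simp only: cell_int_cmult cell_int_const)
    finally show ?thesis by (simp add: slope_def mult.commute)
  qed
  then show ?thesis
    by (simp add: error_sq_def u_energy_def u_pairing_def energy_def sum.distrib sum_subtractf sum_distrib_left)
qed

lemma broken_form_error: "broken_form n m (\<lambda>z. u_exact z - nc_fun e z) (\<lambda>z. u_exact z - nc_fun e z) = error_sq e"
  unfolding error_sq_cells by (rule broken_form_cells) (simp add: gradient_error)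

lemma load_nc_fun: "(LINT z : unit_square | lebesgue. f_rhs z * nc_fun e z) = load e"
proof -
  have sub: "cell s i \<subseteq> unit_square" if "(s, i) \<in> idx" for s i
  proof
    fix z assume "z \<in> cell s i"
    then show "z \<in> unit_square" using cell_bounds(1-4)[OF _ that, of "fst z" "snd z"]
      by (simp add: unit_square_def mem_Times_iff)
  qed
  have c: "continuous_on UNIV (\<lambda>z. f_rhs z * local_poly e s i z)" for s i
    by (intro continuous_intros continuous_f_rhs continuous_local_poly)
  have eq: "indicator unit_square z *\<^sub>R (f_rhs z * nc_fun e z) =
      (\<Sum>(s, i)\<in>idx. indicator (cell s i) z *\<^sub>R (f_rhs z * local_poly e s i z))" for z
    unfolding nc_fun_def sum_distrib_left scaleR_sum_right
  proof (intro sum.cong refl, clarify)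
    fix s i assume "(s, i) \<in> idx"
    then show "indicator unit_square z *\<^sub>R (f_rhs z * (indicator (cell s i) z * local_poly e s i z)) =
        indicator (cell s i) z *\<^sub>R (f_rhs z * local_poly e s i z)"
      using sub[of s i] by (cases "z \<in> cell s i") (auto simp: indicator_def)
  qed
  have "(LINT z : unit_square | lebesgue. f_rhs z * nc_fun e z) =
      (\<Sum>(s, i)\<in>idx. LINT z|lebesgue. indicator (cell s i) z *\<^sub>R (f_rhs z * local_poly e s i z))"
    unfolding set_lebesgue_integral_def eq split_def
    by (rule Bochner_Integration.integral_sum)
       (use cont_integrable[OF c] in \<open>auto simp: set_integrable_def\<close>)
  then show ?thesis
    by (simp add: load_def cell_int_def set_lebesgue_integral_def sum.cartesian_product idx_def)
qed

lemma coeffs_linear: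
  "slope_x (\<lambda>t. e t + c * e' t) s i = slope_x e s i + c * slope_x e' s i"
  "slope_y (\<lambda>t. e t + c * e' t) s i = slope_y e s i + c * slope_y e' s i"
  "center_val (\<lambda>t. e t + c * e' t) s i = center_val e s i + c * center_val e' s i"
  using h_pos k_pos
  by (simp_all add: slope_x_def slope_y_def center_val_def val_left_def val_right_def val_base_def field_simps)

lemma energy_sym: "energy e e' = energy e' e"
  by (simp add: energy_def mult.commute)

lemma energy_linear: "energy (\<lambda>t. e t + c * e' t) w = energy e w + c * energy e' w"
  by (simp add: energy_def coeffs_linear algebra_simps sum.distrib sum_distrib_left)

lemma energy_linear_right: "energy w (\<lambda>t. e t + c * e' t) = energy w e + c * energy w e'"
  using energy_linear[of e c e' w] energy_sym by metis

lemma slope_linear: "slope (\<lambda>t. e t + c * e' t) s i = slope e s i + c *\<^sub>R slope e' s i"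
  by (simp add: slope_def coeffs_linear)

lemma local_poly_linear: "local_poly (\<lambda>t. e t + c * e' t) s i z = local_poly e s i z + c * local_poly e' s i z"
  by (simp add: local_poly_def coeffs_linear algebra_simps)

lemma u_pairing_linear: "u_pairing (\<lambda>t. e t + c * e' t) = u_pairing e + c * u_pairing e'"
proof -
  have ct: "continuous_on UNIV (\<lambda>z. u_grad z \<bullet> w)" for w
    by (intro continuous_intros continuous_u_grad)
  have "cell_int s i (\<lambda>z. u_grad z \<bullet> slope (\<lambda>t. e t + c * e' t) s i) =
     cell_int s i (\<lambda>z. u_grad z \<bullet> slope e s i) + c * cell_int s i (\<lambda>z. u_grad z \<bullet> slope e' s i)" for s i
    unfolding cell_int_cmult[symmetric] slope_linear inner_add_right inner_scaleR_right
    by (rule cell_int_add) (intro continuous_intros ct)+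
  then show ?thesis by (simp add: u_pairing_def sum.distrib sum_distrib_left)
qed

lemma load_linear: "load (\<lambda>t. e t + c * e' t) = load e + c * load e'"
proof -
  have ct: "continuous_on UNIV (\<lambda>z. f_rhs z * local_poly e s i z)" for e s i
    by (intro continuous_intros continuous_f_rhs continuous_local_poly)
  have "cell_int s i (\<lambda>z. f_rhs z * local_poly (\<lambda>t. e t + c * e' t) s i z) =
     cell_int s i (\<lambda>z. f_rhs z * local_poly e s i z) + c * cell_int s i (\<lambda>z. f_rhs z * local_poly e' s i z)" for s i
  proof -
    have "cell_int s i (\<lambda>z. f_rhs z * local_poly (\<lambda>t. e t + c * e' t) s i z) =
      cell_int s i (\<lambda>z. f_rhs z * local_poly e s i z + c * (f_rhs z * local_poly e' s i z))"
      by (simp add: local_poly_linear algebra_simps)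
    then show ?thesis
      unfolding cell_int_cmult[symmetric]
      by (subst (asm) cell_int_add) (intro continuous_intros ct | simp)+
  qed
  then show ?thesis by (simp add: load_def sum.distrib sum_distrib_left)
qed

lemma consistency_linear: "consistency (\<lambda>t. e t + c * e' t) = consistency e + c * consistency e'"
  by (simp add: consistency_def u_pairing_linear load_linear algebra_simps)

lemma error_sq_nonneg: "error_sq e \<ge> 0"
proof -
  have "0 \<le> cell_int s i (\<lambda>z. (u_grad z - slope e s i) \<bullet> (u_grad z - slope e s i))" for s i
    unfolding cell_int_def set_lebesgue_integral_def by (rule integral_nonneg_AE) auto
  then show ?thesis unfolding error_sq_cells by (intro sum_nonneg) auto
qed

lemma energy_nonneg: "energy e e \<ge> 0"
proof -
  have "0 \<le> area i * (slope_x e s i * slope_x e s i + slope_y e s i * slope_y e s i)" for s i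
    using area_pos[of i] by (intro mult_nonneg_nonneg add_nonneg_nonneg zero_le_square) auto
  then show ?thesis unfolding energy_def by (intro sum_nonneg) auto
qed

lemma energy_definite:
  assumes e: "e \<in> dofs" and z: "energy e e = 0"
  shows "e = (\<lambda>t. 0)"
proof -
  have nn: "0 \<le> area i * (slope_x e s i * slope_x e s i + slope_y e s i * slope_y e s i)" for s i
    using area_pos[of i] by (intro mult_nonneg_nonneg add_nonneg_nonneg zero_le_square) auto
  have "(\<Sum>i\<le>2*n. area i * (slope_x e s i * slope_x e s i + slope_y e s i * slope_y e s i)) = 0" if "s < 2 * m" for s
    using z that nn unfolding energy_def by (subst (asm) sum_nonneg_eq_0_iff) (auto intro!: sum_nonneg)
  then have ar0: "area i * (slope_x e s i * slope_x e s i + slope_y e s i * slope_y e s i) = 0" if "s < 2 * m" "i \<le> 2 * n" for s i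
    using that nn by (subst (asm) sum_nonneg_eq_0_iff) auto
  have bd0: "slope_x e s i = 0" "slope_y e s i = 0" if "s < 2 * m" "i \<le> 2 * n" for s i
  proof -
    have "slope_x e s i * slope_x e s i + slope_y e s i * slope_y e s i = 0"
      using ar0[OF that] area_pos[of i] by (metis mult_eq_0_iff order_less_irrefl)
    then show "slope_x e s i = 0" "slope_y e s i = 0" by (simp_all add: sum_squares_eq_zero_iff)
  qed
  have end_factor: "end_factor i \<ge> 1" for i by (simp add: end_factor_cases)
  have w: "e (2 * s + 1, j) = 0" if s: "s < 2 * m" and "j \<le> 2 * n" for s j
    using that(2)
  proof (induction j)
    case 0
    show ?case using dofs_boundary(1)[OF e, of s] by (simp add: val_left_def)
  next
    case (Suc j)
    then have "slope_x e s j = 0" "e (2 * s + 1, j) = 0" using bd0 s by auto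
    then show ?case using end_factor[of j] h_pos by (auto simp: slope_x_def val_left_def val_right_def)
  qed
  have "e (\<rho>, j) = 0" for \<rho> j
  proof (cases "(\<rho>, j) \<in> edges")
    case False
    then show ?thesis using e unfolding dofs_def mem_Collect_eq by blast
  next
    case True
    show ?thesis
    proof (cases "odd \<rho>")
      case True
      then obtain s where "\<rho> = 2 * s + 1" by (auto elim: oddE)
      then show ?thesis using w[of s j] \<open>(\<rho>, j) \<in> edges\<close> by (auto simp: edges_def)
    next
      case False
      then obtain r where r: "\<rho> = 2 * r" by (auto elim: evenE)
      then have rj: "r < 2 * m" "j \<le> 2 * n" "odd (r + j)" using \<open>(\<rho>, j) \<in> edges\<close> by (auto simp: edges_def)
      have b: "base_row r j = r" using rj by (simp add: base_row_def)
      have l: "val_left e r j = 0" using w[OF rj(1,2)] by (simp add: val_left_def)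
      have "val_right e r j = 0"
        using w[OF rj(1), of "j + 1"] rj(2) dofs_boundary(2)[OF e, of r]
        by (cases "j = 2 * n") (auto simp: val_right_def)
      then have "val_base e r j = 0" using bd0(2)[OF rj(1,2)] l tau_cases[of r j] k_pos by (auto simp: slope_y_def)
      then show ?thesis by (simp add: val_base_def b r)
    qed
  qed
  then show ?thesis by auto
qed

lemma dofs_add: "e \<in> dofs \<Longrightarrow> e' \<in> dofs \<Longrightarrow> (\<lambda>t. e t + c * e' t) \<in> dofs"
  unfolding dofs_def mem_Collect_eq by auto

lemma galerkin_coefficients:
  obtains e0 where "e0 \<in> dofs" "\<And>e. e \<in> dofs \<Longrightarrow> energy e0 e = load e"
    "galerkin_error n m = sqrt (error_sq e0)"
proof -
  obtain e0 where e0: "e0 \<in> dofs" "\<And>e. e \<in> dofs \<Longrightarrow> energy e0 e = load e"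
    using riesz_finite_support[of edges energy load] finite_edges energy_sym energy_linear load_linear energy_definite
    unfolding dofs_def mem_Collect_eq by blast
  have "galerkin_solution n m f_rhs = nc_fun e0"
    unfolding galerkin_solution_def nonconforming_P1_eq
  proof (rule the_equality)
    show "nc_fun e0 \<in> nc_fun ` dofs \<and> (\<forall>v\<in>nc_fun ` dofs. broken_form n m (nc_fun e0) v =
        (LINT z:unit_square|lebesgue. f_rhs z * v z))"
      using e0 by (auto simp: broken_form_nc_fun load_nc_fun)
  next
    fix u assume "u \<in> nc_fun ` dofs \<and> (\<forall>v\<in>nc_fun ` dofs. broken_form n m u v =
        (LINT z:unit_square|lebesgue. f_rhs z * v z))"
    then obtain e1 where e1: "e1 \<in> dofs" "u = nc_fun e1" "\<And>e. e \<in> dofs \<Longrightarrow> energy e1 e = load e"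
      by (auto simp: broken_form_nc_fun load_nc_fun)
    define d where "d = (\<lambda>t. e1 t + (-1) * e0 t)"
    have d: "d \<in> dofs" unfolding d_def by (rule dofs_add[OF e1(1) e0(1)])
    have "energy d d = energy e1 d + (-1) * energy e0 d" by (subst (1) d_def) (rule energy_linear)
    then have "energy d d = 0" using e0(2)[OF d] e1(3)[OF d] by simp
    then have d0: "d = (\<lambda>t. 0)" using energy_definite d by blast
    have "e1 t = e0 t" for t using fun_cong[OF d0, of t] by (simp add: d_def)
    then have "e1 = e0" by auto
    then show "u = nc_fun e0" using e1 by simp
  qed
  then have "galerkin_error n m = sqrt (error_sq e0)"
    by (simp add: galerkin_error_def broken_seminorm_def broken_form_error)
  with e0 that show thesis by blast
qed

lemma error_sq_shift: "error_sq (\<lambda>t. e t + c * e' t) = error_sq e - 2 * c * (u_pairing e' - energy e e') + c^2 * energy e' e'"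
  by (simp add: error_sq_def u_pairing_linear energy_linear energy_linear_right energy_sym[of e' e] power2_eq_square algebra_simps)

text \<open>
Moving from the Galerkin solution in the direction of \<open>e\<close> cannot make the squared distance negative;
this is evaluated at the step that minimises it.
\<close>

lemma error_lower_bound:
  assumes e: "e \<in> dofs" and pos: "energy e e > 0"
  shows "(consistency e)^2 \<le> (galerkin_error n m)^2 * energy e e"
proof -
  obtain e0 where e0: "e0 \<in> dofs" "\<And>e. e \<in> dofs \<Longrightarrow> energy e0 e = load e"
    "galerkin_error n m = sqrt (error_sq e0)" by (rule galerkin_coefficients) blast
  have sq: "(galerkin_error n m)^2 = error_sq e0" using e0(3) error_sq_nonneg by simp
  define c where "c = consistency e / energy e e"
  have "0 \<le> error_sq (\<lambda>t. e0 t + c * e t)" by (rule error_sq_nonneg)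
  also have "\<dots> = error_sq e0 - 2 * c * consistency e + c^2 * energy e e" by (simp add: error_sq_shift e0(2)[OF e] consistency_def)
  also have "\<dots> = error_sq e0 - (consistency e)^2 / energy e e"
    using pos by (simp add: c_def power2_eq_square field_simps)
  finally show ?thesis using pos sq by (simp add: field_simps)
qed

text \<open>
With \<open>v = I - u\<^sub>h\<close>, the squared distance of \<open>u\<close> from \<open>I\<close> is \<open>E^2 - 2 * L v + \<bar>v\<bar>^2\<close>, and
\<open>2 * L v - \<bar>v\<bar>^2 \<le> 2 * K * \<bar>v\<bar> - \<bar>v\<bar>^2 \<le> K^2\<close>.
\<close>

lemma error_upper_bound:
  assumes I: "I \<in> dofs" and K: "\<And>e. e \<in> dofs \<Longrightarrow> \<bar>consistency e\<bar> \<le> K * sqrt (energy e e)"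
  shows "(galerkin_error n m)^2 \<le> error_sq I + K^2"
proof -
  obtain e0 where e0: "e0 \<in> dofs" "\<And>e. e \<in> dofs \<Longrightarrow> energy e0 e = load e"
    "galerkin_error n m = sqrt (error_sq e0)" by (rule galerkin_coefficients) blast
  have sq: "(galerkin_error n m)^2 = error_sq e0" using e0(3) error_sq_nonneg by simp
  define v where "v = (\<lambda>t. I t + (-1) * e0 t)"
  have v: "v \<in> dofs" unfolding v_def by (rule dofs_add[OF I e0(1)])
  have Iv: "I = (\<lambda>t. e0 t + 1 * v t)" by (auto simp: v_def)
  have "error_sq I = error_sq e0 - 2 * consistency v + energy v v"
    by (subst Iv, subst error_sq_shift) (simp add: e0(2)[OF v] consistency_def)
  moreover have "consistency v \<le> K * sqrt (energy v v)" using K[OF v] by simp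
  moreover have "0 \<le> (K - sqrt (energy v v))^2" by simp
  then have "2 * (K * sqrt (energy v v)) \<le> K^2 + energy v v"
    using energy_nonneg[of v] by (simp add: power2_diff)
  ultimately show ?thesis using sq by linarith
qed

lemma error_stability:
  assumes C: "\<And>e. e \<in> dofs \<Longrightarrow> \<bar>load e\<bar> \<le> C * sqrt (energy e e)"
  shows "(galerkin_error n m)^2 \<le> 2 * u_energy + 2 * C^2"
proof -
  obtain e0 where e0: "e0 \<in> dofs" "\<And>e. e \<in> dofs \<Longrightarrow> energy e0 e = load e"
    "galerkin_error n m = sqrt (error_sq e0)" by (rule galerkin_coefficients) blast
  have sq: "(galerkin_error n m)^2 = error_sq e0" using e0(3) error_sq_nonneg by simp
  define a where "a = energy e0 e0"
  have a: "a \<ge> 0" by (simp add: a_def energy_nonneg)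
  have z: "u_pairing (\<lambda>t. 0) = 0" "energy (\<lambda>t. 0) (\<lambda>t. 0) = 0" "energy (\<lambda>t. 0) e0 = 0"
    using u_pairing_linear[of "\<lambda>t. 0" 1 "\<lambda>t. 0"] energy_linear[of "\<lambda>t. 0" 1 "\<lambda>t. 0"] by simp_all
  have "0 \<le> error_sq (\<lambda>t. 0 + (-1) * e0 t)" by (rule error_sq_nonneg)
  also have "\<dots> = u_energy + 2 * u_pairing e0 + a"
    by (subst error_sq_shift) (simp add: error_sq_def z a_def)
  finally have 1: "error_sq e0 \<le> 2 * u_energy + 2 * a" by (simp add: error_sq_def a_def)
  have "a \<le> C * sqrt a" using C[OF e0(1)] e0(2)[OF e0(1)] by (simp add: a_def)
  then have "sqrt a * sqrt a \<le> C * sqrt a" using a by simp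
  then have "sqrt a \<le> C \<or> sqrt a = 0" using a by (metis mult_le_cancel_right not_less order.strict_iff_order real_sqrt_ge_zero)
  then have "a \<le> C^2"
  proof
    assume "sqrt a \<le> C"
    then have "(sqrt a)^2 \<le> C^2" using a by (intro power_mono) auto
    then show ?thesis using a by simp
  qed simp
  then show ?thesis using 1 sq by linarith
qed

end

section \<open>The consistency functional, cell by cell\<close>

context anisotropic_mesh begin

lemma cell_int_cubic:
  "cell_int s i (\<lambda>z. c00 + c10 * (fst z - apex_x i) + c01 * (snd z - ymid s)
      + c20 * (fst z - apex_x i)^2 + c11 * ((fst z - apex_x i) * (snd z - ymid s)) + c02 * (snd z - ymid s)^2
      + c30 * (fst z - apex_x i)^3 + c21 * ((fst z - apex_x i)^2 * (snd z - ymid s))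
      + c12 * ((fst z - apex_x i) * (snd z - ymid s)^2) + c03 * (snd z - ymid s)^3) =
    c00 * moment s i 0 0 + c10 * moment s i 1 0 + c01 * moment s i 0 1
      + c20 * moment s i 2 0 + c11 * moment s i 1 1 + c02 * moment s i 0 2
      + c30 * moment s i 3 0 + c21 * moment s i 2 1 + c12 * moment s i 1 2 + c03 * moment s i 0 3"
proof -
  have c: "continuous_on UNIV (\<lambda>z::real\<times>real. C * (fst z - X) ^ p)"
    "continuous_on UNIV (\<lambda>z::real\<times>real. C * (snd z - X) ^ p)"
    "continuous_on UNIV (\<lambda>z::real\<times>real. C * (fst z - X))"
    "continuous_on UNIV (\<lambda>z::real\<times>real. C * (snd z - X))"
    "continuous_on UNIV (\<lambda>z::real\<times>real. C * ((fst z - X) ^ p * (snd z - Y)))"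
    "continuous_on UNIV (\<lambda>z::real\<times>real. C * ((fst z - X) * (snd z - Y) ^ p))"
    "continuous_on UNIV (\<lambda>z::real\<times>real. C * ((fst z - X) * (snd z - Y)))"
    "continuous_on UNIV (\<lambda>z::real\<times>real. C)" for C X Y :: real and p
    by (intro continuous_intros)+
  note c = c continuous_on_add[OF _ c(1)] continuous_on_add[OF _ c(2)] continuous_on_add[OF _ c(3)]
    continuous_on_add[OF _ c(4)] continuous_on_add[OF _ c(5)] continuous_on_add[OF _ c(6)]
    continuous_on_add[OF _ c(7)]
  show ?thesis
    by (simp add: cell_int_add c cell_int_cmult cell_int_const moment_def area_def[symmetric])
qed

definition cell_defect :: "(nat \<times> nat \<Rightarrow> real) \<Rightarrow> nat \<Rightarrow> nat \<Rightarrow> real" where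
  "cell_defect e s i = cell_int s i (\<lambda>z. u_grad z \<bullet> slope e s i) - cell_int s i (\<lambda>z. f_rhs z * local_poly e s i z)"

lemma cell_defect_eq:
  fixes e s i
  defines "b \<equiv> slope_x e s i" and "d \<equiv> slope_y e s i" and "c \<equiv> center_val e s i"
    and "g \<equiv> apex_x i * (1 - apex_x i)" and "g1 \<equiv> 1 - 2 * apex_x i"
    and "q \<equiv> ymid s * (1 - ymid s)" and "q1 \<equiv> 1 - 2 * ymid s"
  shows "cell_defect e s i =
     (b * g1 * q + d * g * q1 - 2 * c * (g + q)) * moment s i 0 0
   + (d * g1 * q1 - 2 * b * q - 2 * c * g1 - 2 * b * (g + q)) * moment s i 1 0
   + (b * g1 * q1 - 2 * d * g - 2 * c * q1 - 2 * d * (g + q)) * moment s i 0 1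
   + (2 * c - d * q1 - 2 * b * g1) * moment s i 2 0
   + (- 4 * b * q1 - 4 * d * g1) * moment s i 1 1
   + (2 * c - b * g1 - 2 * d * q1) * moment s i 0 2
   + (2 * b) * moment s i 3 0 + (4 * d) * moment s i 2 1 + (4 * b) * moment s i 1 2 + (2 * d) * moment s i 0 3"
    (is "_ = ?R")
proof -
  have ct: "continuous_on UNIV (\<lambda>z. u_grad z \<bullet> slope e s i)" "continuous_on UNIV (\<lambda>z. (-1) * (f_rhs z * local_poly e s i z))"
    by (intro continuous_intros continuous_u_grad continuous_f_rhs continuous_local_poly)+
  have "cell_defect e s i = cell_int s i (\<lambda>z. u_grad z \<bullet> slope e s i + (-1) * (f_rhs z * local_poly e s i z))"
    unfolding cell_defect_def cell_int_add[OF ct] cell_int_cmult by simp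
  also have "\<dots> = cell_int s i (\<lambda>z. (b * g1 * q + d * g * q1 - 2 * c * (g + q))
    + (d * g1 * q1 - 2 * b * q - 2 * c * g1 - 2 * b * (g + q)) * (fst z - apex_x i)
    + (b * g1 * q1 - 2 * d * g - 2 * c * q1 - 2 * d * (g + q)) * (snd z - ymid s)
    + (2 * c - d * q1 - 2 * b * g1) * (fst z - apex_x i)^2
    + (- 4 * b * q1 - 4 * d * g1) * ((fst z - apex_x i) * (snd z - ymid s))
    + (2 * c - b * g1 - 2 * d * q1) * (snd z - ymid s)^2
    + (2 * b) * (fst z - apex_x i)^3 + (4 * d) * ((fst z - apex_x i)^2 * (snd z - ymid s))
    + (4 * b) * ((fst z - apex_x i) * (snd z - ymid s)^2) + (2 * d) * (snd z - ymid s)^3)"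
  proof (rule cell_int_cong)
    fix z :: "real \<times> real"
    define \<xi> \<eta> where "\<xi> = fst z - apex_x i" and "\<eta> = snd z - ymid s"
    have z: "fst z = apex_x i + \<xi>" "snd z = ymid s + \<eta>" by (simp_all add: \<xi>_def \<eta>_def)
    have ux: "fst (u_grad z) = (g1 - 2 * \<xi>) * (q + q1 * \<eta> - \<eta>^2)"
      and uy: "snd (u_grad z) = (g + g1 * \<xi> - \<xi>^2) * (q1 - 2 * \<eta>)"
      and f: "f_rhs z = 2 * (g + g1 * \<xi> - \<xi>^2 + q + q1 * \<eta> - \<eta>^2)"
      by (simp_all add: u_grad_def f_rhs_def split_def z g_def g1_def q_def q1_def algebra_simps power2_eq_square)
    have local_poly: "local_poly e s i z = c + b * \<xi> + d * \<eta>" by (simp add: local_poly_def b_def c_def d_def \<xi>_def \<eta>_def)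
    have in1: "u_grad z \<bullet> slope e s i = fst (u_grad z) * b + snd (u_grad z) * d"
      by (simp add: inner_prod_def slope_def b_def d_def)
    show "u_grad z \<bullet> slope e s i + (-1) * (f_rhs z * local_poly e s i z) = (b * g1 * q + d * g * q1 - 2 * c * (g + q))
    + (d * g1 * q1 - 2 * b * q - 2 * c * g1 - 2 * b * (g + q)) * (fst z - apex_x i)
    + (b * g1 * q1 - 2 * d * g - 2 * c * q1 - 2 * d * (g + q)) * (snd z - ymid s)
    + (2 * c - d * q1 - 2 * b * g1) * (fst z - apex_x i)^2
    + (- 4 * b * q1 - 4 * d * g1) * ((fst z - apex_x i) * (snd z - ymid s))
    + (2 * c - b * g1 - 2 * d * q1) * (snd z - ymid s)^2
    + (2 * b) * (fst z - apex_x i)^3 + (4 * d) * ((fst z - apex_x i)^2 * (snd z - ymid s))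
    + (4 * b) * ((fst z - apex_x i) * (snd z - ymid s)^2) + (2 * d) * (snd z - ymid s)^3"
      unfolding in1 ux uy f local_poly \<xi>_def[symmetric] \<eta>_def[symmetric] by algebra
  qed
  also have "\<dots> = ?R" by (rule cell_int_cubic)
  finally show ?thesis .
qed

definition ux :: "real \<Rightarrow> real \<Rightarrow> real" where "ux x y = (1 - 2 * x) * (y * (1 - y))"
definition uy :: "real \<Rightarrow> real \<Rightarrow> real" where "uy x y = x * (1 - x) * (1 - 2 * y)"

text \<open>
The flux of \<open>\<nabla>u\<close> through an edge, by the midpoint rule, times the value of the discrete function at the
midpoint. The normal of a slanted edge is scaled to the length of the edge and points to the right.
\<close>

definition slant_flux :: "(nat \<times> nat \<Rightarrow> real) \<Rightarrow> nat \<Rightarrow> nat \<Rightarrow> real" where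
  "slant_flux e s j = (k * ux (slant_x j) (ymid s) + (-1) ^ (s + j) * (h / 2) * uy (slant_x j) (ymid s)) * e (2 * s + 1, j)"
definition base_flux :: "(nat \<times> nat \<Rightarrow> real) \<Rightarrow> nat \<Rightarrow> nat \<Rightarrow> real" where
  "base_flux e r i = (if odd (r + i) then (lft i + rgt i) * (h / 2) * uy (base_x i) (real r * k) * e (2 * r, i) else 0)"
definition flux :: "(nat \<times> nat \<Rightarrow> real) \<Rightarrow> nat \<Rightarrow> nat \<Rightarrow> real" where
  "flux e s i = (slant_flux e s (Suc i) - slant_flux e s i) + (base_flux e (Suc s) i - base_flux e s i)"
definition residual :: "(nat \<times> nat \<Rightarrow> real) \<Rightarrow> nat \<Rightarrow> nat \<Rightarrow> real" where
  "residual e s i = cell_defect e s i - flux e s i"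

text \<open>
The outflow from one cell is the inflow into its neighbour, so the sum telescopes along the strips
for the slanted edges, and along the columns for the horizontal ones; at the boundary the edge values
are zero.
\<close>

lemma sum_flux:
  assumes e: "e \<in> dofs"
  shows "(\<Sum>s<2*m. \<Sum>i\<le>2*n. flux e s i) = 0"
proof -
  have z: "e (2 * s + 1, 0) = 0" "e (2 * s + 1, 2 * n + 1) = 0" "e (4 * m, i) = 0" "e (0, i) = 0" for s i
    using dofs_boundary[OF e, of s] dofs_boundary(3,4)[OF e, of i] by (simp_all add: val_left_def val_right_def)
  have a: "(\<Sum>i\<le>2*n. slant_flux e s (Suc i) - slant_flux e s i) = 0" for s
    unfolding lessThan_Suc_atMost[symmetric] sum_lessThan_telescope
    using z(1,2)[of s] by (simp add: slant_flux_def)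
  have b: "(\<Sum>s<2*m. base_flux e (Suc s) i - base_flux e s i) = 0" for i
    unfolding sum_lessThan_telescope[of "\<lambda>s. base_flux e s i"] using z(3,4)[of i] by (simp add: base_flux_def)
  have "(\<Sum>s<2*m. \<Sum>i\<le>2*n. flux e s i) = (\<Sum>s<2*m. \<Sum>i\<le>2*n. slant_flux e s (Suc i) - slant_flux e s i)
     + (\<Sum>s<2*m. \<Sum>i\<le>2*n. base_flux e (Suc s) i - base_flux e s i)"
    by (simp add: flux_def sum.distrib)
  also have "(\<Sum>s<2*m. \<Sum>i\<le>2*n. base_flux e (Suc s) i - base_flux e s i) =
     (\<Sum>i\<le>2*n. \<Sum>s<2*m. base_flux e (Suc s) i - base_flux e s i)" by (rule sum.swap)
  finally show ?thesis unfolding a b by simp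
qed

lemma consistency_residual:
  assumes "e \<in> dofs"
  shows "consistency e = (\<Sum>s<2*m. \<Sum>i\<le>2*n. residual e s i)"
  using sum_flux[OF assms] by (simp add: consistency_def u_pairing_def load_def residual_def cell_defect_def sum_subtractf)

lemma base_flux_diff:
  "base_flux e (Suc s) i - base_flux e s i =
    \<tau> s i * (lft i + rgt i) * (h / 2) * uy (base_x i) (ymid s + \<tau> s i * k / 2) * val_base e s i"
proof (cases "even (s + i)")
  case True
  then have "ymid s + \<tau> s i * k / 2 = real (Suc s) * k" by (simp add: \<tau>_def ymid_def field_simps)
  then show ?thesis using True by (simp add: base_flux_def val_base_def base_row_def \<tau>_def)
next
  case False
  then have "ymid s + \<tau> s i * k / 2 = real s * k" by (simp add: \<tau>_def ymid_def field_simps)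
  then show ?thesis using False by (simp add: base_flux_def val_base_def base_row_def \<tau>_def algebra_simps)
qed

lemma slant_flux_right:
  "i \<le> 2 * n \<Longrightarrow> slant_flux e s (Suc i) = (k * ux (apex_x i + rgt i * h / 4) (ymid s)
      - \<tau> s i * (h / 2) * uy (apex_x i + rgt i * h / 4) (ymid s)) * val_right e s i"
  using edge_mid_tri_edges(2)[of i s] by (simp add: slant_flux_def val_right_def edge_mid_def \<tau>_def)

lemma slant_flux_left:
  "i \<le> 2 * n \<Longrightarrow> slant_flux e s i = (k * ux (apex_x i - lft i * h / 4) (ymid s)
      + \<tau> s i * (h / 2) * uy (apex_x i - lft i * h / 4) (ymid s)) * val_left e s i"
  using edge_mid_tri_edges(1)[of i s] by (simp add: slant_flux_def val_left_def edge_mid_def \<tau>_def)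

lemma nodal_values:
  assumes e: "e \<in> dofs" and i: "i \<le> 2 * n"
  shows "val_left e s i = center_val e s i - lft i * slope_x e s i * h / 4"
    "val_right e s i = center_val e s i + rgt i * slope_x e s i * h / 4"
    "val_base e s i = center_val e s i + (rgt i - lft i) * slope_x e s i * h / 4 + \<tau> s i * slope_y e s i * k / 2"
proof -
  consider "i = 0" | "i = 2 * n" "i > 0" | "i \<noteq> 0" "i \<noteq> 2 * n" by blast
  then have "val_left e s i = center_val e s i - lft i * slope_x e s i * h / 4 \<and> val_right e s i = center_val e s i + rgt i * slope_x e s i * h / 4
    \<and> val_base e s i = center_val e s i + (rgt i - lft i) * slope_x e s i * h / 4 + \<tau> s i * slope_y e s i * k / 2"
    using dofs_boundary(1,2)[OF e, of s] h_pos k_pos n_pos tau_cases[of s i]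
    by cases (auto simp: center_val_def slope_x_def slope_y_def end_factor_def lft_def rgt_def field_simps)
  then show "val_left e s i = center_val e s i - lft i * slope_x e s i * h / 4"
    "val_right e s i = center_val e s i + rgt i * slope_x e s i * h / 4"
    "val_base e s i = center_val e s i + (rgt i - lft i) * slope_x e s i * h / 4 + \<tau> s i * slope_y e s i * k / 2" by auto
qed

lemma flux_eq:
  assumes e: "e \<in> dofs" and i: "i \<le> 2 * n"
  shows "flux e s i =
    (k * ux (apex_x i + rgt i * h / 4) (ymid s) - \<tau> s i * (h / 2) * uy (apex_x i + rgt i * h / 4) (ymid s))
       * (center_val e s i + rgt i * slope_x e s i * h / 4)
  - (k * ux (apex_x i - lft i * h / 4) (ymid s) + \<tau> s i * (h / 2) * uy (apex_x i - lft i * h / 4) (ymid s))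
       * (center_val e s i - lft i * slope_x e s i * h / 4)
  + \<tau> s i * (lft i + rgt i) * (h / 2) * uy (apex_x i + (rgt i - lft i) * h / 4) (ymid s + \<tau> s i * k / 2)
       * (center_val e s i + (rgt i - lft i) * slope_x e s i * h / 4 + \<tau> s i * slope_y e s i * k / 2)"
  unfolding flux_def base_flux_diff slant_flux_right[OF i] slant_flux_left[OF i] nodal_values[OF e i] base_x_def
  by (simp add: algebra_simps)

text \<open>
If \<open>k\<close> is small compared with \<open>h\<close>, the leading term is \<open>b * g1 * t * q1 * h^3 / 16\<close>, where \<open>g1 * q1\<close> is the mixed derivative of \<open>u\<close> at the
centre. It changes sign with the orientation \<open>t\<close> of the cell, which is what an oscillating \<open>b\<close> detects.
\<close>

lemma residual_interior:
  fixes e s i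
  defines "b \<equiv> slope_x e s i" and "d \<equiv> slope_y e s i" and "c \<equiv> center_val e s i"
    and "g \<equiv> apex_x i * (1 - apex_x i)" and "g1 \<equiv> 1 - 2 * apex_x i"
    and "q \<equiv> ymid s * (1 - ymid s)" and "q1 \<equiv> 1 - 2 * ymid s" and "t \<equiv> \<tau> s i"
  assumes e: "e \<in> dofs" and i: "0 < i" "i < 2 * n"
  shows "residual e s i = b * g1 * (t * q1 * (h * k^2 / 12 + h^3 / 16) - h * k^3 / 24 - h^3 * k / 24)
    + d * (t * (h * k^2 / 6) * (g - q) - q1 * (h^3 * k / 48 + h * k^3 / 12) + t * (h^3 * k^2 / 40 + h * k^4 / 40))
    + c * (h^3 * k / 24 + h * k^3 / 12 - t * q1 * (h * k^2 / 6 + h^3 / 16))"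
proof -
  have lr: "lft i = 1" "rgt i = 1" using i by (simp_all add: lft_def rgt_def)
  have t: "t = 1 \<or> t = -1" unfolding t_def by (rule tau_cases)
  have i': "i \<le> 2 * n" using i by simp
  show ?thesis
    unfolding residual_def cell_defect_eq flux_eq[OF e i'] moment_values lr ux_def uy_def
      b_def[symmetric] c_def[symmetric] d_def[symmetric] t_def[symmetric] g_def g1_def q_def q1_def
    using t by (elim disjE) (simp_all add: field_simps power2_eq_square power3_eq_cube power4_eq_xxxx)
qed

text \<open>
The coefficients of the two slopes in the residual of a half triangle at a vertical side of the square.
\<close>

definition half_residual_x :: "real \<Rightarrow> real \<Rightarrow> real \<Rightarrow> real" where
  "half_residual_x t q q1 = t * q1 * (h * k^2 / 24 - h^2 * k^2 / 24) - q * h^2 * k / 24 - h^3 * k / 48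
     - h * k^3 / 48 + h^4 * k / 160 + h^2 * k^3 / 60 + h^2 * k * (h / 4 * (1 - h / 4)) / 8"
definition half_residual_y :: "real \<Rightarrow> real \<Rightarrow> real \<Rightarrow> real" where
  "half_residual_y t q q1 = q1 * (h^2 * k / 24 - h^3 * k / 96 - h * k^3 / 24) - t * q * h * k^2 / 12
     - t * h^2 * k^2 / 24 + t * h^3 * k^2 / 80 + t * h * k^4 / 80
     - h * k / 4 * (h / 4 * (1 - h / 4)) * (q1 - t * k)"

lemma residual_left:
  fixes e s
  defines "b \<equiv> slope_x e s 0" and "d \<equiv> slope_y e s 0"
    and "q \<equiv> ymid s * (1 - ymid s)" and "q1 \<equiv> 1 - 2 * ymid s" and "t \<equiv> \<tau> s 0"
  assumes e: "e \<in> dofs"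
  shows "residual e s 0 = b * half_residual_x t q q1 + d * half_residual_y t q q1"
proof -
  have lr: "lft 0 = 0" "rgt 0 = 1" using n_pos by (simp_all add: lft_def rgt_def)
  have x: "apex_x 0 = 0" by (simp add: apex_x_def)
  have c: "center_val e s 0 = 0" by (simp add: center_val_def lr)
  have t: "t = 1 \<or> t = -1" unfolding t_def by (rule tau_cases)
  have i': "0 \<le> 2 * n" by simp
  show ?thesis
    unfolding residual_def cell_defect_eq flux_eq[OF e i'] moment_values lr ux_def uy_def x c
      b_def[symmetric] d_def[symmetric] t_def[symmetric] q_def q1_def half_residual_x_def half_residual_y_def
    using t by (elim disjE) (simp_all add: field_simps power2_eq_square power3_eq_cube power4_eq_xxxx)
qed

text \<open>
The reflection at \<open>x = 1 / 2\<close> maps the last cell of a strip to the first, reverses the horizontal slope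
and keeps \<open>u\<close>, the orientation and the vertical slope.
\<close>

lemma residual_right:
  fixes e s
  defines "b \<equiv> - slope_x e s (2 * n)" and "d \<equiv> slope_y e s (2 * n)"
    and "q \<equiv> ymid s * (1 - ymid s)" and "q1 \<equiv> 1 - 2 * ymid s" and "t \<equiv> \<tau> s (2 * n)"
  assumes e: "e \<in> dofs"
  shows "residual e s (2 * n) = b * half_residual_x t q q1 + d * half_residual_y t q q1"
proof -
  have lr: "lft (2 * n) = 1" "rgt (2 * n) = 0" using n_pos by (simp_all add: lft_def rgt_def)
  have c: "center_val e s (2 * n) = 0" by (simp add: center_val_def lr)
  have t: "t = 1 \<or> t = -1" unfolding t_def by (rule tau_cases)
  have b': "slope_x e s (2 * n) = - b" by (simp add: b_def)
  have i': "2 * n \<le> 2 * n" by simp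
  show ?thesis
    unfolding residual_def cell_defect_eq flux_eq[OF e i'] moment_values lr ux_def uy_def apex_x_last c b'
      d_def[symmetric] t_def[symmetric] q_def q1_def half_residual_x_def half_residual_y_def
    using t by (elim disjE) (simp_all add: field_simps power2_eq_square power3_eq_cube power4_eq_xxxx)
qed

end

section \<open>The upper bound\<close>

lemma abs_mult_le_bound:
  fixes x y :: real
  assumes "\<bar>x\<bar> \<le> 1" "\<bar>y\<bar> \<le> B"
  shows "\<bar>x * y\<bar> \<le> B"
  using mult_mono[OF assms] assms by (simp add: abs_mult)

lemma parabola_bounds:
  fixes x :: real
  assumes "0 \<le> x" "x \<le> 1"
  shows "0 \<le> x * (1 - x)" "x * (1 - x) \<le> 1 / 4" "\<bar>1 - 2 * x\<bar> \<le> 1"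
proof -
  show "0 \<le> x * (1 - x)" using assms by simp
  have "0 \<le> (x - 1 / 2)^2" by simp
  then show "x * (1 - x) \<le> 1 / 4" by (simp add: power2_eq_square algebra_simps)
  show "\<bar>1 - 2 * x\<bar> \<le> 1" using assms by (simp add: abs_if)
qed

lemma parabola_lipschitz:
  fixes x y :: real
  assumes "0 \<le> x" "x \<le> 1" "0 \<le> y" "y \<le> 1"
  shows "\<bar>x * (1 - x) - y * (1 - y)\<bar> \<le> \<bar>x - y\<bar>"
proof -
  have "x * (1 - x) - y * (1 - y) = (1 - x - y) * (x - y)" by (simp add: algebra_simps)
  moreover have "\<bar>1 - x - y\<bar> \<le> 1" using assms by (simp add: abs_if)
  ultimately show ?thesis using abs_mult_le_bound[of "1 - x - y" "x - y" "\<bar>x - y\<bar>"] by simp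
qed

context anisotropic_mesh begin

text \<open>
As \<open>k \<le> h / 2 \<le> 1 / 2\<close>, no monomial in the residuals exceeds the order \<open>h^3\<close>.
\<close>

lemma monomial_bounds:
  "h * k^2 \<le> h^3 / 4" "h * k^3 \<le> h^3 / 8" "h^3 * k \<le> h^3 / 2" "h^3 * k^2 \<le> h^3 / 4" "h * k^4 \<le> h^3 / 16"
  "h^2 * k \<le> h^3 / 2" "h^4 * k \<le> h^3 / 2" "h^2 * k^3 \<le> h^3 / 8" "h^2 * k^2 \<le> h^3 / 4"
  "0 \<le> h * k^2" "0 \<le> h * k^3" "0 \<le> h^3 * k" "0 \<le> h^3 * k^2" "0 \<le> h * k^4"
  "0 \<le> h^2 * k" "0 \<le> h^4 * k" "0 \<le> h^2 * k^3" "0 \<le> h^2 * k^2"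
proof -
  have h: "0 \<le> h" "h \<le> 1" and k: "0 \<le> k" "k \<le> h / 2" using h_pos h_le_1 k_pos k_le by auto
  have kp: "k ^ p \<le> (h / 2) ^ p" for p using k by (intro power_mono)
  have hp: "h ^ (3 + p) \<le> h ^ 3" for p using power_decreasing[of 3 "3 + p" h] h by simp
  have b: "h ^ a * k ^ p \<le> h ^ 3 / 2 ^ p" if "a + p \<ge> 3" for a p
  proof -
    have "h ^ a * k ^ p \<le> h ^ a * (h / 2) ^ p" using kp h by (intro mult_left_mono) auto
    also have "\<dots> = h ^ (a + p) / 2 ^ p" by (simp add: power_add power_divide)
    also have "\<dots> \<le> h ^ 3 / 2 ^ p" using hp[of "a + p - 3"] that by (intro divide_right_mono) simp_all
    finally show ?thesis .
  qed
  show "h * k^2 \<le> h^3 / 4" "h * k^3 \<le> h^3 / 8" "h^3 * k \<le> h^3 / 2" "h^3 * k^2 \<le> h^3 / 4" "h * k^4 \<le> h^3 / 16"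
    "h^2 * k \<le> h^3 / 2" "h^4 * k \<le> h^3 / 2" "h^2 * k^3 \<le> h^3 / 8" "h^2 * k^2 \<le> h^3 / 4"
    using b[of 1 2] b[of 1 3] b[of 3 1] b[of 3 2] b[of 1 4] b[of 2 1] b[of 4 1] b[of 2 3] b[of 2 2] by simp_all
  show "0 \<le> h * k^2" "0 \<le> h * k^3" "0 \<le> h^3 * k" "0 \<le> h^3 * k^2" "0 \<le> h * k^4"
    "0 \<le> h^2 * k" "0 \<le> h^4 * k" "0 \<le> h^2 * k^3" "0 \<le> h^2 * k^2" using h k by simp_all
qed

lemma ymid_range: "s < 2 * m \<Longrightarrow> 0 \<le> ymid s \<and> ymid s \<le> 1"
  using row_range[of s] k_pos by auto

lemma half_residual_bounds:
  assumes t: "t = 1 \<or> t = -1" and q: "0 \<le> q" "q \<le> 1 / 4" and q1: "\<bar>q1\<bar> \<le> 1"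
  shows "\<bar>half_residual_x t q q1\<bar> \<le> h^3" "\<bar>half_residual_y t q q1\<bar> \<le> h^3"
proof -
  note M = monomial_bounds
  have tq: "\<bar>t * q1\<bar> \<le> 1" "\<bar>t\<bar> \<le> 1" using t q1 by auto
  have g4: "0 \<le> h / 4 * (1 - h / 4)" "h / 4 * (1 - h / 4) \<le> 1"
    using parabola_bounds(1,2)[of "h / 4"] h_pos h_le_1 by auto
  have "\<bar>t * q1 * (h * k^2 / 24 - h^2 * k^2 / 24)\<bar> \<le> h^3 / 48"
    using tq(1) by (rule abs_mult_le_bound) (use M in \<open>-, (intro abs_leI; linarith)\<close>)
  moreover have "\<bar>q * (h^2 * k)\<bar> \<le> h^3 / 2"
    by (rule abs_mult_le_bound) (use q M in auto)
  moreover have "\<bar>h / 4 * (1 - h / 4) * (h^2 * k)\<bar> \<le> h^3 / 2"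
    by (rule abs_mult_le_bound) (use g4 M in auto)
  moreover have "half_residual_x t q q1 = t * q1 * (h * k^2 / 24 - h^2 * k^2 / 24) - q * (h^2 * k) / 24 - h^3 * k / 48 - h * k^3 / 48
      + h^4 * k / 160 + h^2 * k^3 / 60 + h / 4 * (1 - h / 4) * (h^2 * k) / 8"
    by (simp only: half_residual_x_def mult_ac)
  ultimately show "\<bar>half_residual_x t q q1\<bar> \<le> h^3"
    using M by (simp only:)
  have y1: "\<bar>q1 * (h^2 * k / 24 - h^3 * k / 96 - h * k^3 / 24)\<bar> \<le> h^3 / 24"
    using q1 by (rule abs_mult_le_bound) (use M in \<open>-, (intro abs_leI; linarith)\<close>)
  have y2: "\<bar>t * q * (h * k^2)\<bar> \<le> h^3 / 4"
    by (rule abs_mult_le_bound) (use t q M in auto)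
  have y3: "\<bar>t * (h^2 * k^2)\<bar> \<le> h^3 / 4" "\<bar>t * (h^3 * k^2)\<bar> \<le> h^3 / 4" "\<bar>t * (h * k^4)\<bar> \<le> h^3 / 16"
    using abs_mult_le_bound[OF tq(2), of "h^2 * k^2" "h^3 / 4"] abs_mult_le_bound[OF tq(2), of "h^3 * k^2" "h^3 / 4"]
      abs_mult_le_bound[OF tq(2), of "h * k^4" "h^3 / 16"] M by simp_all
  have y4: "\<bar>(1 - h / 4) * (q1 - t * k) * (h^2 * k)\<bar> \<le> h^3"
  proof -
    have "\<bar>(q1 - t * k) / 2\<bar> \<le> 1" using t q1 k_pos k_le h_le_1 by (auto simp: abs_le_iff)
    then have "\<bar>(1 - h / 4) * ((q1 - t * k) / 2)\<bar> \<le> 1"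
      using h_pos h_le_1 abs_mult_le_bound[of "1 - h / 4" "(q1 - t * k) / 2" 1] by auto
    then have "\<bar>(1 - h / 4) * ((q1 - t * k) / 2) * (h^2 * k)\<bar> \<le> h^3 / 2"
      by (rule abs_mult_le_bound) (use M in auto)
    then show ?thesis by (simp add: abs_mult)
  qed
  have y5: "h * k / 4 * (h / 4 * (1 - h / 4)) * (q1 - t * k) = (1 - h / 4) * (q1 - t * k) * (h^2 * k) / 16"
    by (simp add: power2_eq_square)
  have y6: "half_residual_y t q q1 = q1 * (h^2 * k / 24 - h^3 * k / 96 - h * k^3 / 24) - t * q * (h * k^2) / 12 - t * (h^2 * k^2) / 24
      + t * (h^3 * k^2) / 80 + t * (h * k^4) / 80 - h * k / 4 * (h / 4 * (1 - h / 4)) * (q1 - t * k)"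
    by (simp only: half_residual_y_def mult_ac)
  note y = y1 y2 y3 y4
  show "\<bar>half_residual_y t q q1\<bar> \<le> h^3"
    unfolding y6 y5 using y[THEN abs_le_D1] y[THEN abs_le_D2] zero_le_power[of h 3] h_pos
    by - (rule abs_leI; linarith)
qed

text \<open>
The area of a cell is only of order \<open>h * k\<close>. The quotient \<open>h^2 / k\<close> of this bound and the area is the
order of the consistency error.
\<close>

lemma residual_bound:
  assumes e: "e \<in> dofs" and si: "(s, i) \<in> idx"
  shows "\<bar>residual e s i\<bar> \<le> h^3 * (\<bar>slope_x e s i\<bar> + \<bar>slope_y e s i\<bar> + \<bar>center_val e s i\<bar>)"
proof -
  note M = monomial_bounds
  have s: "s < 2 * m" and i: "i \<le> 2 * n" using si by (simp_all add: idx_iff)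
  define q q1 g g1 where "q = ymid s * (1 - ymid s)" and "q1 = 1 - 2 * ymid s"
    and "g = apex_x i * (1 - apex_x i)" and "g1 = 1 - 2 * apex_x i"
  have q: "0 \<le> q" "q \<le> 1 / 4" "\<bar>q1\<bar> \<le> 1" and g: "0 \<le> g" "g \<le> 1 / 4" "\<bar>g1\<bar> \<le> 1"
    using parabola_bounds[of "ymid s"] parabola_bounds[of "apex_x i"] ymid_range[OF s] apex_x_range[OF i]
    by (simp_all add: q_def q1_def g_def g1_def)
  have t: "\<tau> s i = 1 \<or> \<tau> s i = -1" by (rule tau_cases)
  have combine: "\<bar>slope_x e s i * X + slope_y e s i * Y + center_val e s i * Z\<bar> \<le> h^3 * (\<bar>slope_x e s i\<bar> + \<bar>slope_y e s i\<bar> + \<bar>center_val e s i\<bar>)"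
    if "\<bar>X\<bar> \<le> h^3" "\<bar>Y\<bar> \<le> h^3" "\<bar>Z\<bar> \<le> h^3" for X Y Z
  proof -
    have "\<bar>slope_x e s i * X\<bar> \<le> \<bar>slope_x e s i\<bar> * h^3" "\<bar>slope_y e s i * Y\<bar> \<le> \<bar>slope_y e s i\<bar> * h^3"
       "\<bar>center_val e s i * Z\<bar> \<le> \<bar>center_val e s i\<bar> * h^3"
      unfolding abs_mult using that by (intro mult_left_mono; simp)+
    then show ?thesis by (simp add: algebra_simps) linarith
  qed
  consider "i = 0" | "i = 2 * n" | "0 < i" "i < 2 * n" using i by linarith
  then show ?thesis
  proof cases
    case 1
    then show ?thesis
      using combine[of "half_residual_x (\<tau> s 0) q q1" "half_residual_y (\<tau> s 0) q q1" 0]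
        half_residual_bounds[OF _ q, of "\<tau> s 0"] t h_pos
      by (simp add: residual_left[OF e] q_def q1_def)
  next
    case 2
    then have "residual e s i = slope_x e s i * - half_residual_x (\<tau> s i) q q1 + slope_y e s i * half_residual_y (\<tau> s i) q q1"
      by (simp add: residual_right[OF e] q_def q1_def)
    then show ?thesis
      using combine[of "- half_residual_x (\<tau> s i) q q1" "half_residual_y (\<tau> s i) q q1" 0]
        half_residual_bounds[OF t q] h_pos by simp
  next
    case 3
    let ?t = "\<tau> s i"
    define X where "X = g1 * (?t * q1 * (h * k^2 / 12 + h^3 / 16) - h * k^3 / 24 - h^3 * k / 24)"
    define Y where "Y = ?t * (h * k^2 / 6) * (g - q) - q1 * (h^3 * k / 48 + h * k^3 / 12) + ?t * (h^3 * k^2 / 40 + h * k^4 / 40)"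
    define Z where "Z = h^3 * k / 24 + h * k^3 / 12 - ?t * q1 * (h * k^2 / 6 + h^3 / 16)"
    have tq: "\<bar>?t * q1\<bar> \<le> 1" "\<bar>?t\<bar> \<le> 1" "\<bar>?t * (g - q)\<bar> \<le> 1" using t q g by auto
    have p: "\<bar>?t * q1 * (h * k^2 / 12 + h^3 / 16)\<bar> \<le> h^3 / 8"
      using tq(1) by (rule abs_mult_le_bound) (use M h_pos zero_le_power[of h 3] in \<open>-, (intro abs_leI; linarith)\<close>)
    have X: "\<bar>X\<bar> \<le> h^3" unfolding X_def using g(3)
      by (rule abs_mult_le_bound) (use p M in \<open>-, (intro abs_leI; linarith)\<close>)
    have "\<bar>?t * q1 * (h * k^2 / 6 + h^3 / 16)\<bar> \<le> h^3 / 4"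
      using tq(1) by (rule abs_mult_le_bound) (use M h_pos zero_le_power[of h 3] in \<open>-, (intro abs_leI; linarith)\<close>)
    then have Z: "\<bar>Z\<bar> \<le> h^3" unfolding Z_def using M by - (intro abs_leI; linarith)
    have "\<bar>?t * (g - q) * (h * k^2 / 6)\<bar> \<le> h^3 / 24"
      using tq(3) by (rule abs_mult_le_bound) (use M h_pos zero_le_power[of h 3] in \<open>-, (intro abs_leI; linarith)\<close>)
    moreover have "\<bar>q1 * (h^3 * k / 48 + h * k^3 / 12)\<bar> \<le> h^3 / 8"
      using q(3) by (rule abs_mult_le_bound) (use M h_pos zero_le_power[of h 3] in \<open>-, (intro abs_leI; linarith)\<close>)
    moreover have "\<bar>?t * (h^3 * k^2 / 40 + h * k^4 / 40)\<bar> \<le> h^3 / 8"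
      using tq(2) by (rule abs_mult_le_bound) (use M h_pos zero_le_power[of h 3] in \<open>-, (intro abs_leI; linarith)\<close>)
    moreover have "?t * (h * k^2 / 6) * (g - q) = ?t * (g - q) * (h * k^2 / 6)" by simp
    ultimately have Y: "\<bar>Y\<bar> \<le> h^3" unfolding Y_def using h_pos zero_le_power[of h 3]
      by - (intro abs_leI; linarith)
    have "residual e s i = slope_x e s i * X + slope_y e s i * Y + center_val e s i * Z"
      unfolding residual_interior[OF e 3] X_def Y_def Z_def q_def q1_def g_def g1_def by (simp add: mult.assoc)
    then show ?thesis using combine[OF X Y Z] by simp
  qed
qed

text \<open>
Along a midline the function is continuous, starts at zero and has increments of at most
\<open>h / 2 * \<bar>slope_x\<bar>\<close>.
\<close>

lemma center_val_bound:
  assumes e: "e \<in> dofs" and i: "i \<le> 2 * n"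
  shows "\<bar>center_val e s i\<bar> \<le> h / 2 * (\<Sum>l\<le>2*n. \<bar>slope_x e s l\<bar>)"
proof -
  define W where "W = h / 2 * (\<Sum>l\<le>2*n. \<bar>slope_x e s l\<bar>)"
  have step: "\<bar>e (2 * s + 1, Suc l) - e (2 * s + 1, l)\<bar> \<le> h / 2 * \<bar>slope_x e s l\<bar>" for l
  proof -
    have "h / 2 * \<bar>slope_x e s l\<bar> = end_factor l * \<bar>val_right e s l - val_left e s l\<bar>"
      using h_pos by (simp add: slope_x_def abs_mult end_factor_cases)
    moreover have "1 * \<bar>val_right e s l - val_left e s l\<bar> \<le> end_factor l * \<bar>val_right e s l - val_left e s l\<bar>"
      by (rule mult_right_mono) (simp_all add: end_factor_cases)
    ultimately show ?thesis by (simp add: val_left_def val_right_def)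
  qed
  have part: "\<bar>e (2 * s + 1, j)\<bar> \<le> h / 2 * (\<Sum>l<j. \<bar>slope_x e s l\<bar>)" for j
  proof (induction j)
    case 0
    show ?case using dofs_boundary(1)[OF e, of s] by (simp add: val_left_def)
  next
    case (Suc j)
    have "\<bar>e (2 * s + 1, Suc j)\<bar> \<le> h / 2 * (\<Sum>l<j. \<bar>slope_x e s l\<bar>) + h / 2 * \<bar>slope_x e s j\<bar>"
      using Suc.IH step[of j] by linarith
    then show ?case by (simp only: sum.lessThan_Suc distrib_left)
  qed
  have "\<bar>e (2 * s + 1, j)\<bar> \<le> W" if "j \<le> 2 * n + 1" for j
  proof -
    have "(\<Sum>l<j. \<bar>slope_x e s l\<bar>) \<le> (\<Sum>l\<le>2*n. \<bar>slope_x e s l\<bar>)"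
      by (rule sum_mono2) (use that in auto)
    then have "h / 2 * (\<Sum>l<j. \<bar>slope_x e s l\<bar>) \<le> W" unfolding W_def using h_pos by (intro mult_left_mono) auto
    then show ?thesis using part[of j] by linarith
  qed
  then have "\<bar>val_left e s i\<bar> \<le> W" "\<bar>val_right e s i\<bar> \<le> W" using i by (simp_all add: val_left_def val_right_def)
  then have 1: "\<bar>(val_left e s i + val_right e s i) / 2\<bar> \<le> W"
    using abs_triangle_ineq[of "val_left e s i" "val_right e s i"] by simp
  have "\<bar>lft i * rgt i * ((val_left e s i + val_right e s i) / 2)\<bar> \<le> W"
    using _ 1 by (rule abs_mult_le_bound) (auto simp: lft_def rgt_def)
  then show ?thesis by (simp add: center_val_def W_def mult.assoc)
qed

lemma square_sum_le:
  fixes f :: "'a \<Rightarrow> real"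
  shows "(\<Sum>x\<in>A. f x)^2 \<le> real (card A) * (\<Sum>x\<in>A. (f x)^2)"
  using Cauchy_Schwarz_ineq_sum[of "\<lambda>x. 1" f A] by simp

lemma h_count: "h * (2 * real n + 1) \<le> 3"
  using nh h_le_1 by (simp add: algebra_simps)

lemma poincare:
  assumes e: "e \<in> dofs"
  shows "(\<Sum>i\<le>2*n. (center_val e s i)^2) \<le> 9 / 4 * (\<Sum>i\<le>2*n. (slope_x e s i)^2)"
proof -
  define S where "S = (\<Sum>i\<le>2*n. (slope_x e s i)^2)"
  define N where "N = 2 * real n + 1"
  have S: "S \<ge> 0" by (simp add: S_def sum_nonneg)
  have "(\<Sum>l\<le>2*n. \<bar>slope_x e s l\<bar>)^2 \<le> N * S"
    using square_sum_le[of "\<lambda>l. \<bar>slope_x e s l\<bar>" "{..2*n}"] by (simp add: S_def N_def algebra_simps)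
  then have b: "(h / 2)^2 * (\<Sum>l\<le>2*n. \<bar>slope_x e s l\<bar>)^2 \<le> (h / 2)^2 * (N * S)"
    by (intro mult_left_mono) auto
  have "(center_val e s i)^2 \<le> (h / 2)^2 * (N * S)" if "i \<le> 2 * n" for i
  proof -
    have "(center_val e s i)^2 \<le> (h / 2 * (\<Sum>l\<le>2*n. \<bar>slope_x e s l\<bar>))^2"
      using center_val_bound[OF e that, of s] by (intro power2_le_iff_abs_le[THEN iffD2]) (auto intro: order_trans[OF abs_ge_zero])
    then show ?thesis using b by (simp only: power_mult_distrib)
  qed
  then have "(\<Sum>i\<le>2*n. (center_val e s i)^2) \<le> (\<Sum>i\<le>2*n. (h / 2)^2 * (N * S))"
    by (intro sum_mono) auto
  also have "\<dots> = (h * N)^2 / 4 * S"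
    by (simp add: N_def power2_eq_square field_simps)
  also have "\<dots> \<le> 3^2 / 4 * S"
    using h_count h_pos S by (intro mult_right_mono divide_right_mono power_mono) (auto simp: N_def)
  finally show ?thesis by (simp add: S_def)
qed

text \<open>
The Cauchy--Schwarz inequality over all cells. There are at most \<open>3 / (h * k)\<close> of them, each of area at
least \<open>h * k / 4\<close>, and the central values are bounded by the horizontal slopes.
\<close>

lemma sum_coeffs_bound:
  assumes e: "e \<in> dofs"
  shows "(\<Sum>s<2*m. \<Sum>i\<le>2*n. \<bar>slope_x e s i\<bar> + \<bar>slope_y e s i\<bar> + \<bar>center_val e s i\<bar>) \<le> 11 / (h * k) * sqrt (energy e e)"
proof -
  let ?x = "\<lambda>s i. \<bar>slope_x e s i\<bar> + \<bar>slope_y e s i\<bar> + \<bar>center_val e s i\<bar>"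
  define T where "T = (\<Sum>s<2*m. \<Sum>i\<le>2*n. ?x s i)"
  define S where "S = (\<Sum>s<2*m. \<Sum>i\<le>2*n. (slope_x e s i)^2 + (slope_y e s i)^2)"
  have hk: "h * k > 0" using h_pos k_pos by simp
  have S0: "S \<ge> 0" unfolding S_def by (intro sum_nonneg) auto
  have "(\<Sum>s<2*m. \<Sum>i\<le>2*n. h * k / 4 * ((slope_x e s i)^2 + (slope_y e s i)^2)) \<le> energy e e"
    unfolding energy_def
  proof (intro sum_mono)
    fix s i
    show "h * k / 4 * ((slope_x e s i)^2 + (slope_y e s i)^2) \<le> area i * (slope_x e s i * slope_x e s i + slope_y e s i * slope_y e s i)"
      unfolding power2_eq_square by (intro mult_right_mono area_bounds add_nonneg_nonneg zero_le_square)
  qed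
  then have aS: "h * k / 4 * S \<le> energy e e" by (simp add: S_def sum_distrib_left)
  have "T^2 = (\<Sum>(s, i)\<in>idx. ?x s i)^2"
    by (simp add: T_def sum.cartesian_product idx_def)
  also have "\<dots> \<le> real (card idx) * (\<Sum>(s, i)\<in>idx. (?x s i)^2)"
    using square_sum_le[of "\<lambda>(s, i). ?x s i" idx] by (simp add: split_def)
  also have "(\<Sum>(s, i)\<in>idx. (?x s i)^2) = (\<Sum>s<2*m. \<Sum>i\<le>2*n. (?x s i)^2)"
    by (simp add: sum.cartesian_product idx_def)
  also have "real (card idx) * \<dots> \<le> 3 / (h * k) * (10 * S)"
  proof (rule mult_mono)
    have "real (card idx) * (h * k) = (2 * real m * k) * (h * (2 * real n + 1))"
      by (simp add: idx_def card_cartesian_product algebra_simps)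
    also have "\<dots> \<le> 3" using h_count by (simp only: mk mult_1)
    finally show "real (card idx) \<le> 3 / (h * k)" using hk by (simp add: pos_le_divide_eq)
    have "(?x s i)^2 \<le> 3 * ((slope_x e s i)^2 + (slope_y e s i)^2) + 3 * (center_val e s i)^2" for s i
    proof -
      have "(x + y + z)^2 \<le> 3 * (x^2 + y^2) + 3 * z^2" for x y z :: real
      proof -
        have "0 \<le> (x - y)^2 + (y - z)^2 + (x - z)^2" by simp
        then show ?thesis by (simp add: power2_eq_square algebra_simps)
      qed
      from this[of "\<bar>slope_x e s i\<bar>" "\<bar>slope_y e s i\<bar>" "\<bar>center_val e s i\<bar>"] show ?thesis by simp
    qed
    then have "(\<Sum>s<2*m. \<Sum>i\<le>2*n. (?x s i)^2) \<le>
       (\<Sum>s<2*m. \<Sum>i\<le>2*n. 3 * ((slope_x e s i)^2 + (slope_y e s i)^2) + 3 * (center_val e s i)^2)"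
      by (intro sum_mono) auto
    also have "\<dots> = 3 * S + 3 * (\<Sum>s<2*m. \<Sum>i\<le>2*n. (center_val e s i)^2)"
      by (simp add: S_def sum.distrib sum_distrib_left)
    also have "(\<Sum>s<2*m. \<Sum>i\<le>2*n. (center_val e s i)^2) \<le> (\<Sum>s<2*m. 9 / 4 * (\<Sum>i\<le>2*n. (slope_x e s i)^2))"
      by (intro sum_mono poincare[OF e])
    also have "\<dots> \<le> 9 / 4 * S"
      unfolding S_def sum_distrib_left[symmetric] by (intro mult_left_mono sum_mono) auto
    finally show "(\<Sum>s<2*m. \<Sum>i\<le>2*n. (?x s i)^2) \<le> 10 * S" using S0 by simp
  qed (use hk in \<open>auto intro!: sum_nonneg\<close>)
  also have "3 / (h * k) * (10 * S) \<le> 120 / (h * k)^2 * energy e e"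
  proof -
    have "3 / (h * k) * (10 * S) = 120 / (h * k)^2 * (h * k / 4 * S)"
      using hk by (simp add: power2_eq_square field_simps)
    also have "\<dots> \<le> 120 / (h * k)^2 * energy e e" using aS by (intro mult_left_mono) auto
    finally show ?thesis .
  qed
  also have "120 / (h * k)^2 * energy e e \<le> (11 / (h * k) * sqrt (energy e e))^2"
    using energy_nonneg[of e] by (simp add: power_mult_distrib power_divide divide_right_mono mult_right_mono)
  finally have "T^2 \<le> (11 / (h * k) * sqrt (energy e e))^2" .
  then have "T \<le> 11 / (h * k) * sqrt (energy e e)"
    by (rule power2_le_imp_le) (use hk energy_nonneg in auto)
  then show ?thesis by (simp add: T_def)
qed

lemma consistency_bound:
  assumes e: "e \<in> dofs"
  shows "\<bar>consistency e\<bar> \<le> 11 * h^2 / k * sqrt (energy e e)"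
proof -
  have "\<bar>consistency e\<bar> \<le> (\<Sum>s<2*m. \<Sum>i\<le>2*n. \<bar>residual e s i\<bar>)"
    unfolding consistency_residual[OF e] by (intro order_trans[OF sum_abs] sum_mono sum_abs)
  also have "\<dots> \<le> (\<Sum>s<2*m. \<Sum>i\<le>2*n. h^3 * (\<bar>slope_x e s i\<bar> + \<bar>slope_y e s i\<bar> + \<bar>center_val e s i\<bar>))"
    by (intro sum_mono residual_bound[OF e]) (auto simp: idx_def)
  also have "\<dots> = h^3 * (\<Sum>s<2*m. \<Sum>i\<le>2*n. \<bar>slope_x e s i\<bar> + \<bar>slope_y e s i\<bar> + \<bar>center_val e s i\<bar>)"
    by (simp add: sum_distrib_left)
  also have "\<dots> \<le> h^3 * (11 / (h * k) * sqrt (energy e e))"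
    using sum_coeffs_bound[OF e] h_pos by (intro mult_left_mono) auto
  also have "\<dots> = 11 * h^2 / k * sqrt (energy e e)"
    using h_pos k_pos by (simp add: field_simps power2_eq_square power3_eq_cube)
  finally show ?thesis .
qed

lemma cell_offsets:
  assumes "z \<in> cell s i"
  shows "\<bar>fst z - apex_x i\<bar> \<le> h / 2" "\<bar>snd z - ymid s\<bar> \<le> k / 2"
    "apex_x i - lft i * h / 2 \<le> fst z" "fst z \<le> apex_x i + rgt i * h / 2"
proof -
  have t: "0 < depth s i (snd z)" "depth s i (snd z) < 1"
    and l: "apex_x i - lft i * depth s i (snd z) * h / 2 < fst z"
    and r: "fst z < apex_x i + rgt i * depth s i (snd z) * h / 2"
    using assms by (auto simp: cell_def split_def)
  have lt: "lft i * depth s i (snd z) \<le> lft i" "rgt i * depth s i (snd z) \<le> rgt i"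
    using t lft_nonneg[of i] rgt_nonneg[of i] by (auto intro: mult_left_le)
  then have lt: "lft i * depth s i (snd z) * h \<le> lft i * h" "rgt i * depth s i (snd z) * h \<le> rgt i * h"
    using h_pos by (auto intro: mult_right_mono)
  show lr: "apex_x i - lft i * h / 2 \<le> fst z" "fst z \<le> apex_x i + rgt i * h / 2"
    using l r lt by linarith+
  have "lft i * h \<le> h" "rgt i * h \<le> h" using h_pos by (auto simp: lft_def rgt_def)
  then show "\<bar>fst z - apex_x i\<bar> \<le> h / 2" using lr by - (intro abs_leI; linarith)
  show "\<bar>snd z - ymid s\<bar> \<le> k / 2"
  proof -
    have "snd z - ymid s = \<tau> s i * (k * (depth s i (snd z) - 1 / 2))" using k_pos by (simp add: depth_def)
    moreover have "\<bar>k * (depth s i (snd z) - 1 / 2)\<bar> \<le> k * (1 / 2)"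
    proof -
      have "\<bar>depth s i (snd z) - 1 / 2\<bar> \<le> 1 / 2" using t by - (intro abs_leI; linarith)
      then show ?thesis unfolding abs_mult using k_pos by (intro mult_mono) auto
    qed
    ultimately show ?thesis using tau_cases[of s i] by auto
  qed
qed

lemma cell_in_square:
  assumes "(s, i) \<in> idx" "z \<in> cell s i"
  shows "0 < fst z" "fst z < 1" "0 < snd z" "snd z < 1"
  using cell_bounds(1-4)[of "fst z" "snd z"] assms by auto

lemma cell_int_abs_bound:
  assumes "continuous_on UNIV g" "\<And>z. z \<in> cell s i \<Longrightarrow> \<bar>g z\<bar> \<le> B"
  shows "\<bar>cell_int s i g\<bar> \<le> B * area i"
proof -
  have "cell_int s i g \<le> B * area i"
    using cell_int_mono[OF assms(1) continuous_on_const, of s i B] assms(2) by (auto simp: cell_int_const abs_le_iff)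
  moreover have "- B * area i \<le> cell_int s i g"
    using cell_int_mono[OF continuous_on_const assms(1), of s i "- B"] assms(2)
    by (auto simp: cell_int_const abs_le_iff) (smt (verit))
  ultimately show ?thesis by (simp add: abs_le_iff)
qed

lemma load_bound:
  assumes e: "e \<in> dofs"
  shows "\<bar>load e\<bar> \<le> 6 * sqrt (energy e e)"
proof -
  have ct: "continuous_on UNIV (\<lambda>z. f_rhs z * local_poly e s i z)" for s i
    by (intro continuous_intros continuous_f_rhs continuous_local_poly)
  have one: "\<bar>cell_int s i (\<lambda>z. f_rhs z * local_poly e s i z)\<bar> \<le> h * k / 2 * (\<bar>slope_x e s i\<bar> + \<bar>slope_y e s i\<bar> + \<bar>center_val e s i\<bar>)"
    if si: "(s, i) \<in> idx" for s i
  proof -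
    let ?B = "\<bar>slope_x e s i\<bar> + \<bar>slope_y e s i\<bar> + \<bar>center_val e s i\<bar>"
    have "\<bar>f_rhs z * local_poly e s i z\<bar> \<le> ?B" if z: "z \<in> cell s i" for z
    proof (rule abs_mult_le_bound)
      note sq = cell_in_square[OF si z]
      show "\<bar>f_rhs z\<bar> \<le> 1"
        using parabola_bounds(1,2)[of "fst z"] parabola_bounds(1,2)[of "snd z"] sq
        by (simp add: f_rhs_def split_def abs_le_iff)
      have o: "\<bar>fst z - apex_x i\<bar> \<le> 1" "\<bar>snd z - ymid s\<bar> \<le> 1"
        using cell_offsets(1,2)[OF z] h_le_1 k_le by linarith+
      have "\<bar>(fst z - apex_x i) * slope_x e s i\<bar> \<le> \<bar>slope_x e s i\<bar>" "\<bar>(snd z - ymid s) * slope_y e s i\<bar> \<le> \<bar>slope_y e s i\<bar>"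
        using o by (intro abs_mult_le_bound; simp)+
      then show "\<bar>local_poly e s i z\<bar> \<le> ?B" unfolding local_poly_def by (simp add: mult.commute)
    qed
    then have "\<bar>cell_int s i (\<lambda>z. f_rhs z * local_poly e s i z)\<bar> \<le> ?B * area i"
      by (intro cell_int_abs_bound ct)
    also have "\<dots> \<le> ?B * (h * k / 2)" using area_bounds(2) by (intro mult_left_mono) auto
    finally show ?thesis by (simp add: mult.commute)
  qed
  have "\<bar>load e\<bar> \<le> (\<Sum>s<2*m. \<Sum>i\<le>2*n. \<bar>cell_int s i (\<lambda>z. f_rhs z * local_poly e s i z)\<bar>)"
    unfolding load_def by (intro order_trans[OF sum_abs] sum_mono sum_abs)
  also have "\<dots> \<le> (\<Sum>s<2*m. \<Sum>i\<le>2*n. h * k / 2 * (\<bar>slope_x e s i\<bar> + \<bar>slope_y e s i\<bar> + \<bar>center_val e s i\<bar>))"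
    by (intro sum_mono one) (auto simp: idx_def)
  also have "\<dots> = h * k / 2 * (\<Sum>s<2*m. \<Sum>i\<le>2*n. \<bar>slope_x e s i\<bar> + \<bar>slope_y e s i\<bar> + \<bar>center_val e s i\<bar>)"
    by (simp add: sum_distrib_left)
  also have "\<dots> \<le> h * k / 2 * (11 / (h * k) * sqrt (energy e e))"
    using sum_coeffs_bound[OF e] h_pos k_pos by (intro mult_left_mono) auto
  also have "\<dots> \<le> 6 * sqrt (energy e e)"
    using h_pos k_pos energy_nonneg[of e] by simp
  finally show ?thesis .
qed

lemma sum_area: "(\<Sum>s<2*m. \<Sum>i\<le>2*n. area i) \<le> 3 / 2"
proof -
  have "(\<Sum>s<2*m. \<Sum>i\<le>2*n. area i) \<le> (\<Sum>s<2*m. \<Sum>i\<le>2*n. h * k / 2)"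
    by (intro sum_mono area_bounds)
  also have "\<dots> = (2 * real m * k) * (h * (2 * real n + 1)) / 2"
    by (simp add: algebra_simps)
  also have "\<dots> \<le> 3 / 2" using h_count by (simp only: mk mult_1)
  finally show ?thesis .
qed

lemma sum_cell_int_bound:
  assumes "\<And>s i. continuous_on UNIV (g s i)" "\<And>s i z. (s, i) \<in> idx \<Longrightarrow> z \<in> cell s i \<Longrightarrow> \<bar>g s i z\<bar> \<le> B" "B \<ge> 0"
  shows "(\<Sum>s<2*m. \<Sum>i\<le>2*n. cell_int s i (g s i)) \<le> 3 / 2 * B"
proof -
  have "(\<Sum>s<2*m. \<Sum>i\<le>2*n. cell_int s i (g s i)) \<le> (\<Sum>s<2*m. \<Sum>i\<le>2*n. B * area i)"
  proof (intro sum_mono)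
    fix s i assume "s \<in> {..<2*m}" "i \<in> {..2*n}"
    then have "\<bar>cell_int s i (g s i)\<bar> \<le> B * area i"
      by (intro cell_int_abs_bound assms) (auto simp: idx_def)
    then show "cell_int s i (g s i) \<le> B * area i" by simp
  qed
  also have "\<dots> = B * (\<Sum>s<2*m. \<Sum>i\<le>2*n. area i)" by (simp add: sum_distrib_left mult_ac)
  also have "\<dots> \<le> B * (3 / 2)" using sum_area assms(3) by (intro mult_left_mono)
  finally show ?thesis by simp
qed

lemma u_energy_bound: "u_energy \<le> 2"
proof -
  have "u_energy \<le> 3 / 2 * 1"
    unfolding u_energy_def
  proof (rule sum_cell_int_bound)
    show "continuous_on UNIV (\<lambda>z. u_grad z \<bullet> u_grad z)" by (intro continuous_intros continuous_u_grad)
    fix s i z assume "(s, i) \<in> idx" "z \<in> cell s i"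
    note sq = cell_in_square[OF this]
    have "\<bar>fst (u_grad z)\<bar> \<le> 1 / 4" "\<bar>(1 - 2 * snd z) * (fst z * (1 - fst z))\<bar> \<le> 1 / 4"
      using abs_mult_le_bound[of "1 - 2 * fst z" "snd z * (1 - snd z)" "1 / 4"]
        abs_mult_le_bound[of "1 - 2 * snd z" "fst z * (1 - fst z)" "1 / 4"]
        parabola_bounds[of "fst z"] parabola_bounds[of "snd z"] sq
      by (simp_all add: u_grad_def split_def)
    moreover have "snd (u_grad z) = (1 - 2 * snd z) * (fst z * (1 - fst z))" by (simp add: u_grad_def split_def)
    ultimately have "(fst (u_grad z))^2 \<le> (1 / 4)^2" "(snd (u_grad z))^2 \<le> (1 / 4)^2"
      by (simp_all only: abs_le_square_iff[symmetric])
    then show "\<bar>u_grad z \<bullet> u_grad z\<bar> \<le> 1"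
      by (simp add: inner_prod_def power2_eq_square)
  qed simp
  then show ?thesis by simp
qed

text \<open>
Interpolation at the edge midpoints.
\<close>

definition interp :: "nat \<times> nat \<Rightarrow> real" where
  "interp t = (if t \<in> edges then u_exact (edge_mid t) else 0)"

lemma interp_dofs: "interp \<in> dofs" by (simp add: dofs_def interp_def)

lemma interp_values:
  assumes si: "(s, i) \<in> idx"
  shows "val_left interp s i = u_exact (apex_x i - lft i * h / 4, ymid s)"
    "val_right interp s i = u_exact (apex_x i + rgt i * h / 4, ymid s)"
    "val_base interp s i = u_exact (base_x i, ymid s + \<tau> s i * k / 2)"
proof -
  have s: "s < 2 * m" and i: "i \<le> 2 * n" using si by (simp_all add: idx_iff)
  note em = edge_mid_tri_edges[OF i, of s]
  have u0: "u_exact (0, y) = 0" "u_exact (1, y) = 0" "u_exact (x, 0) = 0" "u_exact (x, 1) = 0" for x y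
    by (simp_all add: u_exact_def)
  show "val_left interp s i = u_exact (apex_x i - lft i * h / 4, ymid s)"
  proof (cases "i = 0")
    case True
    then show ?thesis using dofs_boundary(1)[OF interp_dofs] by (simp add: lft_def apex_x_def u0)
  next
    case False
    then have "(2 * s + 1, i) \<in> edges" using s i by (auto simp: edges_def)
    then show ?thesis using em(1) by (simp add: val_left_def interp_def)
  qed
  show "val_right interp s i = u_exact (apex_x i + rgt i * h / 4, ymid s)"
  proof (cases "i = 2 * n")
    case True
    then show ?thesis using dofs_boundary(2)[OF interp_dofs] by (simp add: rgt_def apex_x_last u0)
  next
    case False
    then have "(2 * s + 1, i + 1) \<in> edges" using s i by (auto simp: edges_def)
    then show ?thesis using em(2) by (simp add: val_right_def interp_def)
  qed
  show "val_base interp s i = u_exact (base_x i, ymid s + \<tau> s i * k / 2)"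
  proof (cases "(2 * base_row s i, i) \<in> edges")
    case True
    then show ?thesis using em(3) by (simp add: val_base_def interp_def)
  next
    case False
    then have "base_row s i = 0 \<or> base_row s i = 2 * m"
      using s i by (auto simp: edges_def base_row_def split: if_splits)
    moreover have "4 * real m * k = 2" using mk by simp
    ultimately have "snd (edge_mid (2 * base_row s i, i)) = 0 \<or> snd (edge_mid (2 * base_row s i, i)) = 1"
      by (auto simp: edge_mid_def)
    then have "ymid s + \<tau> s i * k / 2 = 0 \<or> ymid s + \<tau> s i * k / 2 = 1" unfolding em(3) by simp
    then show ?thesis using False u0 by (auto simp: val_base_def interp_def)
  qed
qed

text \<open>
The horizontal slope of the interpolant is a difference quotient over a distance of order \<open>h\<close> and is
accurate to this order. The vertical slope compares \<open>u\<close> at the horizontal edge with the mean of its two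
values at the distance \<open>h / 4\<close> to either side, and divides by \<open>k / 2\<close>; the error \<open>q * h^2 / 16\<close> of that mean
becomes \<open>q * h^2 / (8 * k)\<close>. At a half triangle there is only one node value and no such error.
\<close>

lemma interp_gradient_error:
  assumes si: "(s, i) \<in> idx" and z: "z \<in> cell s i"
  shows "\<bar>fst (u_grad z) - slope_x interp s i\<bar> \<le> h^2 / k" "\<bar>snd (u_grad z) - slope_y interp s i\<bar> \<le> h^2 / k"
proof -
  have s: "s < 2 * m" and i: "i \<le> 2 * n" using si by (simp_all add: idx_iff)
  note sq = cell_in_square[OF si z] and off = cell_offsets[OF z]
  have hk: "h > 0" "k > 0" "h \<le> 1" "k \<le> h / 2" by (rule h_pos k_pos h_le_1 k_le)+
  define D where "D = h^2 / k"
  have h2: "2 * h \<le> D"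
  proof -
    have "2 * h * k \<le> h * h" using mult_left_mono[OF hk(4), of "2 * h"] hk by simp
    then show ?thesis using hk by (simp add: D_def pos_le_divide_eq power2_eq_square)
  qed
  define x y \<xi> \<eta> t where "x = apex_x i" and "y = ymid s" and "\<xi> = fst z - apex_x i" and "\<eta> = snd z - ymid s" and "t = \<tau> s i"
  define q q' g' where "q = y * (1 - y)" and "q' = snd z * (1 - snd z)" and "g' = fst z * (1 - fst z)"
  have yr: "0 \<le> y" "y \<le> 1" using ymid_range[OF s] by (auto simp: y_def)
  have xr: "0 \<le> x" "x \<le> 1" using apex_x_range[OF i] by (auto simp: x_def)
  have \<xi>: "\<bar>\<xi>\<bar> \<le> h / 2" and \<eta>: "\<bar>\<eta>\<bar> \<le> k / 2" using off by (simp_all add: \<xi>_def \<eta>_def)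
  have q: "0 \<le> q" "q \<le> 1 / 4" "\<bar>1 - 2 * y\<bar> \<le> 1" using parabola_bounds[OF yr] by (simp_all add: q_def)
  have q': "0 \<le> q'" "q' \<le> 1 / 4" using parabola_bounds[of "snd z"] sq by (simp_all add: q'_def)
  have g': "0 \<le> g'" "g' \<le> 1 / 4" using parabola_bounds[of "fst z"] sq by (simp_all add: g'_def)
  have qq: "\<bar>q' - q\<bar> \<le> k / 2"
    using parabola_lipschitz[of "snd z" y] sq yr \<eta> by (simp add: q_def q'_def \<eta>_def y_def)
  have t: "t = 1 \<or> t = -1" unfolding t_def by (rule tau_cases)
  have gx: "fst (u_grad z) = (1 - 2 * (x + \<xi>)) * q'" and gy: "snd (u_grad z) = g' * (1 - 2 * (y + \<eta>))"
    by (simp_all add: u_grad_def split_def g'_def q'_def x_def y_def \<xi>_def \<eta>_def)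
  have yb: "u_exact (X, y + t * k / 2) = X * (1 - X) * (q + t * k / 2 * (1 - 2 * y) - k^2 / 4)" for X
    using t by (auto simp: u_exact_def q_def power2_eq_square field_simps)
  note iv = interp_values[OF si, folded x_def y_def t_def]
  have um: "u_exact (X, y) = X * (1 - X) * q" for X by (simp add: u_exact_def q_def mult.assoc)
  \<comment> \<open>The three kinds of cells differ only in the point \<open>X\<close> at which the horizontal slope is exact, the value \<open>G\<close>
    of \<open>x * (1 - x)\<close> that enters the vertical slope, and the contribution \<open>R\<close> of the error of the mean of the node values.\<close>
  have bound: "\<bar>fst (u_grad z) - slope_x interp s i\<bar> \<le> D \<and> \<bar>snd (u_grad z) - slope_y interp s i\<bar> \<le> D"
    if b: "slope_x interp s i = (1 - 2 * X) * q" and X: "0 \<le> X" "X \<le> 1" "\<bar>fst z - X\<bar> \<le> h / 2"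
      and d: "slope_y interp s i = G * (1 - 2 * y) - t * G * k / 2 + R" and G: "0 \<le> G" "G \<le> 1" "\<bar>g' - G\<bar> \<le> h"
      and R: "\<bar>R\<bar> \<le> D / 8" for X G R
  proof
    have "(1 - 2 * (x + \<xi>)) * q' - (1 - 2 * X) * q = (1 - 2 * X) * (q' - q) + (-2) * (q' * (fst z - X))"
      by (simp add: \<xi>_def x_def algebra_simps)
    moreover have "\<bar>(1 - 2 * X) * (q' - q)\<bar> \<le> k / 2"
      using parabola_bounds(3)[OF X(1,2)] qq by (rule abs_mult_le_bound)
    moreover have "\<bar>q' * (fst z - X)\<bar> \<le> h / 2" using q' X(3) by (intro abs_mult_le_bound) auto
    ultimately have "\<bar>fst (u_grad z) - slope_x interp s i\<bar> \<le> k / 2 + 2 * (h / 2)"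
      unfolding gx b by linarith
    then show "\<bar>fst (u_grad z) - slope_x interp s i\<bar> \<le> D" using hk h2 by linarith
    have "g' * (1 - 2 * (y + \<eta>)) - (G * (1 - 2 * y) - t * G * k / 2 + R)
        = (1 - 2 * y) * (g' - G) + (-2) * (g' * \<eta>) + t * G * (k / 2) - R"
      by (simp add: algebra_simps)
    moreover have "\<bar>(1 - 2 * y) * (g' - G)\<bar> \<le> h" using q(3) G(3) by (rule abs_mult_le_bound)
    moreover have "\<bar>g' * \<eta>\<bar> \<le> k / 2" using g' \<eta> by (intro abs_mult_le_bound) auto
    moreover have "\<bar>t * G * (k / 2)\<bar> \<le> k / 2" using t G hk by (intro abs_mult_le_bound) auto
    ultimately have "\<bar>snd (u_grad z) - slope_y interp s i\<bar> \<le> h + 2 * (k / 2) + k / 2 + D / 8"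
      unfolding gy d using R by linarith
    then show "\<bar>snd (u_grad z) - slope_y interp s i\<bar> \<le> D" using hk h2 by linarith
  qed
  have q8: "\<bar>t * q * h^2 / (8 * k)\<bar> \<le> D / 8"
    using t q hk by (auto simp: D_def abs_mult field_simps mult_left_le)
  consider "i = 0" | "i = 2 * n" | "0 < i" "i < 2 * n" using i by linarith
  then have "\<bar>fst (u_grad z) - slope_x interp s i\<bar> \<le> D \<and> \<bar>snd (u_grad z) - slope_y interp s i\<bar> \<le> D"
  proof cases
    case 1
    then have lr: "lft i = 0" "rgt i = 1" "x = 0" using n_pos by (simp_all add: lft_def rgt_def x_def apex_x_def)
    have xb0: "base_x i = h / 4" using lr by (simp add: base_x_def x_def)
    have fz: "0 < fst z" "fst z \<le> h / 2" using sq off(4) lr by (simp_all add: x_def)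
    show ?thesis
    proof (rule bound[where X = "h / 8" and G = "h / 4 * (1 - h / 4)" and R = 0])
      show "slope_x interp s i = (1 - 2 * (h / 8)) * q"
        unfolding slope_x_def iv lr um end_factor_def using hk by (simp add: field_simps)
      show "slope_y interp s i = h / 4 * (1 - h / 4) * (1 - 2 * y) - t * (h / 4 * (1 - h / 4)) * k / 2 + 0"
        unfolding slope_y_def iv lr um end_factor_def xb0 yb t_def[symmetric] using hk t
        by (elim disjE) (simp_all add: field_simps power2_eq_square)
      show "0 \<le> h / 4 * (1 - h / 4)" "h / 4 * (1 - h / 4) \<le> 1"
        using parabola_bounds(1,2)[of "h / 4"] hk by auto
      have "\<bar>fst z - h / 4\<bar> \<le> h" using fz hk by (simp add: abs_le_iff)
      then show "\<bar>g' - h / 4 * (1 - h / 4)\<bar> \<le> h"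
        using parabola_lipschitz[of "fst z" "h / 4"] sq hk unfolding g'_def by simp
      show "\<bar>fst z - h / 8\<bar> \<le> h / 2" using fz hk(1) by - (rule abs_leI; linarith)
    qed (use hk h2 in auto)
  next
    case 2
    then have lr: "lft i = 1" "rgt i = 0" "x = 1" using n_pos apex_x_last by (simp_all add: lft_def rgt_def x_def)
    have xb0: "base_x i = 1 - h / 4" using lr by (simp add: base_x_def x_def)
    have fz: "fst z < 1" "1 - h / 2 \<le> fst z" using sq off(3) lr by (simp_all add: x_def)
    show ?thesis
    proof (rule bound[where X = "1 - h / 8" and G = "h / 4 * (1 - h / 4)" and R = 0])
      show "slope_x interp s i = (1 - 2 * (1 - h / 8)) * q"
        unfolding slope_x_def iv lr um end_factor_def using hk by (simp add: field_simps)
      show "slope_y interp s i = h / 4 * (1 - h / 4) * (1 - 2 * y) - t * (h / 4 * (1 - h / 4)) * k / 2 + 0"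
        unfolding slope_y_def iv lr um end_factor_def xb0 yb t_def[symmetric] using hk t
        by (elim disjE) (simp_all add: field_simps power2_eq_square)
      show "0 \<le> h / 4 * (1 - h / 4)" "h / 4 * (1 - h / 4) \<le> 1"
        using parabola_bounds(1,2)[of "h / 4"] hk by auto
      have "\<bar>fst z - (1 - h / 4)\<bar> \<le> h" using fz hk by (simp add: abs_le_iff)
      moreover have "h / 4 * (1 - h / 4) = (1 - h / 4) * (1 - (1 - h / 4))" by simp
      ultimately show "\<bar>g' - h / 4 * (1 - h / 4)\<bar> \<le> h"
        using parabola_lipschitz[of "fst z" "1 - h / 4"] sq hk unfolding g'_def by linarith
      show "\<bar>fst z - (1 - h / 8)\<bar> \<le> h / 2" using fz hk(1) by - (rule abs_leI; linarith)
    qed (use hk h2 in auto)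
  next
    case 3
    then have lr: "lft i = 1" "rgt i = 1" by (simp_all add: lft_def rgt_def)
    have xb0: "base_x i = x" using lr by (simp add: base_x_def x_def)
    show ?thesis
    proof (rule bound[where X = x and G = "x * (1 - x)" and R = "t * q * h^2 / (8 * k)"])
      show "slope_x interp s i = (1 - 2 * x) * q"
        unfolding slope_x_def iv lr um end_factor_def using hk by (simp add: field_simps)
      show "slope_y interp s i = x * (1 - x) * (1 - 2 * y) - t * (x * (1 - x)) * k / 2 + t * q * h^2 / (8 * k)"
        unfolding slope_y_def iv lr um end_factor_def xb0 yb t_def[symmetric] using hk t
        by (elim disjE) (simp_all add: field_simps power2_eq_square)
      show "0 \<le> x * (1 - x)" "x * (1 - x) \<le> 1" using parabola_bounds(1,2)[OF xr] by auto
      show "\<bar>g' - x * (1 - x)\<bar> \<le> h"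
        using parabola_lipschitz[of "fst z" x] sq xr \<xi> hk unfolding g'_def \<xi>_def x_def[symmetric] by simp
      show "\<bar>fst z - x\<bar> \<le> h / 2" using \<xi> by (simp add: \<xi>_def x_def)
    qed (use xr q8 in auto)
  qed
  then show "\<bar>fst (u_grad z) - slope_x interp s i\<bar> \<le> h^2 / k" "\<bar>snd (u_grad z) - slope_y interp s i\<bar> \<le> h^2 / k" by (auto simp: D_def)
qed

lemma error_sq_interp: "error_sq interp \<le> 3 * (h^2 / k)^2"
proof -
  have "error_sq interp \<le> 3 / 2 * (2 * (h^2 / k)^2)"
    unfolding error_sq_cells
  proof (rule sum_cell_int_bound)
    show "continuous_on UNIV (\<lambda>z. (u_grad z - slope interp s i) \<bullet> (u_grad z - slope interp s i))" for s i
      by (intro continuous_intros continuous_u_grad)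
    fix s i z assume "(s, i) \<in> idx" "z \<in> cell s i"
    note E = interp_gradient_error[OF this]
    have p: "h^2 / k \<ge> 0" using k_pos by simp
    have "(fst (u_grad z) - slope_x interp s i)^2 \<le> (h^2 / k)^2" "(snd (u_grad z) - slope_y interp s i)^2 \<le> (h^2 / k)^2"
      using E p by (simp_all only: abs_le_square_iff[symmetric] abs_of_nonneg)
    then show "\<bar>(u_grad z - slope interp s i) \<bullet> (u_grad z - slope interp s i)\<bar> \<le> 2 * (h^2 / k)^2"
      by (simp add: inner_prod_def slope_def power2_eq_square)
  qed simp
  then show ?thesis by simp
qed

lemma mesh_ratio: "h^2 / k = 2 * (real m / (real n)^2)"
  by (simp add: h_def k_def power_divide)

lemma galerkin_error_nonneg: "galerkin_error n m \<ge> 0"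
  by (rule galerkin_coefficients) (use error_sq_nonneg in auto)

lemma galerkin_error_upper: "galerkin_error n m \<le> 24 * min 1 (real m / (real n)^2)"
proof -
  define r where "r = real m / (real n)^2"
  have r: "r \<ge> 0" by (simp add: r_def)
  have "(galerkin_error n m)^2 \<le> 3 * (h^2 / k)^2 + (11 * h^2 / k)^2"
    using error_upper_bound[OF interp_dofs consistency_bound] error_sq_interp by simp
  also have "\<dots> = 124 * (h^2 / k)^2" by (simp add: power_divide power_mult_distrib)
  also have "\<dots> \<le> (24 * r)^2" by (simp add: mesh_ratio r_def[symmetric] power_mult_distrib)
  finally have 1: "galerkin_error n m \<le> 24 * r" by (rule power2_le_imp_le) (use r in simp)
  have "(galerkin_error n m)^2 \<le> 2 * u_energy + 2 * 6^2"
    by (rule error_stability[OF load_bound])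
  also have "\<dots> \<le> 24^2" using u_energy_bound by simp
  finally have 2: "galerkin_error n m \<le> 24" by (rule power2_le_imp_le) simp
  show ?thesis using 1 2 by (simp add: r_def min_def)
qed

end

section \<open>The lower bound\<close>

lemma sum_pairs: "(\<Sum>s<2*K. f s) = (\<Sum>\<sigma><K. f (2 * \<sigma>) + f (2 * \<sigma> + 1 :: nat) :: real)"
  by (induction K) (simp_all add: algebra_simps)

text \<open>
Up to a power of \<open>N\<close>, the summand is the product of \<open>1 - 2 * x\<close> and the sum of the amplitudes at the two
nodes next to \<open>x = i / N\<close>.
\<close>

lemma sum_weighted_amplitude:
  fixes N :: real
  shows "(\<Sum>i<K. (N - 2 * real i)^2 * (2 * real i * (N - real i) - 3 / 2)) =
    - 3 / 2 * N^2 * real K + (2 * N^3 + 6 * N) * (real K * (real K - 1) / 2)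
    - (10 * N^2 + 6) * ((real K - 1) * real K * (2 * real K - 1) / 6)
    + 16 * N * (real K * (real K - 1) / 2)^2
    - 8 * ((real K - 1) * real K * (2 * real K - 1) * (3 * (real K)^2 - 3 * real K - 1) / 30)"
proof (induction K)
  case (Suc K)
  show ?case unfolding sum.lessThan_Suc Suc.IH of_nat_Suc
    by (simp add: field_simps power2_eq_square power3_eq_cube)
qed simp

lemma sum_alternating_quadratic:
  "(\<Sum>i<2*K. (-1) ^ i * (A + B * real i + C * (real i)^2)) =
    - (B * real K) - C * (2 * (real K)^2 - real K)"
  unfolding sum_pairs
  by (induction K) (simp_all add: algebra_simps power2_eq_square)

lemma sum_odd_squares: "(\<Sum>\<sigma><K. (M - (2 * real \<sigma> + 1))^2) = real K * (M^2 - 2 * M * real K + (4 * (real K)^2 - 1) / 3)"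
  by (induction K) (simp_all add: field_simps power2_eq_square)

context anisotropic_mesh begin

text \<open>
The test function of the lower bound. Its node values alternate in sign along a strip and from strip
to strip, and have the amplitude \<open>alpha * beta\<close>. Here \<open>alpha\<close> is \<open>1 - 2 * y\<close> at the common
side of the strips \<open>2 * \<sigma>\<close> and \<open>2 * \<sigma> + 1\<close>, and \<open>beta\<close> samples \<open>x * (1 - x) * (1 - 2 * x)\<close>, so that
the amplitude has the sign of the mixed derivative of \<open>u\<close>. The factor \<open>x * (1 - x)\<close> makes the values next to
the vertical sides of order \<open>h\<close>; the half triangles there have no second node with which the first
could cancel. The amplitude is the same for both strips of a pair: the parts of the residual that do not
depend on the orientation of the cell, multiplied by the alternating slope and mean value, then cancel
within the pair.
\<close>

definition alpha :: "nat \<Rightarrow> real" where "alpha \<sigma> = 1 - (2 * real \<sigma> + 1) / real m"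
definition bump :: "real \<Rightarrow> real" where "bump x = x * (1 - x) * (1 - 2 * x)"
definition beta :: "nat \<Rightarrow> real" where "beta j = bump ((2 * real j - 1) * h / 4)"
definition osc :: "nat \<times> nat \<Rightarrow> real" where
  "osc t = (if t \<in> edges \<and> odd (fst t)
     then (-1) ^ (fst t div 2 + snd t) * alpha (fst t div 2 div 2) * beta (snd t) else 0)"

lemma osc_dofs: "osc \<in> dofs" by (simp add: dofs_def osc_def)

lemma beta_at_vertex: "beta i = bump (apex_x i - h / 4)" "beta (Suc i) = bump (apex_x i + h / 4)"
  by (simp_all add: beta_def apex_x_def field_simps)

lemma beta_ends: "beta (Suc 0) = bump (h / 4)" "beta (2 * n) = - bump (h / 4)"
proof -
  show "beta (Suc 0) = bump (h / 4)" by (simp add: beta_def)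
  have "beta (2 * n) = bump (1 - h / 4)" using beta_at_vertex(1)[of "2 * n"] apex_x_last by simp
  also have "\<dots> = - bump (h / 4)" unfolding bump_def by algebra
  finally show "beta (2 * n) = - bump (h / 4)" .
qed

lemma osc_values:
  assumes "(s, i) \<in> idx"
  shows "val_base osc s i = 0"
    "val_left osc s i = (if i = 0 then 0 else \<tau> s i * alpha (s div 2) * beta i)"
    "val_right osc s i = (if i = 2 * n then 0 else - (\<tau> s i * alpha (s div 2) * beta (Suc i)))"
proof -
  have s: "s < 2 * m" and i: "i \<le> 2 * n" using assms by (simp_all add: idx_iff)
  have d: "(2 * s + 1) div 2 = s" by simp
  show "val_base osc s i = 0" by (simp add: val_base_def osc_def)
  show "val_left osc s i = (if i = 0 then 0 else \<tau> s i * alpha (s div 2) * beta i)"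
    using s i by (simp add: val_left_def osc_def d \<tau>_def edges_def)
  show "val_right osc s i = (if i = 2 * n then 0 else - (\<tau> s i * alpha (s div 2) * beta (Suc i)))"
    using s i by (simp add: val_right_def osc_def d \<tau>_def edges_def)
qed

text \<open>
The vertical slope does not oscillate: the sign of the node values and the orientation of the
cell cancel.
\<close>

lemma osc_interior:
  assumes si: "(s, i) \<in> idx" "0 < i" "i < 2 * n"
  shows "slope_x osc s i = - (2 / h * \<tau> s i * alpha (s div 2) * (beta i + beta (Suc i)))"
    "center_val osc s i = \<tau> s i * alpha (s div 2) * (beta i - beta (Suc i)) / 2"
    "slope_y osc s i = - (alpha (s div 2) / k * (beta i - beta (Suc i)))"
  using osc_values[OF si(1)] si h_pos k_pos tau_cases[of s i]
  by (auto simp: slope_x_def center_val_def slope_y_def end_factor_def lft_def rgt_def field_simps)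

lemma osc_boundary:
  assumes s: "s < 2 * m"
  shows "slope_x osc s 0 = - (4 / h * \<tau> s 0 * alpha (s div 2) * bump (h / 4))"
    "slope_y osc s 0 = 2 / k * alpha (s div 2) * bump (h / 4)"
    "- slope_x osc s (2 * n) = - (4 / h * \<tau> s (2 * n) * alpha (s div 2) * bump (h / 4))"
    "slope_y osc s (2 * n) = 2 / k * alpha (s div 2) * bump (h / 4)"
proof -
  have tn: "\<tau> s (2 * n) = \<tau> s 0" by (simp add: \<tau>_def power_add)
  have lr: "lft 0 = 0" "rgt 0 = 1" "lft (2 * n) = 1" "rgt (2 * n) = 0"
    using n_pos by (simp_all add: lft_def rgt_def)
  have v0: "val_base osc s 0 = 0" "val_left osc s 0 = 0" "val_right osc s 0 = - (\<tau> s 0 * alpha (s div 2) * bump (h / 4))"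
    using osc_values[of s 0] s n_pos by (simp_all add: idx_iff beta_ends)
  have v1: "val_base osc s (2 * n) = 0" "val_left osc s (2 * n) = - (\<tau> s 0 * alpha (s div 2) * bump (h / 4))" "val_right osc s (2 * n) = 0"
    using osc_values[of s "2 * n"] s n_pos by (simp_all add: idx_iff beta_ends tn)
  show "slope_x osc s 0 = - (4 / h * \<tau> s 0 * alpha (s div 2) * bump (h / 4))"
    "slope_y osc s 0 = 2 / k * alpha (s div 2) * bump (h / 4)"
    "- slope_x osc s (2 * n) = - (4 / h * \<tau> s (2 * n) * alpha (s div 2) * bump (h / 4))"
    "slope_y osc s (2 * n) = 2 / k * alpha (s div 2) * bump (h / 4)"
    unfolding slope_x_def slope_y_def end_factor_def lr v0 v1 tn by (simp_all add: mult_ac)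
qed

lemma ymid_pair: "ymid (2 * \<sigma>) = (1 - alpha \<sigma> - k) / 2" "ymid (2 * \<sigma> + 1) = (1 - alpha \<sigma> + k) / 2"
  using n_pos n_le_m by (simp_all add: ymid_def alpha_def k_def field_simps)

text \<open>
The first term is the gain. The second one telescopes along the strip, and the third is an alternating
sum; both are of lower order.
\<close>

lemma osc_residual_interior:
  assumes \<sigma>: "\<sigma> < m" and i: "0 < i" "i < 2 * n"
  shows "residual osc (2 * \<sigma>) i + residual osc (2 * \<sigma> + 1) i = - (alpha \<sigma>)\<^sup>2 *
    ((k^2 / 3 + h^2 / 4) * ((1 - 2 * apex_x i) * (beta i + beta (Suc i)))
      + h^3 / 48 * (beta i - beta (Suc i)) + h * k^2 / 6 * ((-1) ^ i * (beta i - beta (Suc i))))"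
proof -
  define a t x p q where "a = alpha \<sigma>" and "t = (-1 :: real) ^ i" and "x = apex_x i"
    and "p = beta i + beta (Suc i)" and "q = beta i - beta (Suc i)"
  have t: "t = 1 \<or> t = -1" unfolding t_def by (cases "even i") simp_all
  have tau: "\<tau> (2 * \<sigma>) i = t" "\<tau> (2 * \<sigma> + 1) i = - t" by (simp_all add: \<tau>_def t_def power_add)
  have si: "(2 * \<sigma>, i) \<in> idx" "(2 * \<sigma> + 1, i) \<in> idx" using \<sigma> i by (simp_all add: idx_iff)
  have d: "(2 * \<sigma>) div 2 = \<sigma>" "(2 * \<sigma> + 1) div 2 = \<sigma>" by simp_all
  have hk: "h \<noteq> 0" "k \<noteq> 0" using h_pos k_pos by auto
  show ?thesis
    unfolding residual_interior[OF osc_dofs i] osc_interior[OF si(1) i] osc_interior[OF si(2) i] d tau ymid_pair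
      a_def[symmetric] t_def[symmetric] x_def[symmetric] p_def[symmetric] q_def[symmetric]
    using t hk by (elim disjE) (simp_all add: field_simps power2_eq_square power3_eq_cube power4_eq_xxxx)
qed

lemma osc_residual_boundary:
  assumes \<sigma>: "\<sigma> < m"
  shows "residual osc (2 * \<sigma>) 0 + residual osc (2 * \<sigma> + 1) 0 =
      - (alpha \<sigma>)\<^sup>2 * (bump (h / 4) * (h\<^sup>2 / 12 - h^3 / 48 + k\<^sup>2 / 3 - h * k\<^sup>2 / 6))"
    "residual osc (2 * \<sigma>) (2 * n) + residual osc (2 * \<sigma> + 1) (2 * n) =
      - (alpha \<sigma>)\<^sup>2 * (bump (h / 4) * (h\<^sup>2 / 12 - h^3 / 48 + k\<^sup>2 / 3 - h * k\<^sup>2 / 6))"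
proof -
  define a p where "a = alpha \<sigma>" and "p = bump (h / 4)"
  have tau: "\<tau> (2 * \<sigma>) 0 = 1" "\<tau> (2 * \<sigma> + 1) 0 = - 1" "\<tau> (2 * \<sigma>) (2 * n) = 1" "\<tau> (2 * \<sigma> + 1) (2 * n) = - 1"
    by (simp_all add: \<tau>_def)
  have s: "2 * \<sigma> < 2 * m" "2 * \<sigma> + 1 < 2 * m" using \<sigma> by simp_all
  have d: "(2 * \<sigma>) div 2 = \<sigma>" "(2 * \<sigma> + 1) div 2 = \<sigma>" by simp_all
  have hk: "h \<noteq> 0" "k \<noteq> 0" using h_pos k_pos by auto
  show "residual osc (2 * \<sigma>) 0 + residual osc (2 * \<sigma> + 1) 0 =
      - (alpha \<sigma>)\<^sup>2 * (bump (h / 4) * (h\<^sup>2 / 12 - h^3 / 48 + k\<^sup>2 / 3 - h * k\<^sup>2 / 6))"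
    unfolding residual_left[OF osc_dofs] osc_boundary[OF s(1)] osc_boundary[OF s(2)] d tau ymid_pair
      a_def[symmetric] p_def[symmetric] half_residual_x_def half_residual_y_def
    using hk by (simp add: field_simps power2_eq_square power3_eq_cube power4_eq_xxxx)
  show "residual osc (2 * \<sigma>) (2 * n) + residual osc (2 * \<sigma> + 1) (2 * n) =
      - (alpha \<sigma>)\<^sup>2 * (bump (h / 4) * (h\<^sup>2 / 12 - h^3 / 48 + k\<^sup>2 / 3 - h * k\<^sup>2 / 6))"
    unfolding residual_right[OF osc_dofs] osc_boundary[OF s(1)] osc_boundary[OF s(2)] d tau ymid_pair
      a_def[symmetric] p_def[symmetric] half_residual_x_def half_residual_y_def
    using hk by (simp add: field_simps power2_eq_square power3_eq_cube power4_eq_xxxx)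
qed

text \<open>
The sum of the residuals over a pair of strips is \<open>- alpha^2\<close> times this quantity.
\<close>

definition osc_gain :: real where
  "osc_gain = (\<Sum>i\<in>{1..<2*n}. (k^2 / 3 + h^2 / 4) * ((1 - 2 * apex_x i) * (beta i + beta (Suc i)))
      + h^3 / 48 * (beta i - beta (Suc i)) + h * k^2 / 6 * ((-1) ^ i * (beta i - beta (Suc i))))
    + 2 * (bump (h / 4) * (h^2 / 12 - h^3 / 48 + k^2 / 3 - h * k^2 / 6))"

lemma consistency_osc: "consistency osc = - (\<Sum>\<sigma><m. (alpha \<sigma>)^2) * osc_gain"
proof -
  have split: "(\<Sum>i\<le>2*n. f i) = (\<Sum>i\<in>{1..<2*n}. f i) + f 0 + f (2 * n)" for f :: "nat \<Rightarrow> real"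
  proof -
    have "{..2*n} = insert 0 (insert (2 * n) {1..<2*n})" using n_pos by auto
    then show ?thesis using n_pos by simp
  qed
  have "consistency osc = (\<Sum>\<sigma><m. \<Sum>i\<le>2*n. residual osc (2 * \<sigma>) i + residual osc (2 * \<sigma> + 1) i)"
    unfolding consistency_residual[OF osc_dofs] sum_pairs by (simp add: sum.distrib)
  also have "\<dots> = (\<Sum>\<sigma><m. - (alpha \<sigma>)\<^sup>2 * osc_gain)"
  proof (intro sum.cong refl)
    fix \<sigma> assume "\<sigma> \<in> {..<m}"
    then have \<sigma>: "\<sigma> < m" by simp
    show "(\<Sum>i\<le>2*n. residual osc (2 * \<sigma>) i + residual osc (2 * \<sigma> + 1) i) = - (alpha \<sigma>)\<^sup>2 * osc_gain"
      unfolding split osc_residual_boundary[OF \<sigma>] osc_gain_def distrib_left sum_distrib_left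
      by (simp add: osc_residual_interior[OF \<sigma>, simplified] sum_distrib_left distrib_left)
  qed
  finally show ?thesis by (simp add: sum_distrib_right sum_negf)
qed

lemma telescope_from_one: "M \<ge> 1 \<Longrightarrow> (\<Sum>i\<in>{1..<M}. f i - f (Suc i)) = f 1 - (f M :: real)"
  by (induction M rule: nat_induct_at_least) simp_all

text \<open>
With \<open>N = 2 * n\<close> the sums have closed forms that are rational in \<open>N\<close>. The part with the factor \<open>k^2\<close> is
nonnegative and is dropped. The rest behaves like \<open>h / 30\<close> for large \<open>n\<close>, and it exceeds \<open>h / 200\<close> for
all \<open>N \<ge> 2\<close>, because in terms of \<open>N - 2\<close> the difference has nonnegative coefficients only.
\<close>

lemma osc_gain_lower: "osc_gain \<ge> h / 200"
proof -
  define N where "N = 2 * real n"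
  have N: "N \<ge> 2" using n_pos by (simp add: N_def)
  have rN: "real (2 * n) = N" by (simp add: N_def)
  have hN: "h = 2 / N" using n_pos by (simp add: h_def N_def)
  have xN: "apex_x i = real i / N" for i by (simp add: apex_x_def hN)
  define S1 where "S1 = (\<Sum>i\<in>{1..<2*n}. (1 - 2 * apex_x i) * (beta i + beta (Suc i)))"
  define SA where "SA = (\<Sum>i\<in>{1..<2*n}. (-1) ^ i * (beta i - beta (Suc i)))"
  define B where "B = 2 * bump (h / 4)"
  have from1: "(\<Sum>i\<in>{1..<2*n}. f i) = (\<Sum>i<2*n. f i) - f 0" for f :: "nat \<Rightarrow> real"
  proof -
    have "{..<2*n} = insert 0 {1..<2*n}" using n_pos by auto
    then show ?thesis by simp
  qed
  have B: "B = (1 - 3 / (2 * N) + 1 / (2 * N^2)) / N"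
    using N by (simp add: B_def bump_def hN field_simps power2_eq_square)
  have S1: "S1 = (N - 1) * (N - 2) * ((N + 1) * (N + 2) / 15 - 1 / 2) / N^3"
  proof -
    have "(1 - 2 * apex_x i) * (beta i + beta (Suc i)) = (N - 2 * real i)^2 * (2 * real i * (N - real i) - 3 / 2) / N^4" for i
      unfolding beta_at_vertex bump_def xN hN using N by (simp add: field_simps power2_eq_square power3_eq_cube power4_eq_xxxx)
    then have "S1 = (\<Sum>i\<in>{1..<2*n}. (N - 2 * real i)^2 * (2 * real i * (N - real i) - 3 / 2)) / N^4"
      by (simp add: S1_def sum_divide_distrib)
    also have "(\<Sum>i\<in>{1..<2*n}. (N - 2 * real i)^2 * (2 * real i * (N - real i) - 3 / 2))
        = N * ((N - 1) * (N - 2) * ((N + 1) * (N + 2) / 15 - 1 / 2))"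
      unfolding from1 sum_weighted_amplitude rN
      by (simp add: field_simps power2_eq_square power3_eq_cube power4_eq_xxxx)
    also have "\<dots> / N^4 = (N - 1) * (N - 2) * ((N + 1) * (N + 2) / 15 - 1 / 2) / N^3"
      using N by (simp add: power4_eq_xxxx power3_eq_cube)
    finally show ?thesis .
  qed
  have SA: "SA = 1 / N - 3 / N^2 + 1 / (2 * N^3)"
  proof -
    have "beta i - beta (Suc i) = - (1 / N + 1 / (2 * N^3)) + 6 / N^2 * real i + (- 6 / N^3) * (real i)^2" for i
      unfolding beta_at_vertex bump_def xN hN using N by (simp add: field_simps power2_eq_square power3_eq_cube)
    then have "SA = (\<Sum>i\<in>{1..<2*n}. (-1) ^ i * (- (1 / N + 1 / (2 * N^3)) + 6 / N^2 * real i + (- 6 / N^3) * (real i)^2))"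
      by (simp add: SA_def)
    moreover have "real n = N / 2" by (simp add: N_def)
    ultimately show ?thesis
      unfolding from1 sum_alternating_quadratic using N
      by (simp add: field_simps power2_eq_square power3_eq_cube)
  qed
  have tel: "(\<Sum>i\<in>{1..<2*n}. beta i - beta (Suc i)) = B"
    using telescope_from_one[of "2 * n" beta] n_pos by (simp add: beta_ends B_def)
  have "osc_gain = (k^2 / 3 + h^2 / 4) * S1 + h^3 / 48 * B + h * k^2 / 6 * SA
      + B * (h^2 / 12 - h^3 / 48 + k^2 / 3 - h * k^2 / 6)"
    unfolding osc_gain_def S1_def SA_def
    by (simp only: sum.distrib sum_distrib_left[symmetric] tel) (simp add: B_def)
  also have "\<dots> = k^2 * (S1 / 3 + (h / 6 * SA + (1 / 3 - h / 6) * B)) + h^2 / 4 * (S1 + B / 3)"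
    by (simp add: algebra_simps)
  finally have L: "osc_gain = k^2 * (S1 / 3 + (h / 6 * SA + (1 / 3 - h / 6) * B)) + h^2 / 4 * (S1 + B / 3)" .
  have "0 \<le> S1"
  proof -
    have "3 * 4 \<le> (N + 1) * (N + 2)" using N by (intro mult_mono) auto
    then show ?thesis unfolding S1 using N by (intro divide_nonneg_nonneg mult_nonneg_nonneg) auto
  qed
  moreover have "0 \<le> h / 6 * SA + (1 / 3 - h / 6) * B"
  proof -
    have "h / 6 * SA + (1 / 3 - h / 6) * B = (N - 2) * (N + 1 / 2) / (3 * N^3)"
      unfolding SA B hN using N by (simp add: field_simps power2_eq_square power3_eq_cube)
    then show ?thesis using N by simp
  qed
  ultimately have 1: "0 \<le> k^2 * (S1 / 3 + (h / 6 * SA + (1 / 3 - h / 6) * B))" by simp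
  have "h^2 / 4 * (S1 + B / 3) - 1 / (100 * N) =
      ((N - 1) * (N - 2) * ((N + 1) * (N + 2) / 15 - 1 / 2) + (N - 1) * (N - 1 / 2) / 3 - N^4 / 100) / N^5"
    unfolding S1 B hN using N by (simp add: field_simps eval_nat_numeral)
  also have "\<dots> \<ge> 0"
  proof -
    define t where "t = N - 2"
    have t: "t \<ge> 0" "N = t + 2" using N by (simp_all add: t_def)
    have "(N - 1) * (N - 2) * ((N + 1) * (N + 2) / 15 - 1 / 2) + (N - 1) * (N - 1 / 2) / 3 - N^4 / 100
      = 17 / 300 * t^4 + 34 / 75 * t^3 + 43 / 50 * t^2 + 61 / 75 * t + 17 / 50"
      unfolding t(2) by (simp add: field_simps eval_nat_numeral)
    also have "\<dots> \<ge> 0" using t(1) by simp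
    finally show ?thesis using N by simp
  qed
  finally have "h^2 / 4 * (S1 + B / 3) \<ge> 1 / (100 * N)" by simp
  moreover have "h / 200 = 1 / (100 * N)" by (simp add: hN)
  ultimately show ?thesis using 1 L by linarith
qed

text \<open>
The sum equals \<open>(m^2 - 1) / (3 * m)\<close>, which is zero for \<open>m = 1\<close>: then \<open>alpha\<close> vanishes on the only pair of
strips.
\<close>

lemma sum_alpha: "m \<ge> 2 \<Longrightarrow> (\<Sum>\<sigma><m. (alpha \<sigma>)^2) \<ge> real m / 4"
proof -
  assume m: "m \<ge> 2"
  have "(alpha \<sigma>)^2 = (real m - (2 * real \<sigma> + 1))^2 / (real m)^2" for \<sigma>
    using m by (simp add: alpha_def power_divide[symmetric] diff_divide_distrib)
  then have "(\<Sum>\<sigma><m. (alpha \<sigma>)^2) = (\<Sum>\<sigma><m. (real m - (2 * real \<sigma> + 1))^2) / (real m)^2"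
    by (simp add: sum_divide_distrib)
  also have "\<dots> = ((real m)^2 - 1) / (3 * real m)"
    unfolding sum_odd_squares using m by (simp add: field_simps power2_eq_square)
  also have "\<dots> \<ge> real m / 4"
  proof -
    have "2 * 2 \<le> real m * real m" using m by (intro mult_mono) auto
    then show ?thesis using m by (simp add: field_simps power2_eq_square)
  qed
  finally show ?thesis .
qed

lemma alpha_bound: "\<sigma> < m \<Longrightarrow> \<bar>alpha \<sigma>\<bar> \<le> 1"
proof -
  assume s: "\<sigma> < m"
  then have "2 * real \<sigma> + 1 \<le> 2 * real m" using of_nat_le_iff[of "\<sigma> + 1" m, where 'a = real] by simp
  then have "0 \<le> (2 * real \<sigma> + 1) / real m" "(2 * real \<sigma> + 1) / real m \<le> 2" using s by (simp_all add: divide_simps)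
  then show ?thesis by (simp add: alpha_def abs_le_iff)
qed

lemma bump_bound: "0 \<le> x \<Longrightarrow> x \<le> 1 \<Longrightarrow> \<bar>bump x\<bar> \<le> 1 / 4"
  using abs_mult_le_bound[of "1 - 2 * x" "x * (1 - x)" "1 / 4"] parabola_bounds[of x]
  by (simp add: bump_def mult.commute)

lemma osc_gradient_bound:
  assumes si: "(s, i) \<in> idx"
  shows "\<bar>slope_x osc s i\<bar> \<le> 1 / h" "\<bar>slope_y osc s i\<bar> \<le> h / k"
proof -
  have s: "s < 2 * m" and i: "i \<le> 2 * n" using si by (simp_all add: idx_iff)
  have hk: "h > 0" "k > 0" "h \<le> 1" by (rule h_pos k_pos h_le_1)+
  let ?a = "alpha (s div 2)"
  have a: "\<bar>?a\<bar> \<le> 1" by (rule alpha_bound) (use s in simp)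
  have ta: "\<bar>\<tau> s i * ?a\<bar> \<le> 1" using tau_cases[of s i] a by auto
  have b4: "\<bar>bump (h / 4)\<bar> \<le> 1 / 4" "\<bar>bump (h / 4)\<bar> \<le> h / 4"
  proof -
    show "\<bar>bump (h / 4)\<bar> \<le> 1 / 4" using bump_bound[of "h / 4"] hk by simp
    have "\<bar>(1 - h / 4) * (1 - 2 * (h / 4)) * (h / 4)\<bar> \<le> h / 4"
    proof (rule abs_mult_le_bound)
      show "\<bar>(1 - h / 4) * (1 - 2 * (h / 4))\<bar> \<le> 1"
        by (rule abs_mult_le_bound) (use hk in \<open>auto simp: abs_le_iff\<close>)
    qed (use hk in simp)
    then show "\<bar>bump (h / 4)\<bar> \<le> h / 4" by (simp add: bump_def mult_ac)
  qed
  have bdry: "\<bar>4 / h * u * bump (h / 4)\<bar> \<le> 1 / h" "\<bar>2 / k * u * bump (h / 4)\<bar> \<le> h / k" if "\<bar>u\<bar> \<le> 1" for u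
  proof -
    have "\<bar>u * bump (h / 4)\<bar> \<le> 1 / 4" "\<bar>u * bump (h / 4)\<bar> \<le> h / 4"
      using that b4 by (intro abs_mult_le_bound; simp)+
    then have "4 / h * \<bar>u * bump (h / 4)\<bar> \<le> 4 / h * (1 / 4)" "2 / k * \<bar>u * bump (h / 4)\<bar> \<le> 2 / k * (h / 4)"
      using hk by (intro mult_left_mono; simp)+
    moreover have "2 / k * (h / 4) \<le> h / k" using hk by (simp add: field_simps)
    moreover have "\<bar>4 / h * u * bump (h / 4)\<bar> = 4 / h * \<bar>u * bump (h / 4)\<bar>" "\<bar>2 / k * u * bump (h / 4)\<bar> = 2 / k * \<bar>u * bump (h / 4)\<bar>"
      using hk by (simp_all add: abs_mult)
    ultimately show "\<bar>4 / h * u * bump (h / 4)\<bar> \<le> 1 / h" "\<bar>2 / k * u * bump (h / 4)\<bar> \<le> h / k" by simp_all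
  qed
  consider "i = 0" | "i = 2 * n" | "0 < i" "i < 2 * n" using i by linarith
  then have "\<bar>slope_x osc s i\<bar> \<le> 1 / h \<and> \<bar>slope_y osc s i\<bar> \<le> h / k"
  proof cases
    case 1
    then show ?thesis using osc_boundary(1,2)[OF s] bdry[OF ta] bdry[OF a] by (simp add: mult.assoc)
  next
    case 2
    have "\<bar>slope_x osc s i\<bar> = \<bar>- slope_x osc s (2 * n)\<bar>" by (simp add: 2)
    then show ?thesis using osc_boundary(3,4)[OF s] bdry[OF ta] bdry[OF a] 2 by (simp add: mult.assoc)
  next
    case 3
    define x where "x = apex_x i"
    have xr: "0 \<le> x - h / 4" "x + h / 4 \<le> 1"
    proof -
      have "0 \<le> apex_x (i - 1)" "apex_x (Suc i) \<le> 1" using apex_x_range[of "i - 1"] apex_x_range[of "Suc i"] 3 by auto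
      moreover have "apex_x (i - 1) = x - h / 2" "apex_x (Suc i) = x + h / 2"
        using 3 by (auto simp: x_def apex_x_def of_nat_diff field_simps)
      ultimately show "0 \<le> x - h / 4" "x + h / 4 \<le> 1" using hk by auto
    qed
    have x01: "0 \<le> x" "x \<le> 1" using xr hk by auto
    have "\<bar>beta i\<bar> \<le> 1 / 4" "\<bar>beta (Suc i)\<bar> \<le> 1 / 4"
      unfolding beta_at_vertex(1)[of i] beta_at_vertex(2)[of i] x_def[symmetric] using xr hk by (intro bump_bound; linarith)+
    then have "\<bar>beta i + beta (Suc i)\<bar> \<le> 1 / 2" using abs_triangle_ineq[of "beta i" "beta (Suc i)"] by linarith
    then have "\<bar>\<tau> s i * ?a * (beta i + beta (Suc i))\<bar> \<le> 1 / 2" by (rule abs_mult_le_bound[OF ta])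
    then have "2 / h * \<bar>\<tau> s i * ?a * (beta i + beta (Suc i))\<bar> \<le> 2 / h * (1 / 2)"
      using hk by (intro mult_left_mono) auto
    moreover have "\<bar>slope_x osc s i\<bar> = 2 / h * \<bar>\<tau> s i * ?a * (beta i + beta (Suc i))\<bar>"
      unfolding osc_interior[OF si 3] using hk by (simp add: abs_mult)
    ultimately have b: "\<bar>slope_x osc s i\<bar> \<le> 1 / h" by simp
    have diff: "beta i - beta (Suc i) = - (h / 2 * (1 - 6 * (x * (1 - x)) + h^2 / 8))"
      unfolding beta_at_vertex(1)[of i] beta_at_vertex(2)[of i] x_def[symmetric] bump_def by (simp add: field_simps power2_eq_square)
    have "\<bar>1 - 6 * (x * (1 - x)) + h^2 / 8\<bar> \<le> 2"
      using parabola_bounds(1,2)[OF x01] hk power_le_one[of h 2] zero_le_power2[of h] by - (rule abs_leI; linarith)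
    then have "h / 2 * \<bar>1 - 6 * (x * (1 - x)) + h^2 / 8\<bar> \<le> h / 2 * 2" using hk by (intro mult_left_mono) auto
    then have "\<bar>beta i - beta (Suc i)\<bar> \<le> h" unfolding diff using hk by (simp add: abs_mult)
    then have "\<bar>?a * (beta i - beta (Suc i))\<bar> \<le> h" by (rule abs_mult_le_bound[OF a])
    then have "1 / k * \<bar>?a * (beta i - beta (Suc i))\<bar> \<le> 1 / k * h" using hk by (intro mult_left_mono) auto
    moreover have "\<bar>slope_y osc s i\<bar> = 1 / k * \<bar>?a * (beta i - beta (Suc i))\<bar>"
      unfolding osc_interior[OF si 3] using hk by (simp add: abs_mult)
    ultimately show ?thesis using b by simp
  qed
  then show "\<bar>slope_x osc s i\<bar> \<le> 1 / h" "\<bar>slope_y osc s i\<bar> \<le> h / k" by auto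
qed

lemma energy_osc: "energy osc osc \<le> 3 / 2 * (1 / h^2 + h^2 / k^2)"
proof -
  have "energy osc osc \<le> (\<Sum>s<2*m. \<Sum>i\<le>2*n. area i * (1 / h^2 + h^2 / k^2))"
    unfolding energy_def
  proof (intro sum_mono mult_left_mono add_mono)
    fix s i assume "s \<in> {..<2*m}" "i \<in> {..2*n}"
    then have "(s, i) \<in> idx" by (simp add: idx_def)
    note B = osc_gradient_bound[OF this]
    have p: "0 \<le> 1 / h" "0 \<le> h / k" using h_pos k_pos by auto
    have "(slope_x osc s i)^2 \<le> (1 / h)^2" "(slope_y osc s i)^2 \<le> (h / k)^2"
      using B p by (simp_all only: abs_le_square_iff[symmetric] abs_of_nonneg)
    then show "slope_x osc s i * slope_x osc s i \<le> 1 / h^2" "slope_y osc s i * slope_y osc s i \<le> h^2 / k^2"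
      by (simp_all add: power2_eq_square power_divide)
  qed (use area_pos in \<open>auto intro: less_imp_le\<close>)
  also have "\<dots> = (\<Sum>s<2*m. \<Sum>i\<le>2*n. area i) * (1 / h^2 + h^2 / k^2)"
    by (simp only: sum_distrib_right)
  also have "\<dots> \<le> 3 / 2 * (1 / h^2 + h^2 / k^2)" using sum_area by (intro mult_right_mono) auto
  finally show ?thesis by simp
qed

lemma consistency_zero: "consistency (\<lambda>t. 0) = 0"
  using consistency_linear[of "\<lambda>t. 0" 1 "\<lambda>t. 0"] by simp

lemma energy_pos_of_consistency: "e \<in> dofs \<Longrightarrow> consistency e \<noteq> 0 \<Longrightarrow> energy e e > 0"
  using energy_definite[of e] energy_nonneg[of e] consistency_zero by (metis order_le_less)

text \<open>
With \<open>r = m / n^2\<close>, the consistency functional of \<open>osc\<close> is at least of order \<open>r / h\<close>, and its norm at most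
of order \<open>sqrt (1 + r^2) / h\<close>. The quotient is of order \<open>min 1 r\<close>.
\<close>

lemma galerkin_error_lower:
  assumes m: "m \<ge> 2"
  shows "1 / 2200 * min 1 (real m / (real n)^2) \<le> galerkin_error n m"
proof -
  define r where "r = real m / (real n)^2"
  define E where "E = galerkin_error n m"
  define D where "D = h^2 / k"
  have hk: "h > 0" "k > 0" by (rule h_pos k_pos)+
  have r: "r > 0" using n_pos m by (simp add: r_def)
  have D: "D = 2 * r" by (simp add: D_def r_def mesh_ratio)
  have E: "E \<ge> 0" by (simp add: E_def galerkin_error_nonneg)
  have "real m / 4 * (h / 200) \<le> (\<Sum>\<sigma><m. (alpha \<sigma>)^2) * osc_gain"
    using sum_alpha[OF m] osc_gain_lower hk by (intro mult_mono) (auto intro!: sum_nonneg)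
  moreover have "real m = 1 / (2 * k)" using m by (simp add: k_def)
  then have mD: "real m / 4 * (h / 200) = D / (1600 * h)"
    using hk by (simp add: D_def field_simps power2_eq_square)
  ultimately have L: "D / (1600 * h) \<le> \<bar>consistency osc\<bar>" by (simp add: consistency_osc)
  have Dp: "D > 0" using r D by simp
  have "consistency osc \<noteq> 0" using L Dp hk by (smt (verit) divide_pos_pos mult_pos_pos)
  then have "energy osc osc > 0" by (rule energy_pos_of_consistency[OF osc_dofs])
  then have "(consistency osc)^2 \<le> E^2 * energy osc osc" unfolding E_def by (rule error_lower_bound[OF osc_dofs])
  also have "\<dots> \<le> E^2 * (3 / 2 * (1 / h^2 + h^2 / k^2))" using energy_osc by (intro mult_left_mono) auto
  also have "\<dots> = E^2 * (3 / 2 * (1 + D^2)) / h^2"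
    using hk by (simp add: D_def field_simps power2_eq_square)
  finally have "(consistency osc)^2 \<le> E^2 * (3 / 2 * (1 + D^2)) / h^2" .
  moreover have "(D / (1600 * h))^2 \<le> (consistency osc)^2"
    using L Dp hk by (simp add: abs_le_square_iff[symmetric] abs_of_pos)
  ultimately have "D^2 / 2560000 / h^2 \<le> E^2 * (3 / 2 * (1 + D^2)) / h^2"
    by (simp add: power_divide power_mult_distrib)
  then have "D^2 / 2560000 \<le> E^2 * (3 / 2 * (1 + D^2))" using hk(1) unfolding divide_le_cancel by simp
  then have main: "4 * r^2 \<le> 3840000 * (E^2 * (1 + 4 * r^2))" by (simp add: D power_mult_distrib algebra_simps)
  define \<mu> where "\<mu> = min 1 r"
  have mu: "0 < \<mu>" "\<mu> \<le> 1" "\<mu> \<le> r" using r by (auto simp: \<mu>_def)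
  have "4 * \<mu>^2 * (1 + 4 * r^2) \<le> 20 * r^2"
  proof -
    have "\<mu>^2 \<le> r^2" "\<mu>^2 \<le> 1^2" using mu by (intro power_mono; simp)+
    then have "\<mu>^2 * r^2 \<le> 1 * r^2" by (intro mult_right_mono) auto
    then show ?thesis using \<open>\<mu>^2 \<le> r^2\<close> by (simp add: algebra_simps)
  qed
  also have "\<dots> \<le> 19200000 * E^2 * (1 + 4 * r^2)" using main by simp
  finally have "4 * \<mu>^2 \<le> 19200000 * E^2" by (rule mult_right_le_imp_le) (simp add: add_pos_nonneg)
  then have "\<mu>^2 \<le> 4840000 * E^2" using zero_le_power2[of E] by linarith
  then have "\<mu>^2 \<le> (2200 * E)^2" by (simp add: power_mult_distrib)
  then have "\<mu> \<le> 2200 * E" by (rule power2_le_imp_le) (use E in simp)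
  then show ?thesis by (simp add: \<mu>_def r_def E_def)
qed

text \<open>
On the coarsest mesh \<open>osc\<close> is zero. As this is a single mesh, positivity of the error suffices, and
a test function with one nonzero edge value shows it.
\<close>

lemma galerkin_error_pos_coarsest:
  assumes n1: "n = 1" and m1: "m = 1"
  shows "galerkin_error n m > 0"
proof -
  define e :: "nat \<times> nat \<Rightarrow> real" where "e = (\<lambda>t. if t = (1, 1) then 1 else 0)"
  have nm: "2 * n = 2" "2 * m = 2" using n1 m1 by simp_all
  have "(1, 1) \<in> edges" using n_pos n_le_m by (simp add: edges_def)
  then have e: "e \<in> dofs" by (auto simp: dofs_def e_def)
  have "real n = 1" "real m = 1" using n1 m1 by simp_all
  then have hk: "h = 1" "k = 1 / 2" using nh mk by simp_all
  have c: "slope_x e 0 0 = 4" "slope_y e 0 0 = - 4" "slope_x e 0 1 = - 2" "slope_y e 0 1 = 2" "center_val e 0 1 = 1 / 2"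
    by (simp_all add: slope_x_def slope_y_def center_val_def val_left_def val_right_def val_base_def e_def end_factor_def lft_def rgt_def nm hk \<tau>_def base_row_def)
  have z: "residual e s i = 0" if "(s, i) \<in> idx" "(s, i) \<noteq> (0, 0)" "(s, i) \<noteq> (0, 1)" for s i
  proof -
    have "val_left e s i = 0" "val_right e s i = 0" "val_base e s i = 0"
      using that by (auto simp: val_left_def val_right_def val_base_def e_def idx_iff)
    then have "slope_x e s i = 0" "slope_y e s i = 0" "center_val e s i = 0" by (simp_all add: slope_x_def slope_y_def center_val_def)
    then show ?thesis using residual_bound[OF e that(1)] by simp
  qed
  have "consistency e = (\<Sum>(s, i)\<in>idx. residual e s i)"
    by (simp add: consistency_residual[OF e] sum.cartesian_product idx_def)
  also have "\<dots> = (\<Sum>(s, i)\<in>{(0, 0), (0, 1)}. residual e s i)"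
  proof (rule sum.mono_neutral_right[OF finite_idx])
    show "{(0, 0), (0, 1)} \<subseteq> idx" by (auto simp: idx_iff nm)
    show "\<forall>x\<in>idx - {(0, 0), (0, 1)}. (case x of (s, i) \<Rightarrow> residual e s i) = 0"
    proof
      fix x assume x: "x \<in> idx - {(0, 0), (0, 1)}"
      obtain a b where ab: "x = (a, b)" by fastforce
      have "residual e a b = 0" by (rule z) (use x in \<open>simp_all add: ab\<close>)
      then show "(case x of (s, i) \<Rightarrow> residual e s i) = 0" by (simp add: ab)
    qed
  qed
  also have "\<dots> = residual e 0 0 + residual e 0 1" by simp
  also have "\<dots> = 1 / 48"
    using residual_interior[OF e, of 1 0] c
    by (simp add: residual_left[OF e] half_residual_x_def half_residual_y_def c nm hk ymid_def apex_x_def \<tau>_def power2_eq_square power3_eq_cube power4_eq_xxxx)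
  finally have "consistency e = 1 / 48" .
  then have L: "consistency e \<noteq> 0" by simp
  have "galerkin_error n m \<noteq> 0"
    using error_lower_bound[OF e energy_pos_of_consistency[OF e L]] L by auto
  then show ?thesis using galerkin_error_nonneg by simp
qed

end

lemma galerkin_error_two_sided:
  "\<exists>C4 > 0. \<exists>C4' > 0. \<forall>n m :: nat. 1 \<le> n \<and> n \<le> m \<longrightarrow>
        C4' * min 1 (real m / (real n)^2) \<le> galerkin_error n m \<and>
        galerkin_error n m \<le> C4 * min 1 (real m / (real n)^2)"
proof -
  have mesh: "anisotropic_mesh n m" if "1 \<le> n" "n \<le> m" for n m
    using that by unfold_locales
  \<comment> \<open>The pair \<open>m = n = 1\<close> is the only one not covered by the constant \<open>1 / 2200\<close>.\<close>
  define c where "c = min (1 / 2200) (galerkin_error 1 1)"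
  have c: "c > 0"
    using anisotropic_mesh.galerkin_error_pos_coarsest[OF mesh[of 1 1]] by (simp add: c_def)
  have low: "c * min 1 (real m / (real n)^2) \<le> galerkin_error n m" if nm: "1 \<le> n" "n \<le> m" for n m
  proof (cases "m \<ge> 2")
    case True
    have "c * min 1 (real m / (real n)^2) \<le> 1 / 2200 * min 1 (real m / (real n)^2)"
      by (intro mult_right_mono) (auto simp: c_def)
    also have "\<dots> \<le> galerkin_error n m"
      by (rule anisotropic_mesh.galerkin_error_lower[OF mesh[OF nm] True])
    finally show ?thesis .
  next
    case False
    then have "n = 1" "m = 1" using nm by auto
    then show ?thesis by (simp add: c_def)
  qed
  show ?thesis
    using c low anisotropic_mesh.galerkin_error_upper[OF mesh]
    by (intro exI[of _ 24] exI[of _ c] conjI) auto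
qed

text \<open>
As soon as the minimum of \<open>1\<close> and the ratio is less than \<open>1\<close>, it is the ratio.
\<close>

lemma ratio_tendsto_zero:
  fixes N M :: "nat \<Rightarrow> nat"
  assumes NM: "\<And>k. 1 \<le> N k \<and> N k \<le> M k"
    and E: "(\<lambda>k. galerkin_error (N k) (M k)) \<longlonglongrightarrow> 0"
  shows "(\<lambda>k. real (M k) / (real (N k))^2) \<longlonglongrightarrow> 0"
proof -
  obtain c where c: "c > 0" "\<And>n m. 1 \<le> n \<Longrightarrow> n \<le> m \<Longrightarrow> c * min 1 (real m / (real n)^2) \<le> galerkin_error n m"
    using galerkin_error_two_sided by blast
  define r where "r = (\<lambda>k. real (M k) / (real (N k))^2)"
  have "(\<lambda>k. galerkin_error (N k) (M k) / c) \<longlonglongrightarrow> 0 / c"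
    using c(1) by (intro tendsto_divide E tendsto_const) auto
  then have lim: "(\<lambda>k. galerkin_error (N k) (M k) / c) \<longlonglongrightarrow> 0" by simp
  have b: "min 1 (r k) \<le> galerkin_error (N k) (M k) / c" for k
    using c(2)[of "N k" "M k"] NM[of k] c(1) by (simp add: r_def pos_le_divide_eq mult.commute)
  have "r \<longlonglongrightarrow> 0"
  proof (rule tendsto_sandwich)
    show "\<forall>\<^sub>F k in sequentially. 0 \<le> r k" by (simp add: r_def)
    have "\<forall>\<^sub>F k in sequentially. galerkin_error (N k) (M k) / c < 1"
      using lim by (rule order_tendstoD) simp
    then show "\<forall>\<^sub>F k in sequentially. r k \<le> galerkin_error (N k) (M k) / c"
      by eventually_elim (use b in \<open>smt (verit)\<close>)
  qed (use lim in auto)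
  then show ?thesis by (simp add: r_def)
qed

theorem theorem3:
  shows "(poisson_solution f_rhs u_exact \<and>
          (\<forall>w. poisson_solution f_rhs w \<longrightarrow> (\<forall>z \<in> unit_square. w z = u_exact z))) \<and>
    (\<exists>C4 > 0. \<exists>C4' > 0. \<forall>n m :: nat. 1 \<le> n \<and> n \<le> m \<longrightarrow>
        C4' * min 1 (real m / (real n)\<^sup>2) \<le> galerkin_error n m \<and>
        galerkin_error n m \<le> C4 * min 1 (real m / (real n)\<^sup>2)) \<and>
    (\<forall>N M :: nat \<Rightarrow> nat. (\<forall>k. 1 \<le> N k \<and> N k \<le> M k) \<longrightarrow>
        filterlim N at_top sequentially \<longrightarrow>
        (\<lambda>k. galerkin_error (N k) (M k)) \<longlonglongrightarrow> 0 \<longrightarrow>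
        (\<lambda>k. real (M k) / (real (N k))\<^sup>2) \<longlonglongrightarrow> 0)"
proof (intro conjI allI impI ballI)
  show "poisson_solution f_rhs u_exact" by (rule poisson_u_exact)
  show "w z = u_exact z" if "poisson_solution f_rhs w" "z \<in> unit_square" for w z
    using that by (rule poisson_unique)
  show "(\<lambda>k. real (M k) / (real (N k))\<^sup>2) \<longlonglongrightarrow> 0"
    if "\<forall>k. 1 \<le> N k \<and> N k \<le> M k" "(\<lambda>k. galerkin_error (N k) (M k)) \<longlonglongrightarrow> 0" for N M
    using that by (intro ratio_tendsto_zero) simp_all
qed (rule galerkin_error_two_sided)

end
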